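(* Assume $1/2<s<1$. Let $\theta_0\in L^1\cap L^\infty(\mathbb{R}^2)$ and $z_0\in\mathbb{R}^2$. Then there exist $\theta\in L^\infty(\mathbb{R}_+;L^1\cap L^\infty(\mathbb{R}^2))$ and $z\in C^0(\mathbb{R}_+;\mathbb{R}^2)$ such that $(\theta,z)$ is a weak solution of the vortex-wave system with initial datum $(\theta_0,z_0)$. More precisely, with $v=K_s\star\theta$ and $H(t,x)=K_s(x-z(t))$, for every $T>0$ and every test function $\psi\in\mathcal{D}([0,T)\times\mathbb{R}^2)$, $$\int_0^T\int_{\mathbb{R}^2}\theta(t,x)\Big(\frac{\partial\psi}{\partial t}(t,x)+(v+H)(t,x)\cdot\nabla\psi(t,x)\Big)\mathrm{d}x\,\mathrm{d}t+\int_{\mathbb{R}^2}\theta_0(x)\psi(0,x)\,\mathrm{d}x=0,$$ and $z$ is a solution of the integral equation $$z(t)=z_0+\int_0^tv(\tau,z(\tau))\,\mathrm{d}\tau .$$ Moreover, this solution satisfies $\|\theta(t,\cdot)\|_{L^p}\le\|\theta_0\|_{L^p}$ for all $p\in[1,+\infty]$. Finally, the function $\theta$ is continuous in time with values in $L^1\cap L^\infty(\mathbb{R}^2)$ equipped with the weak-$\star$ topology.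
   Context: For $x=(x_1,x_2)\in\mathbb{R}^2$, $x^\perp=(-x_2,x_1)$. $K_s(x):=c_s\,\frac{x^\perp}{|x|^{4-2s}}$ for $x\ne0$, with $c_s=\frac{(1-s)\Gamma(1-s)}{2^{2s-1}\pi\Gamma(s)}$; it is the kernel of $-\nabla^\perp(-\Delta)^{-s}$. Gradients and convolutions are in the space variable. $\mathcal{D}([0,T)\times\mathbb{R}^2)$ denotes smooth functions compactly supported in $[0,T)\times\mathbb{R}^2$ (not required to vanish at $t=0$). *)

theory Defs
  imports "HOL-Probability.Probability"
begin

section \<open>Lebesgue spaces\<close>

text \<open>Classes of functions modulo equality almost everywhere are represented by their
  Lebesgue measurable members.  The exponent ranges over \<open>[1, \<infinity>]\<close>.\<close>

definition Lp_norm :: "ennreal \<Rightarrow> ('a::euclidean_space \<Rightarrow> real) \<Rightarrow> ennreal" where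
  "Lp_norm p f =
     (if p = \<infinity> then esssup lebesgue (\<lambda>x. ennreal \<bar>f x\<bar>)
      else let I = \<integral>\<^sup>+ x. ennreal (\<bar>f x\<bar> powr enn2real p) \<partial>lebesgue
           in if I = \<infinity> then \<infinity> else ennreal (enn2real I powr (1 / enn2real p)))"

definition Lp :: "ennreal \<Rightarrow> ('a::euclidean_space \<Rightarrow> real) set" where
  "Lp p = {f \<in> borel_measurable lebesgue. Lp_norm p f < \<infinity>}"

definition L1_Linf :: "('a::euclidean_space \<Rightarrow> real) set" where
  "L1_Linf = Lp 1 \<inter> Lp \<infinity>"

text \<open>The space \<open>L\<^sup>\<infinity>(\<real>\<^sub>+; L\<^sup>1 \<inter> L\<^sup>\<infinity>)\<close>.  Since \<open>L\<^sup>\<infinity>\<close> is not separable, measurability in time is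
  understood, as usual, as joint Lebesgue measurability in \<open>(t, x)\<close>.\<close>

definition Linf_time_L1_Linf :: "(real \<Rightarrow> 'a::euclidean_space \<Rightarrow> real) set" where
  "Linf_time_L1_Linf =
     {\<theta>. (\<lambda>(t, x). \<theta> t x) \<in> borel_measurable (lebesgue_on ({0..} \<times> UNIV)) \<and>
         (\<exists>C<\<infinity>. AE t in lebesgue_on {0..}.
            \<theta> t \<in> L1_Linf \<and> Lp_norm 1 (\<theta> t) + Lp_norm \<infinity> (\<theta> t) \<le> C)}"

text \<open>\<open>L\<^sup>1 \<inter> L\<^sup>\<infinity>\<close> is the dual of \<open>L\<^sup>1 + C\<^sub>0\<close>, where \<open>C\<^sub>0\<close> consists of the continuous functions
  vanishing at infinity: the dual of \<open>C\<^sub>0\<close> is the space of finite signed measures, and those that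
  are also in the dual of \<open>L\<^sup>1\<close> have a bounded density.  The weak-\<open>\<star>\<close> topology is the coarsest
  one making the pairings with the predual continuous.\<close>

definition C0_space :: "('a::euclidean_space \<Rightarrow> real) set" where
  "C0_space = {\<phi>. continuous_on UNIV \<phi> \<and> (\<phi> \<longlongrightarrow> 0) at_infinity}"

definition predual_L1_Linf :: "('a::euclidean_space \<Rightarrow> real) set" where
  "predual_L1_Linf = {\<lambda>x. f x + g x | f g. f \<in> Lp 1 \<and> g \<in> C0_space}"

definition weak_star_L1_Linf :: "('a::euclidean_space \<Rightarrow> real) topology" where
  "weak_star_L1_Linf =
     pullback_topology L1_Linf
       (\<lambda>f. \<lambda>\<phi>\<in>predual_L1_Linf. LINT x|lebesgue. f x * \<phi> x)
       (product_topology (\<lambda>_. euclideanreal) predual_L1_Linf)"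

section \<open>Test functions\<close>

text \<open>Derivatives are taken within \<open>S\<close>, so that for \<open>S = [0, T) \<times> \<real>\<^sup>2\<close> smoothness is meant up to
  the boundary \<open>t = 0\<close>; they are unique there, because \<open>S\<close> contains the limits of enough difference
  quotients at each of its points.\<close>

primrec Ck_on :: "nat \<Rightarrow> 'a::euclidean_space set \<Rightarrow> ('a \<Rightarrow> real) \<Rightarrow> bool" where
  "Ck_on 0 S f \<longleftrightarrow> continuous_on S f"
| "Ck_on (Suc k) S f \<longleftrightarrow>
     (\<exists>f'. (\<forall>x\<in>S. (f has_derivative f' x) (at x within S)) \<and> (\<forall>h. Ck_on k S (\<lambda>x. f' x h)))"

definition smooth_on :: "'a::euclidean_space set \<Rightarrow> ('a \<Rightarrow> real) \<Rightarrow> bool" where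
  "smooth_on S f \<longleftrightarrow> (\<forall>k. Ck_on k S f)"

text \<open>Only the values on \<open>[0, T) \<times> \<real>\<^sup>2\<close> of a test function matter.\<close>

definition test_functions :: "real \<Rightarrow> (real \<times> (real^2) \<Rightarrow> real) set" where
  "test_functions T =
     {\<psi>. smooth_on ({0..<T} \<times> UNIV) \<psi> \<and>
         (\<exists>K. compact K \<and> K \<subseteq> {0..<T} \<times> UNIV \<and> (\<forall>p \<in> ({0..<T} \<times> UNIV) - K. \<psi> p = 0))}"

text \<open>The time derivative is one-sided at \<open>t = 0\<close>.\<close>

definition time_deriv :: "real \<Rightarrow> (real \<times> (real^2) \<Rightarrow> real) \<Rightarrow> real \<Rightarrow> real^2 \<Rightarrow> real" where
  "time_deriv T \<psi> t x = vector_derivative (\<lambda>\<tau>. \<psi> (\<tau>, x)) (at t within {0..<T})"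

definition grad :: "('a::real_inner \<Rightarrow> real) \<Rightarrow> 'a \<Rightarrow> 'a" where
  "grad f x = (THE D. GDERIV f x :> D)"

section \<open>The kernel\<close>

definition perp :: "real^2 \<Rightarrow> real^2" where
  "perp x = vector [- x $ 2, x $ 1]"

definition c_const :: "real \<Rightarrow> real" where
  "c_const s = (1 - s) * Gamma (1 - s) / (2 powr (2 * s - 1) * pi * Gamma s)"

text \<open>At the singularity the conventions of the library give \<open>K_kernel s 0 = 0\<close>.\<close>

definition K_kernel :: "real \<Rightarrow> real^2 \<Rightarrow> real^2" where
  "K_kernel s x = (c_const s / norm x powr (4 - 2 * s)) *\<^sub>R perp x"

definition convol :: "('a::euclidean_space \<Rightarrow> 'b::euclidean_space) \<Rightarrow> ('a \<Rightarrow> real) \<Rightarrow> 'a \<Rightarrow> 'b" where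
  "convol K f x = (LINT y|lebesgue. f y *\<^sub>R K (x - y))"

section \<open>The vortex-wave system\<close>

definition velocity :: "real \<Rightarrow> (real \<Rightarrow> real^2 \<Rightarrow> real) \<Rightarrow> real \<Rightarrow> real^2 \<Rightarrow> real^2" where
  "velocity s \<theta> t = convol (K_kernel s) (\<theta> t)"

definition vortex_field :: "real \<Rightarrow> (real \<Rightarrow> real^2) \<Rightarrow> real \<Rightarrow> real^2 \<Rightarrow> real^2" where
  "vortex_field s z t x = K_kernel s (x - z t)"

end

theory Submission
  imports Defs
begin

text \<open>The solution is a weak limit of a monotone difference scheme of Lax--Friedrichs type in which the
  space variable stays continuous.  The kernel is regularised to \<open>K\<^sub>\<epsilon> = \<nabla>\<^sup>\<bottom>p\<^sub>\<epsilon>\<close>, and one step replaces \<open>f\<close>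
  by a combination \<open>\<Sum>j<4. w\<^sub>j(x) f(x + q\<^sub>j)\<close> of four translates, whose weights are differences of the
  stream function of the regularised velocity around a small square.  Since these differences
  telescope, the weights and their translates both sum to \<open>1\<close>: the step is a discrete transport by a
  divergence free field, and by Jensen it decreases every \<open>L\<^sup>p\<close> norm.  The vortex is moved by an
  Euler step.

  Tested against \<open>C\<^sup>1\<^sup>,\<^sup>1\<close> functions the scheme is equicontinuous in time, so a diagonal subsequence
  converges weakly at all times.  As \<open>1/2 < s\<close>, the kernel is locally integrable and bounded away from
  the origin, hence the velocities converge locally uniformly and the singular fluxes converge, even
  though the vorticity converges only weakly.  The case of \<open>H\<close> is the same because \<open>K\<^sub>s(\<cdot> - z)\<close> is
  integrable near \<open>z\<close> and the trajectories \<open>z\<close> converge.\<close>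

section \<open>Density in \<open>L\<^sup>1\<close> and weak limits\<close>

text \<open>The exponent decides everything: with \<open>b = 4 - 2 * s\<close> the kernel has size
  |x|^(1-b), which is integrable near the origin of the plane exactly when b < 3, that is s > 1/2.
  Hence replacing the kernel by its regularisation changes velocities and vortex fluxes by at most a
  multiple of \<open>vel_gap\<close>, uniformly over all vorticities with the same sup and L^1
  bounds. Limits can therefore be taken at a fixed regularisation, where kernels are bounded and
  Lipschitz and weak convergence is enough.

  The parameters come from a balance. Each step spreads mass over a distance of order
  \<open>mesh\<close>, so its numerical diffusion per unit time is of order mesh^2 / tstep, and the
  choices make this ratio equal to 2 eps; the Courant condition for nonnegative weights holds with
  equality.

  A second obstacle is measurability in time. The limit vorticity is chosen at each time separately,
  and only its pairings with test functions are determined. Joint measurability is recovered by one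
  more weak limit, in space-time, corrected on a null set of times so that the pairings stay right
  at every time.\<close>

lemma countable_rational_points:
  "countable {a::'a::euclidean_space. \<forall>i\<in>Basis. a \<bullet> i \<in> \<rat>}"
proof -
  have "{a::'a. \<forall>i\<in>Basis. a \<bullet> i \<in> \<rat>} \<subseteq> (\<lambda>f. \<Sum>i\<in>Basis. f i *\<^sub>R i) ` (Basis \<rightarrow>\<^sub>E \<rat>)"
  proof
    fix a :: 'a assume a: "a \<in> {a. \<forall>i\<in>Basis. a \<bullet> i \<in> \<rat>}"
    show "a \<in> (\<lambda>f. \<Sum>i\<in>Basis. f i *\<^sub>R i) ` (Basis \<rightarrow>\<^sub>E \<rat>)"
      by (rule image_eqI[where x="restrict (\<lambda>i. a \<bullet> i) Basis"])
        (use a in \<open>auto simp: euclidean_representation\<close>)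
  qed
  moreover have "countable (Basis \<rightarrow>\<^sub>E (\<rat>::real set) :: ('a \<Rightarrow> real) set)"
    by (intro countable_PiE) (auto simp: countable_rat)
  ultimately show ?thesis
    by (meson countable_image countable_subset)
qed

definition rational_box :: "'a::euclidean_space \<Rightarrow> 'a \<Rightarrow> bool" where
  "rational_box a b \<longleftrightarrow> (\<forall>i\<in>Basis. a \<bullet> i \<in> \<rat> \<and> b \<bullet> i \<in> \<rat>)"

lemma borel_eq_rational_boxes:
  "(borel :: 'a::euclidean_space measure) = sigma UNIV {box a b |a b. rational_box a b}"
proof (rule borel_eq_countable_basis)
  have "countable ((\<lambda>(a,b). box a b) ` ({a::'a. \<forall>i\<in>Basis. a \<bullet> i \<in> \<rat>} \<times> {a. \<forall>i\<in>Basis. a \<bullet> i \<in> \<rat>}))"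
    using countable_rational_points by blast
  then show "countable {box a b |a b::'a. rational_box a b}"
    by (rule countable_subset[rotated]) (auto simp: rational_box_def)
  show "topological_basis {box a b |a b::'a. rational_box a b}"
  proof (rule topological_basisI)
    fix O' :: "'a set" and x assume "open O'" "x \<in> O'"
    then obtain e where e: "e > 0" "ball x e \<subseteq> O'" by (auto simp: open_contains_ball)
    obtain a b where "\<forall>i\<in>Basis. a \<bullet> i \<in> \<rat> \<and> b \<bullet> i \<in> \<rat>" "x \<in> box a b" "box a b \<subseteq> ball x e"
      using rational_boxes[OF e(1)] by blast
    then show "\<exists>B'\<in>{box a b |a b. rational_box a b}. x \<in> B' \<and> B' \<subseteq> O'"
      using e(2) unfolding rational_box_def by (intro bexI[of _ "box a b"]) auto
  qed (auto simp: open_box)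
qed

lemma integrable_indicator_inter_box:
  assumes "A \<in> sets borel"
  shows "integrable lborel (indicator (A \<inter> box a b) :: 'a::euclidean_space \<Rightarrow> real)"
proof -
  have "emeasure lborel (A \<inter> box a b) \<le> emeasure lborel (box a b)"
    by (intro emeasure_mono) auto
  also have "\<dots> < \<infinity>" by (simp add: emeasure_lborel_box_eq)
  finally show ?thesis using assms by (intro integrable_real_indicator) auto
qed

text \<open>Boxes generate the Borel sets and are stable under intersection, so a Dynkin argument
  inside a bounded box gives all its Borel subsets; sets of finite measure and then integrable
  functions follow by dominated limits. Rational corners keep the generators countable, as diagonal
  extraction requires.\<close>

lemma L1_induct [consumes 1, case_names box add scale lim]:
  fixes f :: "'a::euclidean_space \<Rightarrow> real"
  assumes f: "integrable lborel f"
    and box: "\<And>a b. rational_box a b \<Longrightarrow> P (indicator (box a b))"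
    and add: "\<And>f g. integrable lborel f \<Longrightarrow> integrable lborel g \<Longrightarrow> P f \<Longrightarrow> P g \<Longrightarrow> P (\<lambda>x. f x + g x)"
    and scale: "\<And>c f. integrable lborel f \<Longrightarrow> P f \<Longrightarrow> P (\<lambda>x. c * f x)"
    and lim: "\<And>f. integrable lborel f \<Longrightarrow>
       (\<And>e. e > 0 \<Longrightarrow> \<exists>g. integrable lborel g \<and> P g \<and> (\<integral>x. \<bar>f x - g x\<bar> \<partial>lborel) \<le> e) \<Longrightarrow> P f"
  shows "P f"
proof -
  \<comment> \<open>A dominated pointwise limit is an L^1 limit, so \<open>lim\<close> applies.
    Every passage to the limit below goes through this fact.\<close>
  have dom: "P f" if "f \<in> borel_measurable borel" "integrable lborel w" "\<And>n. integrable lborel (s n)" "\<And>n. P (s n)"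
    "\<And>x. (\<lambda>n. s n x) \<longlonglongrightarrow> f x" "\<And>n x. \<bar>s n x\<bar> \<le> w x" for f w and s :: "nat \<Rightarrow> 'a \<Rightarrow> real"
  proof (rule lim)
    have fw: "\<bar>f x\<bar> \<le> w x" for x
      by (rule LIMSEQ_le_const2[OF tendsto_rabs[OF that(5)]]) (use that(6) in auto)
    show fi: "integrable lborel f"
    proof (rule Bochner_Integration.integrable_bound[OF that(2)])
      show "AE x in lborel. norm (f x) \<le> norm (w x)"
      proof (rule AE_I2)
        fix x show "norm (f x) \<le> norm (w x)" using fw[of x] by simp
      qed
    qed (use that(1) in simp)
    have "(\<lambda>n. \<integral>x. \<bar>f x - s n x\<bar> \<partial>lborel) \<longlonglongrightarrow> (\<integral>x. 0 \<partial>(lborel::'a measure))"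
    proof (rule integral_dominated_convergence[where w="\<lambda>x. 2 * w x"])
      show "AE x in lborel. (\<lambda>n. \<bar>f x - s n x\<bar>) \<longlonglongrightarrow> 0"
      proof (rule AE_I2)
        fix x
        have "(\<lambda>n. \<bar>f x - s n x\<bar>) \<longlonglongrightarrow> \<bar>f x - f x\<bar>" by (intro tendsto_intros that(5))
        then show "(\<lambda>n. \<bar>f x - s n x\<bar>) \<longlonglongrightarrow> 0" by simp
      qed
      show "AE x in lborel. norm \<bar>f x - s n x\<bar> \<le> 2 * w x" for n
      proof (rule AE_I2)
        fix x show "norm \<bar>f x - s n x\<bar> \<le> 2 * w x" using fw[of x] that(6)[of n x] by auto
      qed
      show "(\<lambda>x. \<bar>f x - s i x\<bar>) \<in> borel_measurable lborel" for i
        using that(1) borel_measurable_integrable[OF that(3)[of i]] by measurable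
    qed (use that(2) in auto)
    then have lim0: "(\<lambda>n. \<integral>x. \<bar>f x - s n x\<bar> \<partial>lborel) \<longlonglongrightarrow> 0" by simp
    fix e :: real assume "e > 0"
    then have "eventually (\<lambda>n. (\<integral>x. \<bar>f x - s n x\<bar> \<partial>lborel) < e) sequentially"
      using order_tendstoD(2)[OF lim0] by blast
    then obtain n where "(\<integral>x. \<bar>f x - s n x\<bar> \<partial>lborel) < e" by (auto simp: eventually_sequentially)
    then show "\<exists>g. integrable lborel g \<and> P g \<and> (\<integral>x. \<bar>f x - g x\<bar> \<partial>lborel) \<le> e"
      using that(3,4) by (intro exI[of _ "s n"]) auto
  qed
  \<comment> \<open>Intersecting with a bounded box keeps all indicators integrable, including those
    of the complements met in the induction over the sigma-algebra.\<close>
  define Q :: "nat \<Rightarrow> 'a set" where "Q k = box (- real k *\<^sub>R One) (real k *\<^sub>R One)" for k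
  have Qi: "integrable lborel (indicator (A \<inter> Q k) :: 'a \<Rightarrow> real)" if "A \<in> sets borel" for A k
    unfolding Q_def by (rule integrable_indicator_inter_box[OF that])
  have PQ: "P (indicator (A \<inter> Q k))" if "A \<in> sets borel" for A k
  proof -
    let ?G = "{box a b |a b::'a. rational_box a b}"
    have sets: "sets borel = sigma_sets UNIV ?G"
      unfolding borel_eq_rational_boxes by (rule sets_measure_of) auto
    have inter: "\<exists>a'' b''. rational_box a'' b'' \<and> box a b \<inter> box a' b' = box a'' b''"
      if "rational_box a b" "rational_box a' b'" for a b a' b' :: 'a
    proof (intro exI conjI)
      show "box a b \<inter> box a' b' = box (\<Sum>i\<in>Basis. max (a\<bullet>i) (a'\<bullet>i) *\<^sub>R i) (\<Sum>i\<in>Basis. min (b\<bullet>i) (b'\<bullet>i) *\<^sub>R i)"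
        by (rule box_Int_box)
      show "rational_box (\<Sum>i\<in>Basis. max (a\<bullet>i) (a'\<bullet>i) *\<^sub>R i) (\<Sum>i\<in>Basis. min (b\<bullet>i) (b'\<bullet>i) *\<^sub>R i)"
        using that by (auto simp: rational_box_def max_def min_def)
    qed
    have ratQ: "rational_box (- real k *\<^sub>R One) (real k *\<^sub>R (One::'a))"
      by (auto simp: rational_box_def)
    have "Int_stable ?G"
      unfolding Int_stable_def using inter by blast
    moreover have "?G \<subseteq> Pow UNIV" by simp
    moreover have "A \<in> sigma_sets UNIV ?G" using that sets by simp
    ultimately show ?thesis
    proof (induction rule: sigma_sets_induct_disjoint)
      case basic
      then show ?case unfolding Q_def using inter[OF _ ratQ] box by fastforce
    next
      case empty
      have "P (indicator (Q k))" unfolding Q_def using ratQ box by blast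
      then have "P (\<lambda>x. 0 * indicator (Q k) x)" using Qi[of UNIV k] by (intro scale) auto
      moreover have "(\<lambda>x. 0 * indicator (Q k) x) = (indicator ({} \<inter> Q k) :: 'a \<Rightarrow> real)" by auto
      ultimately show ?case by simp
    next
      case (compl A)
      have A: "A \<in> sets borel" using compl sets by simp
      have "P (indicator (Q k))" unfolding Q_def using ratQ box by blast
      then have "P (\<lambda>x. indicator (Q k) x + (-1) * indicator (A \<inter> Q k) x)"
        using Qi[of UNIV k] Qi[OF A] compl by (intro add scale) auto
      moreover have "(\<lambda>x. indicator (Q k) x + (-1) * indicator (A \<inter> Q k) x) = (indicator ((UNIV - A) \<inter> Q k) :: 'a \<Rightarrow> real)"
        by (auto simp: indicator_def)
      ultimately show ?case by simp
    next
      case (union A)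
      have A: "A i \<in> sets borel" for i using union sets by auto
      have P0: "P (\<lambda>x. 0)" using scale[OF Qi[OF A] union(3), where c=0] by simp
      have Pn: "P (\<lambda>x. \<Sum>i<n. indicator (A i \<inter> Q k) x)" for n
      proof (induction n)
        case (Suc n)
        have "P (\<lambda>x. (\<Sum>i<n. indicator (A i \<inter> Q k) x) + indicator (A n \<inter> Q k) x)"
          by (intro add Bochner_Integration.integrable_sum Qi A Suc union)
        then show ?case by simp
      qed (use P0 in auto)
      show ?case
      proof (rule dom[where s="\<lambda>n x. \<Sum>i<n. indicator (A i \<inter> Q k) x" and w="indicator (Q k)"])
        show "(indicator (\<Union> (range A) \<inter> Q k) :: 'a \<Rightarrow> real) \<in> borel_measurable borel"
          using Qi[of "\<Union> (range A)" k] A by auto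
        have disj: "disjoint_family (\<lambda>i. A i \<inter> Q k)"
          using union(1) by (auto simp: disjoint_family_on_def)
        have eq: "(\<Sum>i<n. indicator (A i \<inter> Q k) x) = (indicator ((\<Union>i<n. A i) \<inter> Q k) x :: real)" for n x
        proof -
          have "(\<Union>i<n. A i) \<inter> Q k = (\<Union>i<n. A i \<inter> Q k)" by auto
          moreover have "disjoint_family_on (\<lambda>i. A i \<inter> Q k) {..<n}"
            using disj unfolding disjoint_family_on_def by blast
          ultimately show ?thesis by (simp only: indicator_UN_disjoint[OF finite_lessThan])
        qed
        show "(\<lambda>n. \<Sum>i<n. indicator (A i \<inter> Q k) x) \<longlonglongrightarrow> (indicator (\<Union> (range A) \<inter> Q k) x :: real)" for x
        proof -
          have "(\<lambda>i. indicator (A i \<inter> Q k) x) sums (indicator (\<Union>i. A i \<inter> Q k) x :: real)"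
            by (rule indicator_sums) (use disj in \<open>auto simp: disjoint_family_on_def\<close>)
          then show ?thesis by (simp add: sums_def)
        qed
        show "\<bar>\<Sum>i<n. indicator (A i \<inter> Q k) x\<bar> \<le> (indicator (Q k) x :: real)" for n x
          unfolding eq by (auto simp: indicator_def)
        show "integrable lborel (indicator (Q k) :: 'a \<Rightarrow> real)" using Qi[of UNIV k] by simp
      qed (auto intro!: Bochner_Integration.integrable_sum Qi A Pn)
    qed
  qed
  have PA: "P (indicator A)" if A: "A \<in> sets borel" "emeasure lborel A < \<infinity>" for A
  proof (rule dom[where s="\<lambda>n. indicator (A \<inter> Q n)" and w="indicator A"])
    show "(\<lambda>n. indicator (A \<inter> Q n) x) \<longlonglongrightarrow> (indicator A x :: real)" for x
    proof -
      obtain N where N: "norm x < real N" using reals_Archimedean2 by blast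
      have "x \<in> Q n" if "n \<ge> N" for n
      proof -
        have "\<bar>x \<bullet> i\<bar> < real n" if "i \<in> Basis" for i
          using Basis_le_norm[OF that, of x] N \<open>n \<ge> N\<close> by linarith
        moreover have "(One::'a) \<bullet> i = 1" if "i \<in> Basis" for i
          using inner_sum_left_Basis[OF that, of "\<lambda>_. 1"] by simp
        ultimately show ?thesis unfolding Q_def mem_box by (force simp: abs_less_iff)
      qed
      then have "eventually (\<lambda>n. indicator (A \<inter> Q n) x = (indicator A x :: real)) sequentially"
        unfolding eventually_sequentially by (intro exI[of _ N]) (auto simp: indicator_def)
      then show ?thesis by (rule tendsto_eventually)
    qed
  qed (use A PQ Qi in \<open>auto simp: indicator_def intro!: integrable_real_indicator\<close>)
  from f show ?thesis
  proof (induction rule: integrable_induct)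
    case (base A c)
    then have "P (\<lambda>x. c * indicator A x)" by (intro scale PA integrable_real_indicator) auto
    then show ?case by (simp add: mult.commute)
  next
    case (add f g) then show ?case by (intro assms(3))
  next
    case (lim f s)
    show ?case by (rule dom[where s=s and f=f and w="\<lambda>x. 2 * norm (f x)"]) (use lim in auto)
  qed
qed

section \<open>Weak limits of uniformly bounded sequences\<close>

lemma integrable_bounded_mult:
  fixes f \<phi> :: "'a::euclidean_space \<Rightarrow> real"
  assumes "f \<in> borel_measurable borel" "\<And>x. \<bar>f x\<bar> \<le> C" "integrable lborel \<phi>"
  shows "integrable lborel (\<lambda>x. f x * \<phi> x)"
proof (rule Bochner_Integration.integrable_bound[OF integrable_mult_right[OF assms(3), of C]])
  show "(\<lambda>x. f x * \<phi> x) \<in> borel_measurable lborel"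
    using assms(1) borel_measurable_integrable[OF assms(3)] by measurable
  have "0 \<le> C" using assms(2)[of 0] by linarith
  then show "AE x in lborel. norm (f x * \<phi> x) \<le> norm (C * \<phi> x)"
    using assms(2) by (auto simp: abs_mult intro!: AE_I2 mult_right_mono)
qed

lemma integral_bounded_mult_le:
  fixes f \<phi> :: "'a::euclidean_space \<Rightarrow> real"
  assumes "f \<in> borel_measurable borel" "\<And>x. \<bar>f x\<bar> \<le> C" "integrable lborel \<phi>"
  shows "\<bar>\<integral>x. f x * \<phi> x \<partial>lborel\<bar> \<le> C * (\<integral>x. \<bar>\<phi> x\<bar> \<partial>lborel)"
proof -
  have "\<bar>\<integral>x. f x * \<phi> x \<partial>lborel\<bar> \<le> (\<integral>x. \<bar>f x * \<phi> x\<bar> \<partial>lborel)" by (rule integral_abs_bound)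
  also have "\<dots> \<le> (\<integral>x. C * \<bar>\<phi> x\<bar> \<partial>lborel)"
  proof (rule integral_mono)
    show "\<bar>f x * \<phi> x\<bar> \<le> C * \<bar>\<phi> x\<bar>" for x using assms(2)[of x] by (simp add: abs_mult mult_right_mono)
  qed (use integrable_bounded_mult[OF assms] assms(3) in auto)
  finally show ?thesis by simp
qed

text \<open>The limits of the pairings form a linear functional on L^1 bounded by \<open>C\<close>
  times the norm. It is represented by a function through Radon-Nikodym: evaluated on indicators it
  is a signed set function, which a shift makes nonnegative and an integrable weight makes
  finite.\<close>

lemma weak_limit_exists:
  fixes f :: "nat \<Rightarrow> 'a::euclidean_space \<Rightarrow> real"
  assumes f[measurable]: "\<And>n. f n \<in> borel_measurable borel" and fC: "\<And>n x. \<bar>f n x\<bar> \<le> C"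
    and conv: "\<And>\<phi>. integrable lborel \<phi> \<Longrightarrow> convergent (\<lambda>n. \<integral>x. f n x * \<phi> x \<partial>lborel)"
  obtains g where "g \<in> borel_measurable borel" "\<And>x. \<bar>g x\<bar> \<le> C"
    "\<And>\<phi>. integrable lborel \<phi> \<Longrightarrow> (\<lambda>n. \<integral>x. f n x * \<phi> x \<partial>lborel) \<longlonglongrightarrow> (\<integral>x. g x * \<phi> x \<partial>lborel)"
proof -
  have C0: "0 \<le> C" using fC[of 0 0] by auto
  \<comment> \<open>Lebesgue measure is infinite, so indicators need not be integrable. Multiplying
    them by an everywhere positive integrable weight cures this without changing the null
    sets.\<close>
  obtain h :: "'a \<Rightarrow> ennreal" where h: "h \<in> borel_measurable lborel" "integral\<^sup>N lborel h \<noteq> \<infinity>"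
      "\<And>x. 0 < h x \<and> h x < \<infinity>"
    using sigma_finite_measure.Ex_finite_integrable_function[OF sigma_finite_lborel] by auto
  define w where "w x = enn2real (h x)" for x
  have hw: "h x = ennreal (w x)" for x using h(3)[of x] by (simp add: w_def)
  have wpos: "0 < w x" for x using h(3)[of x] by (simp add: w_def enn2real_positive_iff)
  have w0: "0 \<le> w x" for x using wpos[of x] by simp
  have wmeas[measurable]: "w \<in> borel_measurable borel" using h(1) unfolding w_def by measurable
  have wi: "integrable lborel w"
  proof (rule integrableI_bounded)
    have "(\<lambda>x. ennreal (norm (w x))) = h" using hw w0 by auto
    then show "(\<integral>\<^sup>+x. ennreal (norm (w x)) \<partial>lborel) < \<infinity>" using h(2) by (simp add: top.not_eq_extremum)
  qed simp
  have fi: "integrable lborel (\<lambda>x. f n x * \<phi> x)" if "integrable lborel \<phi>" for n \<phi>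
    by (rule integrable_bounded_mult[OF f fC that])
  define L where "L \<phi> = lim (\<lambda>n. \<integral>x. f n x * \<phi> x \<partial>lborel)" for \<phi>
  have L: "(\<lambda>n. \<integral>x. f n x * \<phi> x \<partial>lborel) \<longlonglongrightarrow> L \<phi>" if "integrable lborel \<phi>" for \<phi>
    unfolding L_def using conv[OF that] by (simp add: convergent_LIMSEQ_iff)
  have Ladd: "L (\<lambda>x. \<phi> x + \<eta> x) = L \<phi> + L \<eta>" if "integrable lborel \<phi>" "integrable lborel \<eta>" for \<phi> \<eta>
  proof (rule LIMSEQ_unique)
    show "(\<lambda>n. \<integral>x. f n x * (\<phi> x + \<eta> x) \<partial>lborel) \<longlonglongrightarrow> L (\<lambda>x. \<phi> x + \<eta> x)"
      using that by (intro L) auto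
    show "(\<lambda>n. \<integral>x. f n x * (\<phi> x + \<eta> x) \<partial>lborel) \<longlonglongrightarrow> L \<phi> + L \<eta>"
      using tendsto_add[OF L[OF that(1)] L[OF that(2)]] fi that by (simp add: distrib_left)
  qed
  have Lscale: "L (\<lambda>x. c * \<phi> x) = c * L \<phi>" if "integrable lborel \<phi>" for \<phi> c
  proof (rule LIMSEQ_unique)
    show "(\<lambda>n. \<integral>x. f n x * (c * \<phi> x) \<partial>lborel) \<longlonglongrightarrow> L (\<lambda>x. c * \<phi> x)"
      using that by (intro L) auto
    show "(\<lambda>n. \<integral>x. f n x * (c * \<phi> x) \<partial>lborel) \<longlonglongrightarrow> c * L \<phi>"
      using tendsto_mult_left[OF L[OF that(1)], of c] by (simp add: mult.left_commute)
  qed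
  have Lbound: "\<bar>L \<phi>\<bar> \<le> C * (\<integral>x. \<bar>\<phi> x\<bar> \<partial>lborel)" if "integrable lborel \<phi>" for \<phi>
    by (rule LIMSEQ_le_const2[OF tendsto_rabs[OF L[OF that]]]) (use integral_bounded_mult_le[OF f fC that] in auto)
  have wiA: "integrable lborel (\<lambda>x. indicator A x * w x)" if "A \<in> sets borel" for A
    using integrable_mult_indicator[OF _ wi, of A] that by simp
  \<comment> \<open>Adding \<open>C\<close> times the weighted measure of \<open>A\<close> turns the
    signed set function into one lying between 0 and 2 C times that measure.\<close>
  define m where "m A = L (\<lambda>x. indicator A x * w x) + C * (\<integral>x. indicator A x * w x \<partial>lborel)" for A
  have m0: "0 \<le> m A" and mle: "m A \<le> 2 * C * (\<integral>x. indicator A x * w x \<partial>lborel)" if "A \<in> sets borel" for A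
    using Lbound[OF wiA[OF that]] w0 by (auto simp: m_def abs_mult)
  have madd: "m (A \<union> B) = m A + m B" if "A \<in> sets borel" "B \<in> sets borel" "A \<inter> B = {}" for A B
  proof -
    have "indicator (A \<union> B) x * w x = indicator A x * w x + indicator B x * w x" for x
      using that(3) by (auto simp: indicator_def)
    then show ?thesis using Ladd[OF wiA[OF that(1)] wiA[OF that(2)]] wiA that
      by (simp add: m_def distrib_left)
  qed
  \<comment> \<open>Finite additivity comes from linearity of \<open>L\<close>; continuity at the
    empty set comes from domination by the finite weighted measure.\<close>
  have ca: "countably_additive (sets borel) (\<lambda>A. ennreal (m A))"
  proof (rule ring_of_sets.empty_continuous_imp_countably_additive)
    show "ring_of_sets UNIV (sets (borel::'a measure))"
      using sets.ring_of_sets_axioms[of "borel::'a measure"] by simp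
    have "m {} = 0" using m0[of "{}"] mle[of "{}"] by simp
    then show "positive (sets borel) (\<lambda>A. ennreal (m A))" by (simp add: positive_def)
    show "Measure_Space.additive (sets borel) (\<lambda>A. ennreal (m A))"
      unfolding Measure_Space.additive_def using madd m0 by (auto simp: ennreal_plus)
    fix A :: "nat \<Rightarrow> 'a set" assume A: "range A \<subseteq> sets borel" "decseq A" "(\<Inter>i. A i) = {}"
    have A'[measurable]: "A n \<in> sets borel" for n using A by auto
    have "(\<lambda>n. \<integral>x. indicator (A n) x * w x \<partial>lborel) \<longlonglongrightarrow> (\<integral>x. 0 \<partial>(lborel::'a measure))"
    proof (rule integral_dominated_convergence[where w=w])
      show "AE x in lborel. (\<lambda>n. indicator (A n) x * w x) \<longlonglongrightarrow> 0"
      proof (rule AE_I2)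
        fix x
        obtain N where "x \<notin> A N" using A(3) by auto
        then have "x \<notin> A n" if "n \<ge> N" for n using A(2) that by (auto simp: decseq_def)
        then have "eventually (\<lambda>n. indicator (A n) x * w x = 0) sequentially"
          unfolding eventually_sequentially by (intro exI[of _ N]) auto
        then show "(\<lambda>n. indicator (A n) x * w x) \<longlonglongrightarrow> 0" by (rule tendsto_eventually)
      qed
    qed (use wi w0 in \<open>auto simp: indicator_def\<close>)
    then have "(\<lambda>n. 2 * C * (\<integral>x. indicator (A n) x * w x \<partial>lborel)) \<longlonglongrightarrow> 0"
      using tendsto_mult_left[of _ 0 _ "2*C"] by simp
    then have "(\<lambda>n. m (A n)) \<longlonglongrightarrow> 0"
      by (rule tendsto_sandwich[rotated 2, OF tendsto_const]) (use m0 mle in auto)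
    then show "(\<lambda>i. ennreal (m (A i))) \<longlonglongrightarrow> 0"
      using tendsto_ennrealI by fastforce
  qed auto
  define N where "N = measure_of UNIV (sets (borel::'a measure)) (\<lambda>A. ennreal (m A))"
  have setsN: "sets N = sets borel" unfolding N_def using sets.sigma_sets_eq[of "borel::'a measure"] by (simp add: sets_measure_of_conv)
  have emN: "emeasure N A = ennreal (m A)" if "A \<in> sets borel" for A
  proof -
    have "m {} = 0" using m0[of "{}"] mle[of "{}"] by simp
    then show ?thesis
      using emeasure_measure_of[OF N_def, of A] ca that by (simp add: positive_def setsN)
  qed
  define \<mu> where "\<mu> = density lborel h"
  have sets\<mu>[measurable_cong]: "sets \<mu> = sets borel" by (simp add: \<mu>_def)
  have em\<mu>: "emeasure \<mu> A = ennreal (\<integral>x. indicator A x * w x \<partial>lborel)" if "A \<in> sets borel" for A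
  proof -
    have "emeasure \<mu> A = (\<integral>\<^sup>+x. h x * indicator A x \<partial>lborel)"
      unfolding \<mu>_def by (rule emeasure_density) (use h(1) that in auto)
    moreover have "(\<integral>\<^sup>+x. h x * indicator A x \<partial>lborel) = (\<integral>\<^sup>+x. ennreal (indicator A x * w x) \<partial>lborel)"
      by (rule nn_integral_cong) (simp add: hw indicator_def)
    moreover have "(\<integral>\<^sup>+x. ennreal (indicator A x * w x) \<partial>lborel) = ennreal (\<integral>x. indicator A x * w x \<partial>lborel)"
    proof (rule nn_integral_eq_integral[OF wiA[OF that]])
      show "AE x in lborel. 0 \<le> indicator A x * w x" using w0 by simp
    qed
    ultimately show ?thesis by (simp only:)
  qed
  have sp\<mu>: "space \<mu> = UNIV" by (simp add: \<mu>_def)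
  have fin\<mu>: "emeasure \<mu> (space \<mu>) \<noteq> \<infinity>"
    unfolding sp\<mu> by (subst em\<mu>) auto
  have sf\<mu>: "sigma_finite_measure \<mu>"
    by (rule finite_measure.axioms(1)[OF finite_measureI[OF fin\<mu>]])
  have "absolutely_continuous \<mu> N"
    unfolding absolutely_continuous_def
  proof
    fix A assume A: "A \<in> null_sets \<mu>"
    then have "A \<in> sets borel" "(\<integral>x. indicator A x * w x \<partial>lborel) \<le> 0" using em\<mu>[of A] sets\<mu> by (auto simp: null_sets_def ennreal_eq_0_iff)
    moreover have "0 \<le> (\<integral>x. indicator A x * w x \<partial>lborel)" using w0 by (intro integral_nonneg_AE) auto
    ultimately have "m A \<le> 0" using mle[of A] by simp
    then show "A \<in> null_sets N" using \<open>A \<in> sets borel\<close> emN[of A] setsN by (auto simp: null_sets_def ennreal_neg)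
  qed
  then obtain F where F: "F \<in> borel_measurable \<mu>" "density \<mu> F = N"
    using sigma_finite_measure.Radon_Nikodym[OF sf\<mu>, of N] setsN sets\<mu> by auto
  have F[measurable]: "F \<in> borel_measurable borel" and FN: "density \<mu> F = N" using F sets\<mu> by (auto cong: measurable_cong_sets)
  have Fm: "(\<integral>\<^sup>+x. F x * indicator A x \<partial>\<mu>) = ennreal (m A)" if "A \<in> sets borel" for A
    using emN[OF that] that unfolding FN[symmetric] by (subst (asm) emeasure_density) auto
  \<comment> \<open>On the set where the density exceeds 2 C its integral would exceed the bound
    \<open>mle\<close>, unless that set is null.\<close>
  have FleC: "AE x in \<mu>. F x \<le> ennreal (2 * C)"
  proof -
    define A where "A = {x. F x > ennreal (2*C)}"
    have A[measurable]: "A \<in> sets borel" unfolding A_def by measurable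
    have "(\<integral>\<^sup>+x. (F x - ennreal (2*C)) * indicator A x \<partial>\<mu>) + ennreal (2*C) * emeasure \<mu> A
       = (\<integral>\<^sup>+x. (F x - ennreal (2*C)) * indicator A x + ennreal (2*C) * indicator A x \<partial>\<mu>)"
      by (subst nn_integral_add) (auto simp: nn_integral_cmult_indicator)
    also have "\<dots> = (\<integral>\<^sup>+x. F x * indicator A x \<partial>\<mu>)"
      by (intro nn_integral_cong) (auto simp: indicator_def A_def diff_add_cancel_ennreal)
    also have "\<dots> \<le> 0 + ennreal (2*C) * emeasure \<mu> A"
      using Fm[OF A] mle[OF A] em\<mu>[OF A] C0 w0 by (simp add: ennreal_mult[symmetric] ennreal_leI)
    finally have "(\<integral>\<^sup>+x. (F x - ennreal (2*C)) * indicator A x \<partial>\<mu>) \<le> 0"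
      using em\<mu>[OF A] by (simp add: ennreal_mult_eq_top_iff)
    then have "AE x in \<mu>. (F x - ennreal (2*C)) * indicator A x = 0"
      by (subst nn_integral_0_iff_AE[symmetric]) auto
    then show ?thesis
      by eventually_elim (auto simp: A_def indicator_def not_less diff_eq_0_iff_ennreal split: if_splits)
  qed
  \<comment> \<open>Subtracting \<open>C\<close> undoes the shift. The truncation alters the density
    on a null set only and makes the bound hold at every point.\<close>
  define g where "g x = min (2*C) (enn2real (F x)) - C" for x
  have g[measurable]: "g \<in> borel_measurable borel" unfolding g_def by measurable
  have gC: "\<bar>g x\<bar> \<le> C" for x unfolding g_def using C0 enn2real_nonneg[of "F x"] by (auto simp: min_def abs_le_iff)
  have Fg: "AE x in \<mu>. F x = ennreal (g x + C)"
    using FleC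
  proof eventually_elim
    case (elim x)
    then have "F x < \<infinity>" using le_less_trans[OF elim] by (simp add: ennreal_less_top)
    moreover have "enn2real (F x) \<le> 2*C" using elim C0 by (simp add: enn2real_leI)
    ultimately show ?case by (simp add: g_def min_def)
  qed
  have gi: "integrable lborel (\<lambda>x. g x * \<phi> x)" if "integrable lborel \<phi>" for \<phi>
    by (rule integrable_bounded_mult[OF g gC that])
  have baseA: "L (\<lambda>x. indicator A x * w x) = (\<integral>x. g x * (indicator A x * w x) \<partial>lborel)" if A[measurable]: "A \<in> sets borel" for A
  proof -
    have pos: "0 \<le> (g x + C) * (indicator A x * w x)" for x using gC[of x] w0[of x] by (auto simp: abs_le_iff)
    have "ennreal (m A) = (\<integral>\<^sup>+x. F x * indicator A x \<partial>\<mu>)" by (simp add: Fm)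
    also have "\<dots> = (\<integral>\<^sup>+x. ennreal (g x + C) * indicator A x \<partial>\<mu>)"
      using Fg by (intro nn_integral_cong_AE) auto
    also have "\<dots> = (\<integral>\<^sup>+x. h x * (ennreal (g x + C) * indicator A x) \<partial>lborel)"
      unfolding \<mu>_def using h(1) by (subst nn_integral_density) auto
    also have "\<dots> = (\<integral>\<^sup>+x. ennreal ((g x + C) * (indicator A x * w x)) \<partial>lborel)"
    proof (rule nn_integral_cong)
      fix x show "h x * (ennreal (g x + C) * indicator A x) = ennreal ((g x + C) * (indicator A x * w x))"
        using gC[of x] w0[of x] by (auto simp: indicator_def hw ennreal_mult[symmetric] abs_le_iff mult.commute)
    qed
    also have "\<dots> = ennreal (\<integral>x. (g x + C) * (indicator A x * w x) \<partial>lborel)"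
      by (rule nn_integral_eq_integral) (use gi[OF wiA[OF A]] wiA[OF A] pos in \<open>auto simp: distrib_right\<close>)
    finally have "m A = (\<integral>x. (g x + C) * (indicator A x * w x) \<partial>lborel)"
      using m0[OF A] pos by (subst (asm) ennreal_inj) (auto intro!: integral_nonneg_AE)
    then show ?thesis using gi[OF wiA[OF A]] wiA[OF A] by (simp add: m_def distrib_right)
  qed
  have int\<mu>: "integrable \<mu> \<psi> \<longleftrightarrow> integrable lborel (\<lambda>x. w x * \<psi> x)" if "\<psi> \<in> borel_measurable borel" for \<psi> :: "'a \<Rightarrow> real"
  proof -
    have "\<mu> = density lborel (\<lambda>x. ennreal (w x))" unfolding \<mu>_def using hw by presburger
    then show ?thesis using integrable_real_density[of w lborel \<psi>] that w0 by simp
  qed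
  \<comment> \<open>Every Lebesgue integrable function has the form \<open>w x * \<psi> x\<close>
    with \<psi> integrable for the weighted measure, so this covers all test functions.\<close>
  have main: "L (\<lambda>x. w x * \<psi> x) = (\<integral>x. g x * (w x * \<psi> x) \<partial>lborel)" if "integrable \<mu> \<psi>" for \<psi>
    using that
  proof (induction rule: integrable_induct)
    case (base A c)
    then have A: "A \<in> sets borel" using sets\<mu> by simp
    show ?case using Lscale[OF wiA[OF A], of c] baseA[OF A] 
      by (simp add: mult_ac)
  next
    case (add f' g')
    have m: "f' \<in> borel_measurable borel" "g' \<in> borel_measurable borel"
      using add borel_measurable_integrable sets\<mu> by (auto cong: measurable_cong_sets)
    have i: "integrable lborel (\<lambda>x. w x * f' x)" "integrable lborel (\<lambda>x. w x * g' x)"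
      using int\<mu>[OF m(1)] int\<mu>[OF m(2)] add by blast+
    show ?case using Ladd[OF i] add gi[OF i(1)] gi[OF i(2)] by (simp add: distrib_left)
  next
    case (lim \<psi> s)
    have m: "\<psi> \<in> borel_measurable borel" "s n \<in> borel_measurable borel" for n
      using lim borel_measurable_integrable sets\<mu> by (auto cong: measurable_cong_sets)
    have i: "integrable lborel (\<lambda>x. w x * \<psi> x)" "integrable lborel (\<lambda>x. w x * s n x)" for n
      using int\<mu>[OF m(1)] int\<mu>[OF m(2)] lim by blast+
    have sp: "space \<mu> = UNIV" by (simp add: \<mu>_def)
    have dlim: "(\<lambda>n. \<integral>x. \<bar>w x * s n x - w x * \<psi> x\<bar> \<partial>lborel) \<longlonglongrightarrow> (\<integral>x. 0 \<partial>(lborel::'a measure))"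
    proof (rule integral_dominated_convergence[where w="\<lambda>x. 3 * \<bar>w x * \<psi> x\<bar>"])
      show "AE x in lborel. (\<lambda>n. \<bar>w x * s n x - w x * \<psi> x\<bar>) \<longlonglongrightarrow> 0"
      proof (rule AE_I2)
        fix x
        have "(\<lambda>n. \<bar>w x * s n x - w x * \<psi> x\<bar>) \<longlonglongrightarrow> \<bar>w x * \<psi> x - w x * \<psi> x\<bar>"
          using lim.hyps(2)[of x] sp by (intro tendsto_intros) auto
        then show "(\<lambda>n. \<bar>w x * s n x - w x * \<psi> x\<bar>) \<longlonglongrightarrow> 0" by simp
      qed
      show "AE x in lborel. norm \<bar>w x * s n x - w x * \<psi> x\<bar> \<le> 3 * \<bar>w x * \<psi> x\<bar>" for n
      proof (rule AE_I2)
        fix x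
        have "\<bar>s n x - \<psi> x\<bar> \<le> 3 * \<bar>\<psi> x\<bar>" using lim.hyps(3)[of x n] sp by auto
        then have "w x * \<bar>s n x - \<psi> x\<bar> \<le> w x * (3 * \<bar>\<psi> x\<bar>)" using w0 by (intro mult_left_mono)
        then show "norm \<bar>w x * s n x - w x * \<psi> x\<bar> \<le> 3 * \<bar>w x * \<psi> x\<bar>"
          using w0[of x] by (simp add: abs_mult flip: right_diff_distrib)
      qed
    qed (use m i in auto)
    have tends: "(\<lambda>n. T (\<lambda>x. w x * s n x)) \<longlonglongrightarrow> T (\<lambda>x. w x * \<psi> x)"
      if T: "\<And>\<phi> \<eta>. integrable lborel \<phi> \<Longrightarrow> integrable lborel \<eta> \<Longrightarrow> \<bar>T \<phi> - T \<eta>\<bar> \<le> C * (\<integral>x. \<bar>\<phi> x - \<eta> x\<bar> \<partial>lborel)" for T :: "('a \<Rightarrow> real) \<Rightarrow> real"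
    proof (rule LIM_zero_cancel, rule Lim_null_comparison)
      show "(\<lambda>n. C * (\<integral>x. \<bar>w x * s n x - w x * \<psi> x\<bar> \<partial>lborel)) \<longlonglongrightarrow> 0"
        using tendsto_mult_left[OF dlim, of C] by simp
      show "eventually (\<lambda>n. norm (T (\<lambda>x. w x * s n x) - T (\<lambda>x. w x * \<psi> x)) \<le> C * (\<integral>x. \<bar>w x * s n x - w x * \<psi> x\<bar> \<partial>lborel)) sequentially"
        using T[OF i(2) i(1)] by auto
    qed
    have "(\<lambda>n. L (\<lambda>x. w x * s n x)) \<longlonglongrightarrow> L (\<lambda>x. w x * \<psi> x)"
    proof (rule tends)
      fix \<phi> \<eta> :: "'a \<Rightarrow> real" assume *: "integrable lborel \<phi>" "integrable lborel \<eta>"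
      have "L (\<lambda>x. \<phi> x + (-1) * \<eta> x) = L \<phi> + (-1) * L \<eta>" using * Ladd[of \<phi> "\<lambda>x. (-1) * \<eta> x"] Lscale[OF *(2), of "-1"] by simp
      then show "\<bar>L \<phi> - L \<eta>\<bar> \<le> C * (\<integral>x. \<bar>\<phi> x - \<eta> x\<bar> \<partial>lborel)"
        using Lbound[of "\<lambda>x. \<phi> x + (-1) * \<eta> x"] * by simp
    qed
    moreover have "(\<lambda>n. \<integral>x. g x * (w x * s n x) \<partial>lborel) \<longlonglongrightarrow> (\<integral>x. g x * (w x * \<psi> x) \<partial>lborel)"
    proof (rule tends)
      fix \<phi> \<eta> :: "'a \<Rightarrow> real" assume *: "integrable lborel \<phi>" "integrable lborel \<eta>"
      show "\<bar>(\<integral>x. g x * \<phi> x \<partial>lborel) - (\<integral>x. g x * \<eta> x \<partial>lborel)\<bar> \<le> C * (\<integral>x. \<bar>\<phi> x - \<eta> x\<bar> \<partial>lborel)"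
        using integral_bounded_mult_le[OF g gC Bochner_Integration.integrable_diff[OF *]] gi[OF *(1)] gi[OF *(2)]
        by (simp add: right_diff_distrib)
    qed
    ultimately show ?case unfolding lim.IH by (rule LIMSEQ_unique)
  qed
  show ?thesis
  proof (rule that[OF g gC])
    fix \<phi> :: "'a \<Rightarrow> real" assume \<phi>: "integrable lborel \<phi>"
    have wn: "w x \<noteq> 0" for x using wpos[of x] by simp
    have e: "w x * (\<phi> x / w x) = \<phi> x" for x using wn[of x] by simp
    have "integrable lborel (\<lambda>x. w x * (\<phi> x / w x))" unfolding e by (rule \<phi>)
    moreover have "(\<lambda>x. \<phi> x / w x) \<in> borel_measurable borel" using borel_measurable_integrable[OF \<phi>] by measurable
    ultimately have "L (\<lambda>x. w x * (\<phi> x / w x)) = (\<integral>x. g x * (w x * (\<phi> x / w x)) \<partial>lborel)"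
      by (intro main) (simp only: int\<mu>)
    then show "(\<lambda>n. \<integral>x. f n x * \<phi> x \<partial>lborel) \<longlonglongrightarrow> (\<integral>x. g x * \<phi> x \<partial>lborel)"
      using L[OF \<phi>] unfolding e by simp
  qed
qed

section \<open>Translations, diagonal subsequences and lower semicontinuity\<close>

lemma nn_integral_lborel_shift:
  fixes f :: "'a::euclidean_space \<Rightarrow> ennreal"
  assumes [measurable]: "f \<in> borel_measurable borel"
  shows "(\<integral>\<^sup>+x. f (x + c) \<partial>lborel) = (\<integral>\<^sup>+x. f x \<partial>lborel)"
proof -
  have "(\<integral>\<^sup>+x. f x \<partial>lborel) = (\<integral>\<^sup>+x. f x \<partial>distr lborel borel ((+) c))" by (simp add: lborel_distr_plus)
  also have "\<dots> = (\<integral>\<^sup>+x. f (c + x) \<partial>lborel)" by (rule nn_integral_distr) auto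
  finally show ?thesis by (simp add: add.commute)
qed

lemma integral_lborel_shift:
  fixes f :: "'a::euclidean_space \<Rightarrow> 'b::{banach,second_countable_topology}"
  assumes [measurable]: "f \<in> borel_measurable borel"
  shows "(\<integral>x. f (x + c) \<partial>lborel) = (\<integral>x. f x \<partial>lborel)"
proof -
  have "(\<integral>x. f x \<partial>lborel) = (\<integral>x. f x \<partial>distr lborel borel ((+) c))" by (simp add: lborel_distr_plus)
  also have "\<dots> = (\<integral>x. f (c + x) \<partial>lborel)" by (rule integral_distr) auto
  finally show ?thesis by (simp add: add.commute)
qed

lemma integrable_lborel_shift:
  fixes f :: "'a::euclidean_space \<Rightarrow> 'b::{banach,second_countable_topology}"
  assumes "integrable lborel f"
  shows "integrable lborel (\<lambda>x. f (x + c))"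
proof -
  have m: "f \<in> borel_measurable borel" using borel_measurable_integrable[OF assms] by simp
  have "integrable (distr lborel borel ((+) c)) f" using assms by (simp add: lborel_distr_plus)
  then have "integrable lborel (\<lambda>x. f (c + x))" by (subst (asm) integrable_distr_eq) (use m in auto)
  then show ?thesis by (simp add: add.commute)
qed

lemma diagonal_extraction:
  fixes a :: "nat \<Rightarrow> 'i \<Rightarrow> real"
  assumes I: "countable I" and bdd: "\<And>i. i \<in> I \<Longrightarrow> bounded (range (\<lambda>n. a n i))"
  shows "\<exists>r::nat\<Rightarrow>nat. strict_mono r \<and> (\<forall>i\<in>I. convergent (\<lambda>n. a (r n) i))"
proof (cases "I = {}")
  case True
  then show ?thesis by (intro exI[of _ id]) (auto simp: strict_mono_def)
next
  case False
  define e where "e = from_nat_into I"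
  have e: "e n \<in> I" for n unfolding e_def by (rule from_nat_into[OF False])
  interpret subseqs "\<lambda>n s. convergent (\<lambda>m. a (s m) (e n))"
  proof
    fix n and s :: "nat \<Rightarrow> nat" assume "strict_mono s"
    have "range (\<lambda>m. a (s m) (e n)) \<subseteq> range (\<lambda>n'. a n' (e n))" by auto
    then have "bounded (range (\<lambda>m. a (s m) (e n)))" using bdd[OF e] bounded_subset by blast
    then obtain l r where "strict_mono r" "((\<lambda>m. a (s m) (e n)) \<circ> r) \<longlonglongrightarrow> l"
      using bounded_imp_convergent_subsequence by blast
    then show "\<exists>r'. strict_mono r' \<and> convergent (\<lambda>m. a ((s \<circ> r') m) (e n))"
      by (intro exI[of _ r]) (auto simp: convergent_def o_def)
  qed
  have "convergent (\<lambda>n. a (diagseq n) i)" if iI: "i \<in> I" for i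
  proof -
    obtain k where k: "i = e k" using from_nat_into_surj[OF I iI] unfolding e_def by auto
    \<comment> \<open>Only from index \<open>Suc k\<close> on is the diagonal sequence a subsequence
      of the one extracted for \<open>e k\<close>.\<close>
    have "convergent (\<lambda>m. a ((diagseq \<circ> (+) (Suc k)) m) (e k))"
    proof (rule diagseq_holds)
      fix r s :: "nat \<Rightarrow> nat" and n assume "strict_mono r" "convergent (\<lambda>m. a (s m) (e n))"
      then have "convergent ((\<lambda>m. a (s m) (e n)) \<circ> r)" by (intro convergent_subseq_convergent)
      then show "convergent (\<lambda>m. a ((s \<circ> r) m) (e n))" by (simp add: o_def)
    qed
    then have "convergent (\<lambda>m. a (diagseq (m + Suc k)) i)" unfolding k o_def by (simp only: add.commute)
    then show ?thesis using convergent_ignore_initial_segment[of "\<lambda>n. a (diagseq n) i" "Suc k"] by blast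
  qed
  then show ?thesis using subseq_diagseq by blast
qed

text \<open>The graph of the convex function a^p lies above its tangent at b, that is b^p + p
  b^(p-1) (a - b), rearranged without subtraction. It serves both for lower semicontinuity of the
  p-norms and for Jensen's inequality in the scheme.\<close>

lemma powr_tangent_le:
  fixes a b p :: real
  assumes p: "1 \<le> p" and "0 \<le> a" "0 \<le> b"
  shows "p * (a * b powr (p - 1)) \<le> a powr p + (p - 1) * b powr p"
proof (cases "p = 1")
  case True
  then show ?thesis using assms by (cases "b = 0") auto
next
  case False
  define q where "q = p / (p - 1)"
  have p1: "p > 1" using p False by simp
  have "a * b powr (p - 1) \<le> a powr p / p + (b powr (p - 1)) powr q / q"
  proof (rule Youngs_inequality)
    show "1 < q" "1 / p + 1 / q = 1" using p1 by (auto simp: q_def field_simps)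
  qed (use assms p1 in auto)
  also have "(b powr (p - 1)) powr q = b powr p" using p1 by (simp add: powr_powr q_def)
  finally have "p * (a * b powr (p - 1)) \<le> p * (a powr p / p + b powr p / q)"
    using p1 by (intro mult_left_mono) auto
  also have "\<dots> = a powr p + (p - 1) * b powr p" using p1 by (simp add: q_def field_simps)
  finally show ?thesis .
qed

text \<open>Convexity makes the p-norm weakly lower semicontinuous. The tangent inequality at |g|,
  paired with the dual function sgn(g) |g|^(p-1), passes to the limit because it is linear in
  \<open>f n\<close>; it gives p X <= J + (p - 1) X for the integral X of |g|^p over a ball. The
  ball makes the dual function integrable and is removed by Fatou.\<close>

lemma weak_limit_powr_le:
  fixes f :: "nat \<Rightarrow> 'a::euclidean_space \<Rightarrow> real"
  assumes f[measurable]: "\<And>n. f n \<in> borel_measurable borel" and fC: "\<And>n x. \<bar>f n x\<bar> \<le> C"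
    and g[measurable]: "g \<in> borel_measurable borel" and gC: "\<And>x. \<bar>g x\<bar> \<le> C"
    and lim: "\<And>\<phi>. integrable lborel \<phi> \<Longrightarrow> (\<lambda>n. \<integral>x. f n x * \<phi> x \<partial>lborel) \<longlonglongrightarrow> (\<integral>x. g x * \<phi> x \<partial>lborel)"
    and p: "1 \<le> p" and le: "\<And>n. (\<integral>\<^sup>+x. ennreal (\<bar>f n x\<bar> powr p) \<partial>lborel) \<le> I"
  shows "(\<integral>\<^sup>+x. ennreal (\<bar>g x\<bar> powr p) \<partial>lborel) \<le> (I :: ennreal)"
proof (cases "I = \<infinity>")
  case False
  define J where "J = enn2real I"
  have IJ: "I = ennreal J" and J0: "0 \<le> J" using False by (auto simp: J_def top.not_eq_extremum)
  have C0: "0 \<le> C" using fC[of 0 0] by linarith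
  have fi: "integrable lborel (\<lambda>x. \<bar>f n x\<bar> powr p)" and fJ: "(\<integral>x. \<bar>f n x\<bar> powr p \<partial>lborel) \<le> J" for n
  proof -
    have le': "(\<integral>\<^sup>+x. ennreal (\<bar>f n x\<bar> powr p) \<partial>lborel) \<le> ennreal J" using le[of n] IJ by simp
    show i: "integrable lborel (\<lambda>x. \<bar>f n x\<bar> powr p)"
    proof (rule integrableI_bounded)
      show "(\<integral>\<^sup>+x. ennreal (norm (\<bar>f n x\<bar> powr p)) \<partial>lborel) < \<infinity>"
        using le_less_trans[OF le' ennreal_less_top] by simp
    qed simp
    have "ennreal (\<integral>x. \<bar>f n x\<bar> powr p \<partial>lborel) \<le> ennreal J"
      using le' by (subst nn_integral_eq_integral[OF i, symmetric]) auto
    then show "(\<integral>x. \<bar>f n x\<bar> powr p \<partial>lborel) \<le> J" using J0 by simp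
  qed
  have ball: "(\<integral>\<^sup>+x. ennreal (indicator (ball 0 (real k)) x * \<bar>g x\<bar> powr p) \<partial>lborel) \<le> ennreal J" for k :: nat
  proof -
    let ?B = "ball (0::'a) (real k)"
    have [measurable]: "?B \<in> sets borel" by simp
    have [measurable]: "(\<lambda>x. \<bar>g x\<bar> powr r) \<in> borel_measurable borel" for r by measurable
    have Bi: "integrable lborel (indicator ?B :: 'a \<Rightarrow> real)"
      by (rule integrable_real_indicator) (use emeasure_lborel_ball_finite[of "0::'a" "real k"] in \<open>simp_all\<close>)
    define G where "G x = indicator ?B x * \<bar>g x\<bar> powr p" for x
    define \<phi> where "\<phi> x = sgn (g x) * \<bar>g x\<bar> powr (p - 1) * indicator ?B x" for x
    have pw: "\<bar>g x\<bar> powr r \<le> C powr r" if "r \<ge> 0" for r x using that gC[of x] by (intro powr_mono2) auto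
    have Gi: "integrable lborel G" unfolding G_def
    proof (rule Bochner_Integration.integrable_bound[OF integrable_mult_right[OF Bi, of "C powr p"]])
      show "AE x in lborel. norm (indicator ?B x * \<bar>g x\<bar> powr p) \<le> norm (C powr p * indicator ?B x)"
      proof (rule AE_I2)
        fix x show "norm (indicator ?B x * \<bar>g x\<bar> powr p) \<le> norm (C powr p * indicator ?B x)"
          using pw[of p x] p by (auto simp: indicator_def)
      qed
    qed measurable
    have \<phi>i: "integrable lborel \<phi>" unfolding \<phi>_def
    proof (rule Bochner_Integration.integrable_bound[OF integrable_mult_right[OF Bi, of "C powr (p-1)"]])
      show "AE x in lborel. norm (sgn (g x) * \<bar>g x\<bar> powr (p - 1) * indicator ?B x) \<le> norm (C powr (p-1) * indicator ?B x)"
      proof (rule AE_I2)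
        fix x show "norm (sgn (g x) * \<bar>g x\<bar> powr (p - 1) * indicator ?B x) \<le> norm (C powr (p-1) * indicator ?B x)"
          using pw[of "p-1" x] p by (auto simp: indicator_def abs_mult sgn_real_def)
      qed
    qed measurable
    have g\<phi>: "g x * \<phi> x = G x" for x
    proof (cases "g x = 0")
      case False
      have "\<bar>g x\<bar> * \<bar>g x\<bar> powr (p - 1) = \<bar>g x\<bar> powr p"
        using powr_mult_base[of "\<bar>g x\<bar>" "p - 1"] by simp
      moreover have "g x * sgn (g x) = \<bar>g x\<bar>" by (simp add: abs_sgn)
      ultimately show ?thesis unfolding \<phi>_def G_def by (metis mult.assoc mult.commute)
    qed (simp add: \<phi>_def G_def)
    have fb: "p * (\<integral>x. f n x * \<phi> x \<partial>lborel) \<le> J + (p - 1) * (\<integral>x. G x \<partial>lborel)" for n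
    proof -
      have pt: "p * (f n x * \<phi> x) \<le> \<bar>f n x\<bar> powr p + (p - 1) * G x" for x
      proof -
        have "f n x * \<phi> x \<le> \<bar>f n x\<bar> * (\<bar>g x\<bar> powr (p - 1) * indicator ?B x)"
          using abs_ge_self[of "f n x * \<phi> x"]
          by (rule order_trans) (auto simp: \<phi>_def abs_mult sgn_real_def indicator_def)
        then have "p * (f n x * \<phi> x) \<le> p * (\<bar>f n x\<bar> * (\<bar>g x\<bar> powr (p - 1) * indicator ?B x))"
          using p by (intro mult_left_mono) auto
        also have "\<dots> \<le> \<bar>f n x\<bar> powr p + (p - 1) * G x"
          using powr_tangent_le[OF p, of "\<bar>f n x\<bar>" "\<bar>g x\<bar>"] by (auto simp: G_def indicator_def)
        finally show ?thesis .
      qed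
      have "p * (\<integral>x. f n x * \<phi> x \<partial>lborel) = (\<integral>x. p * (f n x * \<phi> x) \<partial>lborel)" by simp
      also have "\<dots> \<le> (\<integral>x. \<bar>f n x\<bar> powr p + (p - 1) * G x \<partial>lborel)"
        using integrable_bounded_mult[OF f fC \<phi>i] fi Gi pt by (intro integral_mono) auto
      also have "\<dots> = (\<integral>x. \<bar>f n x\<bar> powr p \<partial>lborel) + (p - 1) * (\<integral>x. G x \<partial>lborel)"
        using fi Gi by simp
      finally show ?thesis using fJ[of n] by simp
    qed
    have "(\<lambda>n. p * (\<integral>x. f n x * \<phi> x \<partial>lborel)) \<longlonglongrightarrow> p * (\<integral>x. g x * \<phi> x \<partial>lborel)"
      using lim[OF \<phi>i] by (intro tendsto_intros)
    then have "p * (\<integral>x. g x * \<phi> x \<partial>lborel) \<le> J + (p - 1) * (\<integral>x. G x \<partial>lborel)"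
      by (rule LIMSEQ_le_const2) (use fb in auto)
    then have "(\<integral>x. G x \<partial>lborel) \<le> J" unfolding g\<phi> by (simp add: algebra_simps)
    moreover have "(\<integral>\<^sup>+x. ennreal (G x) \<partial>lborel) = ennreal (\<integral>x. G x \<partial>lborel)"
      by (rule nn_integral_eq_integral[OF Gi]) (auto simp: G_def)
    ultimately show ?thesis unfolding G_def using ennreal_leI by simp
  qed
  have "(\<integral>\<^sup>+x. ennreal (\<bar>g x\<bar> powr p) \<partial>lborel) =
     (\<integral>\<^sup>+x. liminf (\<lambda>k. ennreal (indicator (ball 0 (real k)) x * \<bar>g x\<bar> powr p)) \<partial>lborel)"
  proof (rule nn_integral_cong)
    fix x :: 'a
    obtain N :: nat where N: "norm x < real N" using reals_Archimedean2 by blast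
    have "eventually (\<lambda>k. ennreal (indicator (ball 0 (real k)) x * \<bar>g x\<bar> powr p) = ennreal (\<bar>g x\<bar> powr p)) sequentially"
      unfolding eventually_sequentially using N by (intro exI[of _ N]) (auto simp: indicator_def)
    then show "ennreal (\<bar>g x\<bar> powr p) = liminf (\<lambda>k. ennreal (indicator (ball 0 (real k)) x * \<bar>g x\<bar> powr p))"
      by (intro lim_imp_Liminf[symmetric] tendsto_eventually) auto
  qed
  also have "\<dots> \<le> liminf (\<lambda>k. \<integral>\<^sup>+x. ennreal (indicator (ball 0 (real k)) x * \<bar>g x\<bar> powr p) \<partial>lborel)"
  proof (rule nn_integral_liminf)
    fix k :: nat
    have [measurable]: "ball (0::'a) (real k) \<in> sets borel" by simp
    show "(\<lambda>x. ennreal (indicator (ball 0 (real k)) x * \<bar>g x\<bar> powr p)) \<in> borel_measurable lborel" by measurable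
  qed
  also have "\<dots> \<le> I" unfolding IJ
    by (rule order_trans[OF Liminf_mono[of _ "\<lambda>_. ennreal J"]]) (use ball in \<open>auto simp: Liminf_const\<close>)
  finally show ?thesis .
qed simp

section \<open>Functions with Lipschitz gradient\<close>

text \<open>The gradient is encoded by the quadratic Taylor remainder, so that all consistency errors of the
  scheme can be read off without differentiation.\<close>

definition C11 :: "real \<Rightarrow> ('a::euclidean_space \<Rightarrow> real) \<Rightarrow> ('a \<Rightarrow> 'a) \<Rightarrow> bool" where
  "C11 L f D \<longleftrightarrow> (\<forall>x. norm (D x) \<le> L) \<and> (\<forall>x y. \<bar>f y - f x - D x \<bullet> (y - x)\<bar> \<le> L * (norm (y - x))\<^sup>2)"

lemma C11D: assumes "C11 L f D" shows "norm (D x) \<le> L" "\<bar>f y - f x - D x \<bullet> (y - x)\<bar> \<le> L * (norm (y - x))\<^sup>2" "0 \<le> L"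
  using assms norm_ge_zero order_trans unfolding C11_def by blast+

lemma C11_mono: assumes "C11 L f D" "L \<le> L'" shows "C11 L' f D"
  unfolding C11_def
proof (intro conjI allI)
  fix x y
  show "norm (D x) \<le> L'" using C11D(1)[OF assms(1), of x] assms(2) by simp
  show "\<bar>f y - f x - D x \<bullet> (y - x)\<bar> \<le> L' * (norm (y - x))\<^sup>2"
    using C11D(2)[OF assms(1), of y x] mult_right_mono[OF assms(2), of "(norm (y - x))\<^sup>2"] by simp
qed

lemma C11_has_derivative:
  assumes "C11 L f D"
  shows "(f has_derivative (\<lambda>h. D x \<bullet> h)) (at x)"
  unfolding has_derivative_at
proof
  show "bounded_linear (\<lambda>h. D x \<bullet> h)" by (rule bounded_linear_inner_right)
  show "(\<lambda>h. norm (f (x + h) - f x - D x \<bullet> h) / norm h) \<midarrow>0\<rightarrow> 0"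
  proof (rule Lim_null_comparison)
    show "\<forall>\<^sub>F h in at 0. norm (norm (f (x + h) - f x - D x \<bullet> h) / norm h) \<le> L * norm h"
      unfolding eventually_at_filter
    proof (intro always_eventually allI impI)
      fix h :: 'a assume "h \<noteq> 0"
      then show "norm (norm (f (x + h) - f x - D x \<bullet> h) / norm h) \<le> L * norm h"
        using C11D(2)[OF assms, of "x + h" x] by (simp add: divide_le_eq power2_eq_square mult.assoc)
    qed
    show "(\<lambda>h. L * norm h) \<midarrow>0\<rightarrow> 0"
      by (intro tendsto_mult_right_zero tendsto_norm_zero tendsto_ident_at)
  qed
qed

lemma C11_lipschitz:
  assumes "C11 L f D"
  shows "\<bar>f y - f x\<bar> \<le> L * norm (y - x)"
proof -
  have "norm (f y - f x) \<le> L * norm (y - x)"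
  proof (rule differentiable_bound[of UNIV f "\<lambda>x h. D x \<bullet> h"])
    show "(f has_derivative (\<lambda>h. D x \<bullet> h)) (at x within UNIV)" for x using C11_has_derivative[OF assms] by simp
    show "onorm (\<lambda>h. D x \<bullet> h) \<le> L" for x
    proof (rule onorm_bound[OF C11D(3)[OF assms]])
      fix h show "norm (D x \<bullet> h) \<le> L * norm h"
        using Cauchy_Schwarz_ineq2[of "D x" h] mult_right_mono[OF C11D(1)[OF assms, of x] norm_ge_zero[of h]] by simp
    qed
  qed auto
  then show ?thesis by simp
qed

lemma C11_continuous: "C11 L f D \<Longrightarrow> continuous_on UNIV f"
  using C11_has_derivative has_derivative_continuous continuous_at_imp_continuous_on by metis

lemma C11_borel: "C11 L f D \<Longrightarrow> f \<in> borel_measurable borel"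
  by (rule borel_measurable_continuous_onI[OF C11_continuous])

text \<open>The Taylor remainder of a product is the sum of each remainder times the other factor
  and of the product of the two increments, which accounts for \<open>L * M\<close>.\<close>

lemma C11_mult:
  assumes f: "C11 L f D" and g: "C11 M g E" and F: "\<And>x. \<bar>f x\<bar> \<le> F" and G: "\<And>x. \<bar>g x\<bar> \<le> G"
  shows "C11 (F * M + G * L + L * M) (\<lambda>x. f x * g x) (\<lambda>x. f x *\<^sub>R E x + g x *\<^sub>R D x)"
  unfolding C11_def
proof (intro conjI allI)
  fix x y
  have F0: "0 \<le> F" and G0: "0 \<le> G" using F[of x] G[of x] by linarith+
  have L0: "0 \<le> L" "0 \<le> M" using C11D(3) f g by auto
  have "norm (f x *\<^sub>R E x + g x *\<^sub>R D x) \<le> \<bar>f x\<bar> * norm (E x) + \<bar>g x\<bar> * norm (D x)"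
    using norm_triangle_ineq[of "f x *\<^sub>R E x" "g x *\<^sub>R D x"] by simp
  also have "\<dots> \<le> F * M + G * L"
    using F[of x] G[of x] C11D(1)[OF f, of x] C11D(1)[OF g, of x] F0 G0 by (intro add_mono mult_mono) auto
  finally show "norm (f x *\<^sub>R E x + g x *\<^sub>R D x) \<le> F * M + G * L + L * M" using mult_nonneg_nonneg[OF L0] by linarith
  define v where "v = norm (y - x)"
  have e: "f y * g y - f x * g x - (f x *\<^sub>R E x + g x *\<^sub>R D x) \<bullet> (y - x) =
     f x * (g y - g x - E x \<bullet> (y - x)) + g x * (f y - f x - D x \<bullet> (y - x)) + (f y - f x) * (g y - g x)"
    by (simp add: algebra_simps inner_add_left)
  have "\<bar>f x * (g y - g x - E x \<bullet> (y - x))\<bar> \<le> F * (M * v\<^sup>2)" unfolding abs_mult v_def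
    using F F0 C11D(2)[OF g, of y x] by (intro mult_mono) auto
  moreover have "\<bar>g x * (f y - f x - D x \<bullet> (y - x))\<bar> \<le> G * (L * v\<^sup>2)" unfolding abs_mult v_def
    using G G0 C11D(2)[OF f, of y x] by (intro mult_mono) auto
  moreover have "\<bar>(f y - f x) * (g y - g x)\<bar> \<le> (L * v) * (M * v)" unfolding abs_mult v_def
    using C11_lipschitz[OF f, of y x] C11_lipschitz[OF g, of y x] L0 by (intro mult_mono) auto
  ultimately have "\<bar>f y * g y - f x * g x - (f x *\<^sub>R E x + g x *\<^sub>R D x) \<bullet> (y - x)\<bar> \<le> F * (M * v\<^sup>2) + G * (L * v\<^sup>2) + (L * v) * (M * v)"
    unfolding e by linarith
  also have "\<dots> = (F * M + G * L + L * M) * v\<^sup>2" by (simp add: algebra_simps power2_eq_square)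
  finally show "\<bar>f y * g y - f x * g x - (f x *\<^sub>R E x + g x *\<^sub>R D x) \<bullet> (y - x)\<bar> \<le> (F * M + G * L + L * M) * (norm (y - x))\<^sup>2"
    by (simp add: v_def)
qed

text \<open>The quadratic spline whose derivative is the hat function on \<open>[0, 2]\<close>.\<close>

definition ramp :: "real \<Rightarrow> real" where
  "ramp s = ((max 0 s)\<^sup>2 - 2 * (max 0 (s - 1))\<^sup>2 + (max 0 (s - 2))\<^sup>2) / 2"

definition ramp' :: "real \<Rightarrow> real" where
  "ramp' s = max 0 s - 2 * max 0 (s - 1) + max 0 (s - 2)"

lemma ramp_le: "s \<le> 0 \<Longrightarrow> ramp s = 0" and ramp_ge: "2 \<le> s \<Longrightarrow> ramp s = 1"
  by (auto simp: ramp_def max_def power2_eq_square algebra_simps)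

lemma ramp_bounds: "0 \<le> ramp s" "ramp s \<le> 1"
proof -
  consider "s \<le> 0" | "0 \<le> s" "s \<le> 1" | "1 \<le> s" "s \<le> 2" | "2 \<le> s" by linarith
  then have "0 \<le> ramp s \<and> ramp s \<le> 1"
  proof cases
    case 2
    then have "ramp s = s\<^sup>2 / 2" by (auto simp: ramp_def max_def)
    moreover have "s\<^sup>2 \<le> 1" using 2 power_le_one[of s 2] by auto
    ultimately show ?thesis using zero_le_power2[of s] by linarith
  next
    case 3
    then have "ramp s = 1 - (2 - s)\<^sup>2 / 2" by (auto simp: ramp_def max_def power2_eq_square field_simps)
    moreover have "(2 - s)\<^sup>2 \<le> 1" using 3 power_le_one[of "2 - s" 2] by auto
    ultimately show ?thesis using zero_le_power2[of "2 - s"] by linarith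
  qed (auto simp: ramp_le ramp_ge)
  then show "0 \<le> ramp s" "ramp s \<le> 1" by auto
qed

lemma ramp'_bound: "\<bar>ramp' s\<bar> \<le> 1"
  by (auto simp: ramp'_def max_def)

text \<open>The derivative \<open>2 * max 0 x\<close> of the squared positive part is Lipschitz with
  constant 2, whence the quadratic remainder with constant 1. \<open>ramp\<close> is a combination
  of such functions.\<close>

lemma max_sq_taylor: "\<bar>(max 0 y)\<^sup>2 - (max 0 x)\<^sup>2 - 2 * max 0 x * (y - x)\<bar> \<le> (y - x)\<^sup>2" for x y :: real
proof (cases "x \<le> 0")
  case True
  then have "(max 0 y)\<^sup>2 \<le> \<bar>y - x\<bar>\<^sup>2" by (intro power_mono) auto
  then show ?thesis using True by simp
next
  case x: False
  show ?thesis
  proof (cases "y \<ge> 0")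
    case True
    then have "(max 0 y)\<^sup>2 - (max 0 x)\<^sup>2 - 2 * max 0 x * (y - x) = (y - x)\<^sup>2"
      using x by (simp add: max_def power2_eq_square algebra_simps)
    then show ?thesis by simp
  next
    case False
    have "x * y \<le> 0" using x False by (simp add: mult_nonneg_nonpos)
    then have "2 * x * y \<le> 0" by (simp add: mult.assoc)
    then have "0 \<le> x\<^sup>2 - 2 * x * y" using zero_le_power2[of x] by linarith
    then have "\<bar>x\<^sup>2 - 2 * x * y\<bar> = x\<^sup>2 - 2 * x * y" by simp
    moreover have "(max 0 y)\<^sup>2 - (max 0 x)\<^sup>2 - 2 * max 0 x * (y - x) = x\<^sup>2 - 2 * x * y"
      using x False by (simp add: max_def power2_eq_square algebra_simps)
    moreover have "(y - x)\<^sup>2 = y\<^sup>2 + (x\<^sup>2 - 2 * x * y)" by (simp add: power2_eq_square algebra_simps)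
    ultimately show ?thesis by simp
  qed
qed

text \<open>The constant is (1 + 2 + 1) / 2, from the coefficients of the three squared positive
  parts in \<open>ramp\<close>.\<close>

lemma ramp_taylor: "\<bar>ramp y - ramp x - ramp' x * (y - x)\<bar> \<le> 2 * (y - x)\<^sup>2"
proof -
  define T where "T a = (max 0 (y - a))\<^sup>2 - (max 0 (x - a))\<^sup>2 - 2 * max 0 (x - a) * (y - x)" for a
  have T: "\<bar>T a\<bar> \<le> (y - x)\<^sup>2" for a using max_sq_taylor[of "y - a" "x - a"] by (simp add: T_def)
  have "ramp y - ramp x - ramp' x * (y - x) = (T 0 - 2 * T 1 + T 2) / 2"
    by (simp add: T_def ramp_def ramp'_def algebra_simps add_divide_distrib diff_divide_distrib)
  then show ?thesis using T[of 0] T[of 1] T[of 2] by (simp add: abs_le_iff)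
qed

lemma C11_ramp_inner:
  assumes i: "norm i = 1"
  shows "C11 (2 * k\<^sup>2 + \<bar>k\<bar>) (\<lambda>x. ramp (k * (x \<bullet> i) + c)) (\<lambda>x. (k * ramp' (k * (x \<bullet> i) + c)) *\<^sub>R i)"
  unfolding C11_def
proof (intro conjI allI)
  fix x y
  have "\<bar>k\<bar> * \<bar>ramp' (k * (x \<bullet> i) + c)\<bar> \<le> \<bar>k\<bar>" using ramp'_bound mult_left_mono[of _ 1 "\<bar>k\<bar>"] by simp
  then show "norm ((k * ramp' (k * (x \<bullet> i) + c)) *\<^sub>R i) \<le> 2 * k\<^sup>2 + \<bar>k\<bar>"
    using i zero_le_power2[of k] by (simp only: norm_scaleR abs_mult)
  let ?u = "k * (x \<bullet> i) + c" and ?w = "k * (y \<bullet> i) + c"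
  have d: "?w - ?u = k * ((y - x) \<bullet> i)" by (simp add: algebra_simps inner_diff_left)
  have "\<bar>(y - x) \<bullet> i\<bar> \<le> norm (y - x)" using Cauchy_Schwarz_ineq2[of "y - x" i] i by simp
  then have "\<bar>(y - x) \<bullet> i\<bar>\<^sup>2 \<le> (norm (y - x))\<^sup>2" by (intro power_mono) auto
  then have "2 * (?w - ?u)\<^sup>2 \<le> (2 * k\<^sup>2) * (norm (y - x))\<^sup>2"
    unfolding d power_mult_distrib using mult_left_mono[of "((y - x) \<bullet> i)\<^sup>2" "(norm (y - x))\<^sup>2" "2 * k\<^sup>2"] by simp
  also have "\<dots> \<le> (2 * k\<^sup>2 + \<bar>k\<bar>) * (norm (y - x))\<^sup>2" by (intro mult_right_mono) auto
  finally have "2 * (?w - ?u)\<^sup>2 \<le> (2 * k\<^sup>2 + \<bar>k\<bar>) * (norm (y - x))\<^sup>2" .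
  moreover have ie: "(k * ramp' ?u) *\<^sub>R i \<bullet> (y - x) = ramp' ?u * (?w - ?u)"
    unfolding d by (simp add: inner_commute)
  ultimately show "\<bar>ramp ?w - ramp ?u - (k * ramp' ?u) *\<^sub>R i \<bullet> (y - x)\<bar> \<le> (2 * k\<^sup>2 + \<bar>k\<bar>) * (norm (y - x))\<^sup>2"
    unfolding ie using ramp_taylor[of ?w ?u] by linarith
qed

text \<open>A C11 substitute for the indicator of the box: it vanishes outside and equals 1 at
  points whose coordinates keep distance at least 2/k from the faces.\<close>

definition bump :: "nat \<Rightarrow> 'a::euclidean_space \<Rightarrow> 'a \<Rightarrow> 'a \<Rightarrow> real" where
  "bump k a b x = (\<Prod>i\<in>Basis. ramp (real k * (x \<bullet> i - a \<bullet> i)) * ramp (real k * (b \<bullet> i - x \<bullet> i)))"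

lemma bump_bounds: "0 \<le> bump k a b x" "bump k a b x \<le> 1"
  unfolding bump_def using ramp_bounds
  by (auto intro!: prod_nonneg prod_le_1 mult_nonneg_nonneg mult_le_one)

lemma bump_outside: "x \<notin> box a b \<Longrightarrow> bump k a b x = 0"
proof -
  assume "x \<notin> box a b"
  then obtain i where i: "i \<in> Basis" "x \<bullet> i \<le> a \<bullet> i \<or> b \<bullet> i \<le> x \<bullet> i" by (auto simp: mem_box not_less)
  then have "real k * (x \<bullet> i - a \<bullet> i) \<le> 0 \<or> real k * (b \<bullet> i - x \<bullet> i) \<le> 0"
    by (auto simp: mult_le_0_iff)
  then have "ramp (real k * (x \<bullet> i - a \<bullet> i)) * ramp (real k * (b \<bullet> i - x \<bullet> i)) = 0" using ramp_le by auto
  then show "bump k a b x = 0" unfolding bump_def using i(1) by (auto intro!: prod_zero)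
qed

lemma bump_tendsto: "(\<lambda>k. bump k a b x) \<longlonglongrightarrow> indicator (box a b) x"
proof (cases "x \<in> box a b")
  case True
  have one: "(\<lambda>k. ramp (real k * c)) \<longlonglongrightarrow> 1" if "c > 0" for c
  proof (rule tendsto_eventually)
    obtain N where N: "2 / c < real N" using reals_Archimedean2 by blast
    show "eventually (\<lambda>k. ramp (real k * c) = 1) sequentially"
      unfolding eventually_sequentially
    proof (intro exI[of _ N] allI impI ramp_ge)
      fix n assume "N \<le> n"
      then have "2 / c < real n" using N by simp
      then show "2 \<le> real n * c" using that by (simp add: divide_less_eq)
    qed
  qed
  have "(\<lambda>k. bump k a b x) \<longlonglongrightarrow> (\<Prod>i\<in>(Basis::'a set). 1 * 1)"
    unfolding bump_def
    by (intro tendsto_prod tendsto_mult one) (use True in \<open>auto simp: mem_box\<close>)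
  then show ?thesis using True by simp
next
  case False then show ?thesis by (simp add: bump_outside)
qed

lemma C11_bump: "\<exists>L D. C11 L (bump k a b) D"
proof -
  have "\<exists>L D. C11 L (\<lambda>x::'a. \<Prod>i\<in>S. ramp (real k * (x \<bullet> i - a \<bullet> i)) * ramp (real k * (b \<bullet> i - x \<bullet> i))) D"
    if "finite S" "S \<subseteq> Basis" for S
    using that
  proof (induction rule: finite_induct)
    case empty
    have "C11 0 (\<lambda>x::'a. 1) (\<lambda>x. 0)" by (simp add: C11_def)
    then show ?case by auto
  next
    case (insert i S)
    then obtain L D where LD: "C11 L (\<lambda>x::'a. \<Prod>i\<in>S. ramp (real k * (x \<bullet> i - a \<bullet> i)) * ramp (real k * (b \<bullet> i - x \<bullet> i))) D" by auto
    have i: "norm i = 1" using insert by simp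
    have e1: "(\<lambda>x. ramp (real k * (x \<bullet> i - a \<bullet> i))) = (\<lambda>x. ramp (real k * (x \<bullet> i) + (- real k * (a \<bullet> i))))"
      and e2: "(\<lambda>x. ramp (real k * (b \<bullet> i - x \<bullet> i))) = (\<lambda>x. ramp ((- real k) * (x \<bullet> i) + real k * (b \<bullet> i)))"
      by (auto simp: algebra_simps)
    have r: "\<bar>ramp s\<bar> \<le> 1" for s using ramp_bounds[of s] by simp
    have rr: "\<bar>ramp s * ramp t\<bar> \<le> 1" for s t using ramp_bounds[of s] ramp_bounds[of t] by (simp add: mult_le_one)
    have pr: "\<bar>\<Prod>i\<in>S. ramp (real k * (x \<bullet> i - a \<bullet> i)) * ramp (real k * (b \<bullet> i - x \<bullet> i))\<bar> \<le> 1" for x :: 'a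
      using ramp_bounds by (auto intro!: prod_le_1 mult_nonneg_nonneg mult_le_one simp: abs_prod abs_mult)
    have "\<exists>L D. C11 L (\<lambda>x. ramp (real k * (x \<bullet> i - a \<bullet> i)) * ramp (real k * (b \<bullet> i - x \<bullet> i))) D"
      using C11_mult[OF C11_ramp_inner[OF i, of "real k" "- real k * (a \<bullet> i)"] C11_ramp_inner[OF i, of "- real k" "real k * (b \<bullet> i)"] r r]
      unfolding e1[symmetric, THEN fun_cong] e2[symmetric, THEN fun_cong] by blast
    then obtain L' D' where "C11 L' (\<lambda>x. ramp (real k * (x \<bullet> i - a \<bullet> i)) * ramp (real k * (b \<bullet> i - x \<bullet> i))) D'" by blast
    from C11_mult[OF this LD rr pr] show ?case using insert(1,2) by auto
  qed
  from this[of Basis] show ?thesis unfolding bump_def[abs_def] by simp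
qed

lemma bump_borel[measurable]: "bump k a b \<in> borel_measurable borel"
  using C11_bump C11_borel by metis

lemma bump_integrable: "integrable lborel (bump k a b)"
proof (rule Bochner_Integration.integrable_bound[OF integrable_indicator_inter_box[of UNIV a b]])
  show "AE x in lborel. norm (bump k a b x) \<le> norm (indicator (UNIV \<inter> box a b) x :: real)"
  proof (rule AE_I2)
    fix x show "norm (bump k a b x) \<le> norm (indicator (UNIV \<inter> box a b) x :: real)"
      using bump_bounds[of k a b x] bump_outside[of x a b k] by (auto simp: indicator_def)
  qed
qed auto

text \<open>The generators now form a countable family of C11 functions: countability allows a
  diagonal subsequence, and C11 regularity gives equicontinuity in time for the scheme tested
  against each of them.\<close>

lemma L1_induct_bump [consumes 1, case_names bump add scale lim]:
  fixes f :: "'a::euclidean_space \<Rightarrow> real"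
  assumes f: "integrable lborel f"
    and bump: "\<And>k a b. rational_box a b \<Longrightarrow> P (bump k a b)"
    and add: "\<And>f g. integrable lborel f \<Longrightarrow> integrable lborel g \<Longrightarrow> P f \<Longrightarrow> P g \<Longrightarrow> P (\<lambda>x. f x + g x)"
    and scale: "\<And>c f. integrable lborel f \<Longrightarrow> P f \<Longrightarrow> P (\<lambda>x. c * f x)"
    and lim: "\<And>f. integrable lborel f \<Longrightarrow>
       (\<And>e. e > 0 \<Longrightarrow> \<exists>g. integrable lborel g \<and> P g \<and> (\<integral>x. \<bar>f x - g x\<bar> \<partial>lborel) \<le> e) \<Longrightarrow> P f"
  shows "P f"
  using f
proof (rule L1_induct)
  fix a b :: 'a assume ab: "rational_box a b"
  have ib: "integrable lborel (indicator (box a b) :: 'a \<Rightarrow> real)"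
    using integrable_indicator_inter_box[of UNIV a b] by simp
  show "P (indicator (box a b))"
  proof (rule lim[OF ib])
    have "(\<lambda>k. \<integral>x. \<bar>indicator (box a b) x - bump k a b x\<bar> \<partial>lborel) \<longlonglongrightarrow> (\<integral>x. 0 \<partial>(lborel::'a measure))"
    proof (rule integral_dominated_convergence[OF _ _ ib])
      show "AE x in lborel. (\<lambda>k. \<bar>indicator (box a b) x - bump k a b x\<bar>) \<longlonglongrightarrow> 0"
      proof (rule AE_I2)
        fix x
        have "(\<lambda>k. \<bar>indicator (box a b) x - bump k a b x\<bar>) \<longlonglongrightarrow> \<bar>indicator (box a b) x - indicator (box a b) x\<bar>"
          by (intro tendsto_intros bump_tendsto)
        then show "(\<lambda>k. \<bar>indicator (box a b) x - bump k a b x\<bar>) \<longlonglongrightarrow> 0" by simp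
      qed
      show "AE x in lborel. norm \<bar>indicator (box a b) x - bump k a b x\<bar> \<le> indicator (box a b) x" for k
      proof (rule AE_I2)
        fix x show "norm \<bar>indicator (box a b) x - bump k a b x\<bar> \<le> indicator (box a b) x"
          using bump_bounds[of k a b x] bump_outside[of x a b k] by (auto simp: indicator_def)
      qed
    qed auto
    then have lim0: "(\<lambda>k. \<integral>x. \<bar>indicator (box a b) x - bump k a b x\<bar> \<partial>lborel) \<longlonglongrightarrow> 0" by simp
    fix e :: real assume "e > 0"
    then have "eventually (\<lambda>k. (\<integral>x. \<bar>indicator (box a b) x - bump k a b x\<bar> \<partial>lborel) < e) sequentially"
      using order_tendstoD(2)[OF lim0] by blast
    then obtain k where "(\<integral>x. \<bar>indicator (box a b) x - bump k a b x\<bar> \<partial>lborel) < e" by (auto simp: eventually_sequentially)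
    then show "\<exists>g. integrable lborel g \<and> P g \<and> (\<integral>x. \<bar>indicator (box a b) x - g x\<bar> \<partial>lborel) \<le> e"
      using bump_integrable bump[OF ab] by (intro exI[of _ "bump k a b"]) auto
  qed
qed (fact add scale lim)+

section \<open>The regularised kernel\<close>

lemma norm_perp [simp]: "norm (perp x) = norm x"
  by (simp add: perp_def norm_eq_sqrt_inner inner_vec_def sum_2 add.commute)

lemma perp_simps: "perp (x + y) = perp x + perp y" "perp (x - y) = perp x - perp y" "perp (a *\<^sub>R x) = a *\<^sub>R perp x"
    "perp (- x) = - perp x" "perp 0 = 0" "perp (perp x) = - x"
  by (simp_all add: perp_def vec_eq_iff forall_2)

lemma linear_perp: "linear perp"
  by (rule linearI) (simp_all add: perp_simps)

lemma continuous_perp: "continuous_on S perp"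
  using linear_continuous_on[OF linear_perp[unfolded linear_conv_bounded_linear]] by blast

lemma borel_perp [measurable]: "perp \<in> borel_measurable borel"
  by (rule borel_measurable_continuous_onI[OF continuous_perp])

text \<open>The mean value inequality on the segment, applied to \<open>f\<close> minus its linear
  part at \<open>x\<close>. One constant serves for the size of the gradient, its Lipschitz bound
  and the remainder.\<close>

lemma C11_I:
  fixes f :: "'a::euclidean_space \<Rightarrow> real"
  assumes d: "\<And>x. (f has_derivative (\<lambda>h. D x \<bullet> h)) (at x)"
    and b: "\<And>x. norm (D x) \<le> L" and l: "\<And>x y. norm (D y - D x) \<le> L * norm (y - x)"
  shows "C11 L f D"
  unfolding C11_def
proof (intro conjI allI)
  fix x y :: 'a
  let ?S = "closed_segment x y"
  have L: "0 \<le> L" using b[of x] norm_ge_zero[of "D x"] by linarith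
  have "norm ((f y - D x \<bullet> y) - (f x - D x \<bullet> x)) \<le> (L * norm (y - x)) * norm (y - x)"
  proof (rule differentiable_bound[of ?S "\<lambda>z. f z - D x \<bullet> z" "\<lambda>z h. D z \<bullet> h - D x \<bullet> h"])
    fix z assume z: "z \<in> ?S"
    show "((\<lambda>z. f z - D x \<bullet> z) has_derivative (\<lambda>h. D z \<bullet> h - D x \<bullet> h)) (at z within ?S)"
      by (intro has_derivative_diff has_derivative_at_withinI[OF d] has_derivative_inner_right has_derivative_ident)
    show "onorm (\<lambda>h. D z \<bullet> h - D x \<bullet> h) \<le> L * norm (y - x)"
    proof (rule onorm_bound)
      have "norm (z - x) \<le> norm (y - x)"
        using segment_bound(1)[OF z] by (simp add: norm_minus_commute)
      then have "norm (D z - D x) \<le> L * norm (y - x)"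
        using l[of z x] mult_left_mono[OF _ L] order_trans by blast
      then show "norm (D z \<bullet> h - D x \<bullet> h) \<le> L * norm (y - x) * norm h" for h
        using Cauchy_Schwarz_ineq2[of "D z - D x" h] mult_right_mono[OF _ norm_ge_zero[of h]]
        by (fastforce simp: inner_diff_left)
    qed (use L in simp)
  qed auto
  moreover have "(f y - D x \<bullet> y) - (f x - D x \<bullet> x) = f y - f x - D x \<bullet> (y - x)" by (simp add: inner_diff_right)
  ultimately show "\<bar>f y - f x - D x \<bullet> (y - x)\<bar> \<le> L * (norm (y - x))\<^sup>2"
    by (simp add: power2_eq_square mult.assoc)
qed (rule b)

text \<open>Mean value theorem; the derivative is largest in modulus at the left end
  \<open>A\<close>.\<close>

lemma powr_neg_diff:
  fixes A B b :: real
  assumes "0 < A" "A \<le> B" "0 \<le> b"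
  shows "0 \<le> A powr (- b) - B powr (- b)" "A powr (- b) - B powr (- b) \<le> b * A powr (- b - 1) * (B - A)"
proof -
  show "0 \<le> A powr (- b) - B powr (- b)" using powr_mono2'[of "-b" A B] assms by simp
  show "A powr (- b) - B powr (- b) \<le> b * A powr (- b - 1) * (B - A)"
  proof (cases "A = B")
    case False
    then have "A < B" using assms by simp
    moreover have "((\<lambda>u. u powr (-b)) has_real_derivative (-b) * u powr (-b - 1)) (at u)" if "A \<le> u" "u \<le> B" for u
      using has_real_derivative_powr[of u "-b"] that assms by simp
    ultimately obtain z where z: "A < z" "z < B" "B powr (-b) - A powr (-b) = (B - A) * ((-b) * z powr (-b-1))"
      using MVT2[of A B "\<lambda>u. u powr (-b)" "\<lambda>u. (-b) * u powr (-b-1)"] by blast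
    have "z powr (-b-1) \<le> A powr (-b-1)" using powr_mono2'[of "-b-1" A z] z assms by simp
    then have "b * (B - A) * z powr (-b-1) \<le> b * (B - A) * A powr (-b-1)"
      using assms by (intro mult_left_mono) auto
    then show ?thesis using z(3) by (simp add: mult_ac)
  qed simp
qed

text \<open>The norm of the pair \<open>(x, e)\<close> is \<open>\<surd>(|x|\<^sup>2 + e\<^sup>2)\<close>, so \<open>e\<close> is the regularisation parameter and \<open>e = 0\<close>
  gives the kernel \<open>K\<^sub>s\<close> for \<open>b = 4 - 2s\<close>.\<close>

definition kern :: "real \<Rightarrow> real \<Rightarrow> real \<Rightarrow> real^2 \<Rightarrow> real^2" where
  "kern c b e x = (c * norm (x, e) powr (- b)) *\<^sub>R perp x"

text \<open>The stream function of \<open>kern\<close>: for positive \<open>e\<close> its gradient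
  is \<open>gradpot\<close>, which a quarter turn takes to \<open>kern\<close>. The sign and the
  factor \<open>b - 2\<close> compensate the exponent \<open>2 - b\<close> produced by
  differentiation.\<close>

definition pot :: "real \<Rightarrow> real \<Rightarrow> real \<Rightarrow> real^2 \<Rightarrow> real" where
  "pot c b e x = - (c / (b - 2)) * norm (x, e) powr (2 - b)"

definition gradpot :: "real \<Rightarrow> real \<Rightarrow> real \<Rightarrow> real^2 \<Rightarrow> real^2" where
  "gradpot c b e x = (c * norm (x, e) powr (- b)) *\<^sub>R x"

lemma K_kernel_eq: "K_kernel s = kern (c_const s) (4 - 2 * s) 0"
  by (rule ext) (simp only: K_kernel_def kern_def norm_Pair powr_minus divide_inverse, simp)

lemma perp_gradpot: "perp (gradpot c b e x) = kern c b e x"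
  by (simp add: gradpot_def kern_def perp_simps)

lemma kern_uminus: "kern c b e (- x) = - kern c b e x"
  by (simp add: kern_def perp_simps norm_Pair)

lemma norm_kern: "norm (kern c b e x) = \<bar>c\<bar> * norm (x, e) powr (- b) * norm x"
  by (simp add: kern_def abs_mult)

lemma norm_gradpot: "norm (gradpot c b e x) = norm (kern c b e x)"
  by (simp add: perp_gradpot[symmetric])

lemma kern_borel [measurable]: "kern c b e \<in> borel_measurable borel"
  unfolding kern_def by measurable

lemma pot_borel [measurable]: "pot c b e \<in> borel_measurable borel"
  unfolding pot_def by measurable

lemma reg_norm_ge: "norm x \<le> norm (x, e)" "\<bar>e\<bar> \<le> norm (x, e)" for x :: "real^2" and e :: real
  using norm_fst_le[of x e] norm_snd_le[of e x] by auto

lemma reg_norm_lip: "\<bar>norm (x, e) - norm (y, e)\<bar> \<le> norm (x - y)" for x y :: "real^2" and e :: real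
  using norm_triangle_ineq3[of "(x, e)" "(y, e)"] by (simp add: norm_Pair)

lemma reg_norm_le: "norm (x, e) \<le> norm x + \<bar>e\<bar>" for x :: "real^2" and e :: real
  using norm_Pair_le[of x e] by simp

section \<open>Estimates for the regularised kernel and its stream function\<close>

text \<open>For b = 4 - 2s this is the range 1/2 < s < 1. The upper bound makes |x|^(1-b) locally
  integrable in the plane; the lower one makes the power in \<open>pot\<close> negative, so that the
  regularised stream function is bounded.\<close>

locale riesz =
  fixes c b :: real
  assumes b: "2 < b" "b < 3"
begin

lemma norm_kern_le:
  assumes "0 < e"
  shows "norm (kern c b e x) \<le> \<bar>c\<bar> * e powr (1 - b)"
proof -
  let ?m = "norm (x, e)"
  have m: "e \<le> ?m" "norm x \<le> ?m" using reg_norm_ge(1)[of x e] reg_norm_ge(2)[of e x] assms by auto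
  have "norm (kern c b e x) \<le> \<bar>c\<bar> * ?m powr (- b) * ?m"
    unfolding norm_kern using m by (intro mult_left_mono) auto
  also have "\<dots> = \<bar>c\<bar> * ?m powr (1 - b)" using powr_mult_base[of ?m "-b"] by (simp add: mult.assoc mult.commute)
  also have "\<dots> \<le> \<bar>c\<bar> * e powr (1 - b)" using powr_mono2'[of "1-b" e ?m] m assms b by (intro mult_left_mono) auto
  finally show ?thesis .
qed

text \<open>With \<open>A <= B\<close> the two regularised norms, the difference splits into the
  change of the vector with the smaller scalar B^(-b), and the change of the scalar times the
  shorter vector. In the latter |x| <= A absorbs one power of A, so both parts are of order
  e^(-b).\<close>

lemma gradpot_lipschitz:
  assumes e: "0 < e"
  shows "norm (gradpot c b e y - gradpot c b e x) \<le> \<bar>c\<bar> * (1 + b) * e powr (- b) * norm (y - x)"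
proof -
  have main: "norm (gradpot c b e x - gradpot c b e y) \<le> \<bar>c\<bar> * (1 + b) * e powr (- b) * norm (x - y)"
    if le: "norm (x, e) \<le> norm (y, e)" for x y
  proof -
    define A B where "A = norm (x, e)" and "B = norm (y, e)"
    have A: "e \<le> A" "norm x \<le> A" "A \<le> B" and B: "e \<le> B"
      using reg_norm_ge(1)[of x e] reg_norm_ge(2)[of e x] reg_norm_ge(2)[of e y] e le by (auto simp: A_def B_def)
    have A0: "0 < A" using A e by simp
    have BA: "B - A \<le> norm (x - y)" using reg_norm_lip[of x e y] by (simp add: A_def B_def)
    define r where "r = A powr (-b) - B powr (-b)"
    have r: "0 \<le> r" "r \<le> b * A powr (- b - 1) * (B - A)"
      using powr_neg_diff[OF A0 A(3)] b unfolding r_def by auto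
    have "gradpot c b e x - gradpot c b e y = c *\<^sub>R (B powr (-b) *\<^sub>R (x - y) + r *\<^sub>R x)"
      by (simp add: gradpot_def A_def[symmetric] B_def[symmetric] r_def algebra_simps)
    then have "norm (gradpot c b e x - gradpot c b e y) \<le> \<bar>c\<bar> * (B powr (-b) * norm (x - y) + r * norm x)"
      using norm_triangle_ineq[of "B powr (-b) *\<^sub>R (x - y)" "r *\<^sub>R x"] r(1) mult_left_mono[OF _ abs_ge_zero[of c]]
      by simp
    also have "\<dots> \<le> \<bar>c\<bar> * (e powr (-b) * norm (x - y) + b * e powr (-b) * norm (x - y))"
    proof (intro mult_left_mono add_mono)
      show "B powr (-b) * norm (x - y) \<le> e powr (-b) * norm (x - y)"
        using powr_mono2'[of "-b" e B] B b e by (intro mult_right_mono) auto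
      have "r * norm x \<le> (b * A powr (- b - 1) * (B - A)) * A"
        using r A A0 b by (intro mult_mono) auto
      also have "\<dots> = b * A powr (-b) * (B - A)" using powr_mult_base[of A "-b-1"] A0 by (simp add: mult_ac)
      also have "\<dots> \<le> b * e powr (-b) * norm (x - y)"
        using powr_mono2'[of "-b" e A] A(1,3) b e BA by (intro mult_mono) auto
      finally show "r * norm x \<le> b * e powr (-b) * norm (x - y)" .
    qed auto
    finally show ?thesis by (simp add: algebra_simps)
  qed
  show ?thesis
    using main[of x y] main[of y x] by (cases "norm (x, e) \<le> norm (y, e)") (auto simp: norm_minus_commute)
qed

lemma kern_lipschitz:
  assumes e: "0 < e"
  shows "norm (kern c b e y - kern c b e x) \<le> \<bar>c\<bar> * (1 + b) * e powr (- b) * norm (y - x)"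
proof -
  have "norm (kern c b e y - kern c b e x) = norm (gradpot c b e y - gradpot c b e x)"
    by (simp add: perp_gradpot[symmetric] perp_simps(2)[symmetric])
  then show ?thesis using gradpot_lipschitz[OF e, of y x] by simp
qed

lemma pot_has_derivative:
  assumes e: "0 < e"
  shows "(pot c b e has_derivative (\<lambda>h. gradpot c b e x \<bullet> h)) (at x)"
proof -
  define u where "u x = x \<bullet> x + e\<^sup>2" for x :: "real^2"
  have u: "u x > 0" for x using e by (simp add: u_def add_nonneg_pos)
  have n: "norm (x, e) = sqrt (u x)" for x by (simp add: norm_Pair u_def power2_norm_eq_inner)
  have np: "norm (x, e) powr a = u x powr (a / 2)" for x a
    unfolding n by (simp add: powr_half_sqrt[OF less_imp_le[OF u], symmetric] powr_powr)
  have du: "(u has_derivative (\<lambda>h. 2 * (x \<bullet> h))) (at x)"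
    unfolding u_def by (rule derivative_eq_intros refl | simp add: inner_commute)+
  have dp: "((\<lambda>v. v powr ((2-b)/2)) has_derivative (\<lambda>k. ((2-b)/2 * u x powr ((2-b)/2 - 1)) * k)) (at (u x))"
    using has_real_derivative_powr[OF u[of x], of "(2-b)/2"] unfolding has_field_derivative_def .
  have "((\<lambda>x. u x powr ((2-b)/2)) has_derivative (\<lambda>h. ((2-b)/2 * u x powr ((2-b)/2 - 1)) * (2 * (x \<bullet> h)))) (at x)"
    by (rule has_derivative_compose[OF du dp])
  from has_derivative_mult_right[OF this, of "- (c / (b - 2))"]
  have "((\<lambda>x. - (c / (b - 2)) * u x powr ((2-b)/2)) has_derivative (\<lambda>h. - (c / (b - 2)) * (((2-b)/2 * u x powr ((2-b)/2 - 1)) * (2 * (x \<bullet> h))))) (at x)" .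
  moreover have "- (c / (b - 2)) * (((2-b)/2 * u x powr ((2-b)/2 - 1)) * (2 * (x \<bullet> h))) = gradpot c b e x \<bullet> h" for h
  proof -
    have e1: "(2-b)/2 - 1 = - b / 2" by (simp add: field_simps)
    have "- (c / (b - 2)) * (((2-b)/2 * u x powr ((2-b)/2 - 1)) * (2 * (x \<bullet> h))) = (- (c / (b - 2)) * (2-b)) * u x powr ((2-b)/2 - 1) * (x \<bullet> h)"
      by simp
    also have "- (c / (b - 2)) * (2-b) = c" using b by (simp add: field_simps)
    finally show ?thesis unfolding gradpot_def np e1 by simp
  qed
  ultimately show ?thesis unfolding pot_def[abs_def] np by simp
qed

text \<open>A Lipschitz constant plus a bound for the size of \<open>gradpot\<close>, since
  \<open>C11\<close> asks for one constant dominating both.\<close>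

definition Lpot :: "real \<Rightarrow> real" where
  "Lpot e = \<bar>c\<bar> * (1 + b) * e powr (- b) + \<bar>c\<bar> * e powr (1 - b)"

lemma C11_pot: "0 < e \<Longrightarrow> C11 (Lpot e) (pot c b e) (gradpot c b e)"
proof (rule C11_I)
  assume e: "0 < e"
  show "(pot c b e has_derivative (\<lambda>h. gradpot c b e x \<bullet> h)) (at x)" for x by (rule pot_has_derivative[OF e])
  have "0 \<le> \<bar>c\<bar> * (1 + b) * e powr (- b)" using b by (intro mult_nonneg_nonneg) auto
  then show "norm (gradpot c b e x) \<le> Lpot e" for x using norm_kern_le[OF e, of x] by (simp add: norm_gradpot Lpot_def)
  show "norm (gradpot c b e y - gradpot c b e x) \<le> Lpot e * norm (y - x)" for x y
  proof -
    have "0 \<le> \<bar>c\<bar> * e powr (1 - b) * norm (y - x)" by simp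
    then show ?thesis using gradpot_lipschitz[OF e, of y x] unfolding Lpot_def distrib_right by linarith
  qed
qed

lemma pot_bound:
  assumes "0 < e"
  shows "\<bar>pot c b e x\<bar> \<le> \<bar>c / (b - 2)\<bar> * e powr (2 - b)"
  unfolding pot_def using powr_mono2'[of "2-b" e "norm (x,e)"] reg_norm_ge(2)[of e x] assms b
  by (auto simp: abs_mult intro!: mult_left_mono divide_right_mono)

text \<open>Regularising only lowers the scalar factor. Hence both the regularised kernel and the
  error are dominated by the singular kernel, the majorant near the origin; outside the unit ball
  the error is of order \<open>e\<close>, because there the power is Lipschitz in the norm.\<close>

lemma kern_diff:
  assumes e: "0 \<le> e"
  shows "norm (kern c b 0 x - kern c b e x) \<le> norm (kern c b 0 x)"
    "norm (kern c b e x) \<le> norm (kern c b 0 x)"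
    "1 \<le> norm x \<Longrightarrow> norm (kern c b 0 x - kern c b e x) \<le> \<bar>c\<bar> * b * e"
proof -
  define A B where "A = norm x" and "B = norm (x, e)"
  have AB: "A \<le> B" "B \<le> A + e" using reg_norm_ge(1)[of x e] reg_norm_le[of x e] e by (auto simp: A_def B_def)
  have A: "norm (x, 0::real) = A" by (simp add: A_def norm_Pair)
  have d: "norm (kern c b 0 x - kern c b e x) = \<bar>c\<bar> * \<bar>A powr (-b) - B powr (-b)\<bar> * A"
  proof -
    have "kern c b 0 x - kern c b e x = (c * (A powr (-b) - B powr (-b))) *\<^sub>R perp x"
      unfolding kern_def A B_def[symmetric] by (simp add: algebra_simps)
    then show ?thesis by (simp add: abs_mult A_def)
  qed
  have k0: "norm (kern c b 0 x) = \<bar>c\<bar> * A powr (-b) * A" and ke: "norm (kern c b e x) = \<bar>c\<bar> * B powr (-b) * A"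
    unfolding norm_kern A by (simp_all add: A_def B_def)
  have A0: "0 \<le> A" by (simp add: A_def)
  have r: "\<bar>A powr (-b) - B powr (-b)\<bar> * A \<le> A powr (-b) * A \<and> B powr (-b) * A \<le> A powr (-b) * A"
  proof (cases "A = 0")
    case False
    then have "0 < A" using A0 by simp
    then show ?thesis using powr_neg_diff(1)[of A B b] AB b by (auto intro!: mult_right_mono)
  qed simp
  show "norm (kern c b 0 x - kern c b e x) \<le> norm (kern c b 0 x)"
    unfolding d k0 using r by (simp add: mult.assoc mult_left_mono)
  show "norm (kern c b e x) \<le> norm (kern c b 0 x)"
    unfolding ke k0 using r by (simp add: mult.assoc mult_left_mono)
  assume "1 \<le> norm x"
  then have A1: "1 \<le> A" by (simp add: A_def)
  have "\<bar>A powr (-b) - B powr (-b)\<bar> * A \<le> (b * A powr (- b - 1) * (B - A)) * A"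
    using powr_neg_diff[of A B b] AB b A1 by (intro mult_right_mono) auto
  also have "\<dots> = b * A powr (-b) * (B - A)" using powr_mult_base[of A "-b-1"] A1 by (simp add: mult_ac)
  also have "\<dots> \<le> b * 1 * e"
    using powr_mono2'[of "-b" 1 A] A1 AB b by (intro mult_mono) auto
  finally show "norm (kern c b 0 x - kern c b e x) \<le> \<bar>c\<bar> * b * e"
    unfolding d using mult_left_mono[OF _ abs_ge_zero[of c]] by (fastforce simp: mult.assoc)
qed

lemma norm_kern_outside: "0 \<le> e \<Longrightarrow> 1 \<le> norm x \<Longrightarrow> norm (kern c b e x) \<le> \<bar>c\<bar>"
proof -
  assume e: "0 \<le> e" and x: "1 \<le> norm x"
  have "norm x powr (-b) * norm x = norm x powr (1 - b)" using powr_mult_base[of "norm x" "-b"] by (simp add: mult.commute)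
  also have "\<dots> \<le> 1" using powr_mono2'[of "1-b" 1 "norm x"] x b by simp
  finally have "\<bar>c\<bar> * (norm x powr (-b) * norm x) \<le> \<bar>c\<bar> * 1" by (intro mult_left_mono) auto
  then have "norm (kern c b 0 x) \<le> \<bar>c\<bar>" unfolding norm_kern by (simp add: norm_Pair mult.assoc)
  then show ?thesis using kern_diff(2)[OF e, of x] by simp
qed

text \<open>Decay of order |x|^(1-b) with b < 3 is too slow for integrability at infinity. The
  kernel is therefore used as a test function vanishing at infinity, through
  \<open>weak_limit_C0\<close>.\<close>

lemma kern_tendsto_0: 
  assumes "0 < e"
  shows "(kern c b e \<longlongrightarrow> 0) at_infinity"
proof (rule Lim_null_comparison)
  show "\<forall>\<^sub>F x in at_infinity. norm (kern c b e x) \<le> \<bar>c\<bar> * norm x powr (1 - b)"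
  proof (rule always_eventually, rule allI)
    fix x
    have "norm (kern c b e x) \<le> norm (kern c b 0 x)" using kern_diff(2) assms by simp
    also have "\<dots> = \<bar>c\<bar> * norm x powr (1 - b)"
      unfolding norm_kern using powr_mult_base[of "norm x" "-b"] by (simp add: norm_Pair mult_ac)
    finally show "norm (kern c b e x) \<le> \<bar>c\<bar> * norm x powr (1 - b)" .
  qed
  have "((\<lambda>x::real^2. norm x powr (1 - b)) \<longlongrightarrow> 0) at_infinity"
    by (rule tendsto_neg_powr) (use b in \<open>auto simp: filterlim_norm_at_top\<close>)
  then show "((\<lambda>x::real^2. \<bar>c\<bar> * norm x powr (1 - b)) \<longlongrightarrow> 0) at_infinity"
    using tendsto_mult_right_zero by blast
qed

end

lemma nn_integral_abs_powr_finite: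
  fixes r :: real
  assumes r: "0 \<le> r" "r < 1"
  shows "(\<integral>\<^sup>+s. ennreal (\<bar>s\<bar> powr (- r)) * indicator {-1..1} s \<partial>lborel) < \<infinity>"
proof -
  have half: "(\<integral>\<^sup>+s. ennreal (if s \<in> {0..1} then s powr (- r) else 0) \<partial>lborel) = ennreal (1 powr (-r + 1) / (-r + 1))"
  proof (rule nn_integral_has_integral_lborel)
    have "((\<lambda>s. s powr (-r)) has_integral 1 powr (-r + 1) / (-r + 1)) {0..1}"
      by (rule has_integral_powr_from_0) (use r in auto)
    then show "((\<lambda>s. if s \<in> {0..1} then s powr (-r) else 0) has_integral 1 powr (-r + 1) / (-r + 1)) UNIV"
      by (subst has_integral_restrict_UNIV)
  qed auto
  let ?h = "\<lambda>s::real. ennreal (if s \<in> {0..1} then s powr (- r) else 0)"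
  have [measurable]: "?h \<in> borel_measurable borel" by measurable
  have "(\<integral>\<^sup>+s. ennreal (\<bar>s\<bar> powr (- r)) * indicator {-1..1} s \<partial>lborel) \<le> (\<integral>\<^sup>+s. ?h s + ?h (0 + (-1) * s) \<partial>lborel)"
    by (intro nn_integral_mono) (auto simp: indicator_def)
  also have "\<dots> = (\<integral>\<^sup>+s. ?h s \<partial>lborel) + (\<integral>\<^sup>+s. ?h (0 + (-1) * s) \<partial>lborel)"
    by (rule nn_integral_add) measurable
  also have "(\<integral>\<^sup>+s. ?h (0 + (-1) * s) \<partial>lborel) = (\<integral>\<^sup>+s. ?h s \<partial>lborel)"
    using nn_integral_real_affine[of ?h "-1" 0] by simp
  finally show ?thesis unfolding half by (auto intro: le_less_trans simp: ennreal_plus[symmetric] simp del: ennreal_plus)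
qed

text \<open>A product bound replaces polar coordinates: |x|^(1-b) is the square of |x|^(-r) with r =
  (b - 1) / 2, and each of the two factors is at most |x_i|^(-r) for one coordinate. The integral
  factors into one-dimensional ones, finite because b < 3 means r < 1.\<close>

lemma (in riesz) integrable_kern_ball: "integrable lborel (\<lambda>x. indicator (ball 0 1) x * norm (kern c b 0 x))"
proof (rule integrableI_bounded)
  have [measurable]: "ball (0::real^2) 1 \<in> sets borel" by simp
  show "(\<lambda>x. indicator (ball 0 1) x * norm (kern c b 0 x)) \<in> borel_measurable lborel" by measurable
  define r where "r = (b - 1) / 2"
  have r: "0 \<le> r" "r < 1" using b by (auto simp: r_def)
  \<comment> \<open>The value at 0 is set to infinity because \<open>0 powr (- r)\<close> is 0 by
    convention, and the product bound would fail on the coordinate axes.\<close>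
  define f :: "real \<Rightarrow> ennreal" where "f s = (if s = 0 then \<infinity> else ennreal (\<bar>s\<bar> powr (- r))) * indicator {-1..1} s" for s
  have [measurable]: "f \<in> borel_measurable borel" unfolding f_def by measurable
  have "(\<integral>\<^sup>+s. f s \<partial>lborel) = (\<integral>\<^sup>+s. ennreal (\<bar>s\<bar> powr (- r)) * indicator {-1..1} s \<partial>lborel)"
    using AE_lborel_singleton[of 0] by (intro nn_integral_cong_AE) (auto simp: f_def)
  then have ffin: "(\<integral>\<^sup>+s. f s \<partial>lborel) < \<infinity>" using nn_integral_abs_powr_finite[OF r] by simp
  have pt: "ennreal (norm (indicator (ball 0 1) x * norm (kern c b 0 x))) \<le> ennreal \<bar>c\<bar> * (\<Prod>i\<in>Basis. f (x \<bullet> i))" for x :: "real^2"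
  proof (cases "x \<in> ball 0 1")
    case True
    have le1: "\<bar>x \<bullet> i\<bar> \<le> norm x" "\<bar>x \<bullet> i\<bar> \<le> 1" if "i \<in> Basis" for i
      using Basis_le_norm[OF that, of x] True by auto
    have fge: "ennreal (norm x powr (-r)) \<le> f (x \<bullet> i)" if "i \<in> Basis" for i
      using le1[OF that] powr_mono2'[of "-r" "\<bar>x \<bullet> i\<bar>" "norm x"] r
      by (auto simp: f_def abs_le_iff intro!: ennreal_leI)
    have "norm (kern c b 0 x) = \<bar>c\<bar> * norm x powr (1 - b)"
      unfolding norm_kern using powr_mult_base[of "norm x" "-b"] by (simp add: norm_Pair mult_ac)
    also have "norm x powr (1 - b) = (norm x powr (-r))^2"
    proof -
      have "(norm x powr (-r))^2 = norm x powr (-r) * norm x powr (-r)" by (simp add: power2_eq_square)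
      also have "\<dots> = norm x powr (-r + -r)" by (simp only: powr_add)
      also have "-r + -r = 1 - b" by (simp add: r_def field_simps)
      finally show ?thesis by simp
    qed
    finally have "ennreal (norm (kern c b 0 x)) = ennreal \<bar>c\<bar> * (\<Prod>i\<in>(Basis::(real^2) set). ennreal (norm x powr (-r)))"
      by (simp add: ennreal_mult ennreal_power)
    also have "\<dots> \<le> ennreal \<bar>c\<bar> * (\<Prod>i\<in>Basis. f (x \<bullet> i))"
      by (intro mult_left_mono prod_mono_ennreal) (use fge in auto)
    finally show ?thesis using True by simp
  qed simp
  have "(\<integral>\<^sup>+x. ennreal (norm (indicator (ball 0 1) x * norm (kern c b 0 x))) \<partial>lborel)
      \<le> (\<integral>\<^sup>+x. ennreal \<bar>c\<bar> * (\<Prod>i\<in>Basis. f (x \<bullet> i)) \<partial>(lborel::(real^2) measure))"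
    by (rule nn_integral_mono) (rule pt)
  also have "\<dots> = ennreal \<bar>c\<bar> * (\<integral>\<^sup>+x. (\<Prod>i\<in>Basis. f (x \<bullet> i)) \<partial>(lborel::(real^2) measure))"
    by (rule nn_integral_cmult) measurable
  also have "(\<integral>\<^sup>+x. (\<Prod>i\<in>Basis. f (x \<bullet> i)) \<partial>(lborel::(real^2) measure)) = (\<Prod>i\<in>(Basis::(real^2) set). \<integral>\<^sup>+s. f s \<partial>lborel)"
    by (rule nn_integral_lborel_prod) auto
  also have "ennreal \<bar>c\<bar> * (\<Prod>i\<in>(Basis::(real^2) set). \<integral>\<^sup>+s. f s \<partial>lborel) < \<infinity>"
    using ffin by (simp add: ennreal_mult_less_top power_less_top_ennreal)
  finally show "(\<integral>\<^sup>+x. ennreal (norm (indicator (ball 0 1) x * norm (kern c b 0 x))) \<partial>lborel) < \<infinity>" .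
qed

section \<open>Velocity fields of bounded integrable vorticities\<close>

text \<open>A fixed Borel representative with bounds at every point, so that no exceptional null
  sets accumulate along the scheme.\<close>

definition bdd_L1 :: "real \<Rightarrow> real \<Rightarrow> ('a::euclidean_space \<Rightarrow> real) \<Rightarrow> bool" where
  "bdd_L1 C M f \<longleftrightarrow> f \<in> borel_measurable borel \<and> (\<forall>x. \<bar>f x\<bar> \<le> C) \<and> integrable lborel f \<and> (\<integral>x. \<bar>f x\<bar> \<partial>lborel) \<le> M"

lemma bdd_L1D:
  assumes "bdd_L1 C M f"
  shows "f \<in> borel_measurable borel" "\<bar>f x\<bar> \<le> C" "integrable lborel f" "(\<integral>x. \<bar>f x\<bar> \<partial>lborel) \<le> M" "0 \<le> C" "0 \<le> M"
proof -
  have "0 \<le> (\<integral>x. \<bar>f x\<bar> \<partial>lborel)" by simp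
  then show "0 \<le> M" "0 \<le> C" using assms abs_ge_zero order_trans unfolding bdd_L1_def by blast+
qed (use assms in \<open>auto simp: bdd_L1_def\<close>)

text \<open>The three-term argument for exchanging limits. \<open>Y\<close> will be the same
  quantity with a fixed regularisation of the kernel, or with a nicer test function.\<close>

lemma tendsto_approx:
  fixes X :: "nat \<Rightarrow> 'a::metric_space"
  assumes "\<And>\<eta>. \<eta> > 0 \<Longrightarrow> \<exists>Y m. (\<forall>\<^sub>F n in sequentially. dist (X n) (Y n) \<le> \<eta>) \<and> Y \<longlonglongrightarrow> m \<and> dist m l \<le> \<eta>"
  shows "X \<longlonglongrightarrow> l"
proof (rule tendstoI)
  fix e :: real assume e: "e > 0"
  then obtain Y m where Y: "\<forall>\<^sub>F n in sequentially. dist (X n) (Y n) \<le> e / 4" "Y \<longlonglongrightarrow> m" "dist m l \<le> e / 4"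
    using assms[of "e / 4"] by auto
  have "\<forall>\<^sub>F n in sequentially. dist (Y n) m < e / 4" using tendstoD[OF Y(2), of "e/4"] e by simp
  with Y(1) show "\<forall>\<^sub>F n in sequentially. dist (X n) l < e"
  proof eventually_elim
    case (elim n)
    have "dist (X n) l \<le> dist (X n) (Y n) + dist (Y n) m + dist m l"
      using dist_triangle[of "X n" l "Y n"] dist_triangle[of "Y n" l m] by linarith
    then show ?case using elim Y(3) e by linarith
  qed
qed

text \<open>Cut the test function at a large ball. Inside it is integrable; outside it is uniformly
  small, and the common mass bound \<open>M\<close> makes that part of the pairing small uniformly
  in \<open>n\<close>.\<close>

lemma weak_limit_C0:
  fixes f :: "nat \<Rightarrow> 'a::euclidean_space \<Rightarrow> real"
  assumes f: "\<And>n. bdd_L1 C M (f n)" and g: "bdd_L1 C M g"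
    and lim: "\<And>\<phi>. integrable lborel \<phi> \<Longrightarrow> (\<lambda>n. \<integral>x. f n x * \<phi> x \<partial>lborel) \<longlonglongrightarrow> (\<integral>x. g x * \<phi> x \<partial>lborel)"
    and \<phi>: "\<phi> \<in> borel_measurable borel" "\<And>x. \<bar>\<phi> x\<bar> \<le> B" "(\<phi> \<longlongrightarrow> 0) at_infinity"
  shows "(\<lambda>n. \<integral>x. f n x * \<phi> x \<partial>lborel) \<longlonglongrightarrow> (\<integral>x. g x * \<phi> x \<partial>lborel)"
proof (rule tendsto_approx)
  fix \<eta> :: real assume \<eta>: "\<eta> > 0"
  have M: "0 \<le> M" using bdd_L1D(6)[OF g] .
  define \<epsilon> where "\<epsilon> = \<eta> / (M + 1)"
  have \<epsilon>: "\<epsilon> > 0" "M * \<epsilon> \<le> \<eta>" using \<eta> M by (auto simp: \<epsilon>_def field_simps)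
  have "\<forall>\<^sub>F x in at_infinity. \<bar>\<phi> x\<bar> < \<epsilon>" using tendstoD[OF \<phi>(3) \<epsilon>(1)] by simp
  then obtain R where R: "\<And>x. R \<le> norm x \<Longrightarrow> \<bar>\<phi> x\<bar> < \<epsilon>" by (auto simp: eventually_at_infinity)
  define \<phi>1 where "\<phi>1 x = indicator (ball 0 R) x * \<phi> x" for x
  have [measurable]: "ball (0::'a) R \<in> sets borel" by simp
  have ib: "integrable lborel (indicator (ball 0 R) :: 'a \<Rightarrow> real)"
    by (rule integrable_real_indicator) (use emeasure_lborel_ball_finite[of "0::'a" R] in simp_all)
  have \<phi>1i: "integrable lborel \<phi>1"
    using integrable_bounded_mult[OF \<phi>(1,2) ib] by (simp add: \<phi>1_def[abs_def] mult.commute)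
  have \<phi>2: "(\<lambda>x. \<phi> x - \<phi>1 x) \<in> borel_measurable borel" unfolding \<phi>1_def using \<phi>(1) by measurable
  have \<phi>2b: "\<bar>\<phi> x - \<phi>1 x\<bar> \<le> \<epsilon>" for x using R[of x] \<epsilon> by (auto simp: \<phi>1_def indicator_def)
  have close: "dist (\<integral>x. h x * \<phi> x \<partial>lborel) (\<integral>x. h x * \<phi>1 x \<partial>lborel) \<le> \<eta>" if h: "bdd_L1 C M h" for h
  proof -
    have "(\<integral>x. h x * \<phi> x \<partial>lborel) - (\<integral>x. h x * \<phi>1 x \<partial>lborel) = (\<integral>x. (\<phi> x - \<phi>1 x) * h x \<partial>lborel)"
      using integrable_bounded_mult[OF \<phi>(1,2) bdd_L1D(3)[OF h]] integrable_bounded_mult[OF bdd_L1D(1,2)[OF h] \<phi>1i]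
      by (subst Bochner_Integration.integral_diff[symmetric]) (auto simp: algebra_simps)
    moreover have "\<bar>\<dots>\<bar> \<le> \<epsilon> * (\<integral>x. \<bar>h x\<bar> \<partial>lborel)"
      by (rule integral_bounded_mult_le[OF \<phi>2 \<phi>2b bdd_L1D(3)[OF h]])
    moreover have "\<epsilon> * (\<integral>x. \<bar>h x\<bar> \<partial>lborel) \<le> \<epsilon> * M" using bdd_L1D(4)[OF h] \<epsilon>(1) by (intro mult_left_mono) auto
    ultimately show ?thesis using \<epsilon>(2) by (simp add: dist_real_def mult.commute)
  qed
  show "\<exists>Y m. (\<forall>\<^sub>F n in sequentially. dist (\<integral>x. f n x * \<phi> x \<partial>lborel) (Y n) \<le> \<eta>) \<and> Y \<longlonglongrightarrow> m \<and> dist m (\<integral>x. g x * \<phi> x \<partial>lborel) \<le> \<eta>"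
    using lim[OF \<phi>1i] close[OF f] close[OF g]
    by (intro exI[of _ "\<lambda>n. \<integral>x. f n x * \<phi>1 x \<partial>lborel"] exI[of _ "\<integral>x. g x * \<phi>1 x \<partial>lborel"]) (auto simp: dist_commute)
qed

text \<open>Split at distance 1 from \<open>z\<close>: nearby the vorticity is bounded by
  \<open>C\<close> and \<open>d\<close> is integrable, farther away \<open>d\<close> is bounded by
  \<open>B\<close> and the vorticity has mass at most \<open>M\<close>. Both the singular kernel and
  its regularisation error have this form.\<close>

lemma bdd_L1_local_mult:
  fixes d :: "'a::euclidean_space \<Rightarrow> real"
  assumes f: "bdd_L1 C M f" and d: "d \<in> borel_measurable borel" "\<And>x. 0 \<le> d x"
    and i: "integrable lborel (\<lambda>x. indicator (ball 0 1) x * d x)"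
    and B: "0 \<le> B" "\<And>x. 1 \<le> norm x \<Longrightarrow> d x \<le> B"
  shows "integrable lborel (\<lambda>y. \<bar>f y\<bar> * d (y - z))" (is ?A)
    and "(\<integral>y. \<bar>f y\<bar> * d (y - z) \<partial>lborel) \<le> C * (\<integral>x. indicator (ball 0 1) x * d x \<partial>lborel) + M * B" (is ?B)
proof -
  note [measurable] = bdd_L1D(1)[OF f] d(1)
  let ?i = "\<lambda>x. indicator (ball 0 1) x * d x"
  have le: "\<bar>f y\<bar> * d (y - z) \<le> C * ?i (y + - z) + B * \<bar>f y\<bar>" for y
  proof (cases "norm (y - z) < 1")
    case True
    have "\<bar>f y\<bar> * d (y - z) \<le> C * d (y - z)" using bdd_L1D(2)[OF f] d(2) by (intro mult_right_mono)
    moreover have "0 \<le> B * \<bar>f y\<bar>" using B by simp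
    ultimately show ?thesis using True by simp
  next
    case False
    then have "\<bar>f y\<bar> * d (y - z) \<le> \<bar>f y\<bar> * B" using B by (intro mult_left_mono) auto
    then show ?thesis using False by (simp add: mult.commute)
  qed
  have im: "?i \<in> borel_measurable borel" using borel_measurable_integrable[OF i] by simp
  have si: "integrable lborel (\<lambda>y. ?i (y + - z))" by (rule integrable_lborel_shift[OF i])
  have fi: "integrable lborel (\<lambda>y. \<bar>f y\<bar>)" using bdd_L1D(3)[OF f] by simp
  have ri: "integrable lborel (\<lambda>y. C * ?i (y + - z) + B * \<bar>f y\<bar>)" using si fi by (intro Bochner_Integration.integrable_add integrable_mult_right)
  show ?A
  proof (rule Bochner_Integration.integrable_bound[OF ri])
    show "AE y in lborel. norm (\<bar>f y\<bar> * d (y - z)) \<le> norm (C * ?i (y + - z) + B * \<bar>f y\<bar>)"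
    proof (rule AE_I2)
      fix y
      have "0 \<le> \<bar>f y\<bar> * d (y - z)" using d(2) by simp
      then show "norm (\<bar>f y\<bar> * d (y - z)) \<le> norm (C * ?i (y + - z) + B * \<bar>f y\<bar>)" using le[of y] unfolding real_norm_def by linarith
    qed
  qed measurable
  then have "(\<integral>y. \<bar>f y\<bar> * d (y - z) \<partial>lborel) \<le> (\<integral>y. C * ?i (y + - z) + B * \<bar>f y\<bar> \<partial>lborel)"
    using ri le by (rule integral_mono)
  also have "\<dots> = C * (\<integral>y. ?i (y + - z) \<partial>lborel) + B * (\<integral>y. \<bar>f y\<bar> \<partial>lborel)"
    using si fi by simp
  also have "(\<integral>y. ?i (y + - z) \<partial>lborel) = (\<integral>y. ?i y \<partial>lborel)" by (rule integral_lborel_shift[OF im])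
  also have "B * (\<integral>y. \<bar>f y\<bar> \<partial>lborel) \<le> B * M" using bdd_L1D(4)[OF f] B by (intro mult_left_mono)
  finally show ?B by (simp add: mult.commute)
qed

definition vel :: "real \<Rightarrow> real \<Rightarrow> real \<Rightarrow> (real^2 \<Rightarrow> real) \<Rightarrow> real^2 \<Rightarrow> real^2" where
  "vel c b e f x = (\<integral>y. f y *\<^sub>R kern c b e (x - y) \<partial>lborel)"

lemma vel_borel [measurable]:
  assumes [measurable]: "f \<in> borel_measurable borel"
  shows "vel c b e f \<in> borel_measurable borel"
  unfolding vel_def by measurable

text \<open>The stream function of the regularised velocity, including the contribution of the vortex at \<open>z\<close>.\<close>

definition Psi :: "real \<Rightarrow> real \<Rightarrow> real \<Rightarrow> (real^2 \<Rightarrow> real) \<Rightarrow> real^2 \<Rightarrow> real^2 \<Rightarrow> real" where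
  "Psi c b e f z x = (\<integral>y. f y * pot c b e (x - y) \<partial>lborel) + pot c b e (x - z)"

definition gradPsi :: "real \<Rightarrow> real \<Rightarrow> real \<Rightarrow> (real^2 \<Rightarrow> real) \<Rightarrow> real^2 \<Rightarrow> real^2 \<Rightarrow> real^2" where
  "gradPsi c b e f z x = (\<integral>y. f y *\<^sub>R gradpot c b e (x - y) \<partial>lborel) + gradpot c b e (x - z)"

context riesz
begin

lemma norm_kern_uminus: "norm (kern c b e (x - y)) = norm (kern c b e (y - x))"
  "norm (kern c b e (x - y) - kern c b e' (x - y)) = norm (kern c b e (y - x) - kern c b e' (y - x))"
proof -
  have k: "kern c b e (x - y) = - kern c b e (y - x)" for e using kern_uminus[of c b e "y - x"] by simp
  show "norm (kern c b e (x - y)) = norm (kern c b e (y - x))"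
    "norm (kern c b e (x - y) - kern c b e' (x - y)) = norm (kern c b e (y - x) - kern c b e' (y - x))"
    unfolding k by (auto simp: norm_minus_commute)
qed

definition kern_gap :: "real \<Rightarrow> real" where
  "kern_gap e = (\<integral>x. indicator (ball 0 1) x * norm (kern c b 0 x - kern c b e x) \<partial>lborel)"

text \<open>The price of regularising the kernel, depending on the vorticity only through its bounds
  \<open>C\<close> and \<open>M\<close>. It controls velocities and, up to the size of the test
  field, the fluxes created by the vortex.\<close>

definition vel_gap :: "real \<Rightarrow> real \<Rightarrow> real \<Rightarrow> real" where
  "vel_gap C M e = C * kern_gap e + M * (\<bar>c\<bar> * b * e)"

text \<open>A speed bound uniform in the point, the regularisation and all vorticities with the same
  bounds; it gives the equicontinuity of the vortex trajectories.\<close>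

definition Vmax :: "real \<Rightarrow> real \<Rightarrow> real" where
  "Vmax C M = C * (\<integral>x. indicator (ball 0 1) x * norm (kern c b 0 x) \<partial>lborel) + M * \<bar>c\<bar>"

lemma integrable_ball_bounded:
  assumes [measurable]: "d \<in> borel_measurable borel" and "\<And>x. \<bar>d x\<bar> \<le> norm (kern c b 0 x)"
  shows "integrable lborel (\<lambda>x. indicator (ball 0 1) x * d x)"
proof (rule Bochner_Integration.integrable_bound[OF integrable_kern_ball])
  have [measurable]: "ball (0::real^2) 1 \<in> sets borel" by simp
  show "(\<lambda>x. indicator (ball 0 1) x * d x) \<in> borel_measurable lborel" by measurable
  show "AE x in lborel. norm (indicator (ball 0 1) x * d x) \<le> norm (indicator (ball 0 1) x * norm (kern c b 0 x))"
    using assms(2) by (auto simp: indicator_def intro!: AE_I2)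
qed

lemma kern_mult:
  assumes f: "bdd_L1 C M f" and e: "0 \<le> e"
  shows "integrable lborel (\<lambda>y. \<bar>f y\<bar> * norm (kern c b e (y - z)))"
    "(\<integral>y. \<bar>f y\<bar> * norm (kern c b e (y - z)) \<partial>lborel) \<le> Vmax C M"
    "integrable lborel (\<lambda>y. \<bar>f y\<bar> * norm (kern c b 0 (y - z) - kern c b e (y - z)))"
    "(\<integral>y. \<bar>f y\<bar> * norm (kern c b 0 (y - z) - kern c b e (y - z)) \<partial>lborel) \<le> vel_gap C M e"
proof -
  have i1: "integrable lborel (\<lambda>x. indicator (ball 0 1) x * norm (kern c b e x))"
    by (rule integrable_ball_bounded) (use kern_diff(2)[OF e] in auto)
  have i2: "integrable lborel (\<lambda>x. indicator (ball 0 1) x * norm (kern c b 0 x - kern c b e x))"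
    by (rule integrable_ball_bounded) (use kern_diff(1)[OF e] in auto)
  note 1 = bdd_L1_local_mult[OF f _ norm_ge_zero i1 abs_ge_zero norm_kern_outside[OF e], of z]
  show "integrable lborel (\<lambda>y. \<bar>f y\<bar> * norm (kern c b e (y - z)))" by (rule 1(1)) auto
  have "(\<integral>y. \<bar>f y\<bar> * norm (kern c b e (y - z)) \<partial>lborel)
      \<le> C * (\<integral>x. indicator (ball 0 1) x * norm (kern c b e x) \<partial>lborel) + M * \<bar>c\<bar>"
    by (rule 1(2)) auto
  also have "(\<integral>x. indicator (ball 0 1) x * norm (kern c b e x) \<partial>lborel) \<le> (\<integral>x. indicator (ball 0 1) x * norm (kern c b 0 x) \<partial>lborel)"
    by (intro integral_mono i1 integrable_kern_ball mult_left_mono kern_diff(2)[OF e]) auto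
  finally show "(\<integral>y. \<bar>f y\<bar> * norm (kern c b e (y - z)) \<partial>lborel) \<le> Vmax C M"
    using bdd_L1D(5)[OF f] by (simp add: Vmax_def mult_left_mono)
  have B: "0 \<le> \<bar>c\<bar> * b * e" using b e by simp
  note 2 = bdd_L1_local_mult[OF f _ norm_ge_zero i2 B kern_diff(3)[OF e], of z]
  show "integrable lborel (\<lambda>y. \<bar>f y\<bar> * norm (kern c b 0 (y - z) - kern c b e (y - z)))" by (rule 2(1)) auto
  show "(\<integral>y. \<bar>f y\<bar> * norm (kern c b 0 (y - z) - kern c b e (y - z)) \<partial>lborel) \<le> vel_gap C M e"
    unfolding vel_gap_def kern_gap_def by (rule 2(2)) auto
qed

lemma vel_integrable:
  assumes f: "bdd_L1 C M f" and e: "0 \<le> e"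
  shows "integrable lborel (\<lambda>y. f y *\<^sub>R kern c b e (x - y))"
  by (rule Bochner_Integration.integrable_bound[OF kern_mult(1)[OF f e, of x]])
    (use bdd_L1D(1)[OF f] norm_kern_uminus in auto)

lemma vel_bound:
  assumes f: "bdd_L1 C M f" and e: "0 \<le> e"
  shows "norm (vel c b e f x) \<le> Vmax C M"
proof -
  have "norm (vel c b e f x) \<le> (\<integral>y. norm (f y *\<^sub>R kern c b e (x - y)) \<partial>lborel)"
    unfolding vel_def by (rule integral_norm_bound)
  also have "\<dots> = (\<integral>y. \<bar>f y\<bar> * norm (kern c b e (y - x)) \<partial>lborel)" by (simp add: norm_kern_uminus)
  finally show ?thesis using kern_mult(2)[OF f e, of x] by simp
qed

lemma vel_diff:
  assumes f: "bdd_L1 C M f" and e: "0 \<le> e"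
  shows "dist (vel c b 0 f x) (vel c b e f x) \<le> vel_gap C M e"
proof -
  have "vel c b 0 f x - vel c b e f x = (\<integral>y. f y *\<^sub>R (kern c b 0 (x - y) - kern c b e (x - y)) \<partial>lborel)"
    unfolding vel_def using vel_integrable[OF f] e by (simp add: scaleR_diff_right)
  then have "dist (vel c b 0 f x) (vel c b e f x) \<le> (\<integral>y. norm (f y *\<^sub>R (kern c b 0 (x - y) - kern c b e (x - y))) \<partial>lborel)"
    unfolding dist_norm by (simp only:) (rule integral_norm_bound)
  also have "\<dots> = (\<integral>y. \<bar>f y\<bar> * norm (kern c b 0 (y - x) - kern c b e (y - x)) \<partial>lborel)" by (simp add: norm_kern_uminus)
  finally show ?thesis using kern_mult(4)[OF f e, of x] by simp
qed

lemma vel_gap_tendsto: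
  assumes e: "\<And>n. 0 \<le> e n" "e \<longlonglongrightarrow> 0"
  shows "(\<lambda>n. vel_gap C M (e n)) \<longlonglongrightarrow> 0"
proof -
  have "(\<lambda>n. kern_gap (e n)) \<longlonglongrightarrow> (\<integral>x. 0 \<partial>(lborel :: (real^2) measure))"
    unfolding kern_gap_def
  proof (rule integral_dominated_convergence[OF _ _ integrable_kern_ball])
    have [measurable]: "ball (0::real^2) 1 \<in> sets borel" by simp
    show "(\<lambda>x. indicator (ball 0 1) x * norm (kern c b 0 x - kern c b (e n) x)) \<in> borel_measurable lborel" for n by measurable
    show "AE x in lborel. norm (indicator (ball 0 1) x * norm (kern c b 0 x - kern c b (e n) x)) \<le> indicator (ball 0 1) x * norm (kern c b 0 x)" for n
      using kern_diff(1)[OF e(1)] by (auto simp: indicator_def intro!: AE_I2)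
    show "AE x in lborel. (\<lambda>n. indicator (ball 0 1) x * norm (kern c b 0 x - kern c b (e n) x)) \<longlonglongrightarrow> 0"
    proof (rule AE_I2)
      fix x :: "real^2"
      have "(\<lambda>n. kern c b (e n) x) \<longlonglongrightarrow> kern c b 0 x"
      \<comment> \<open>At the origin the power is not continuous in the regularisation parameter,
        but \<open>perp 0 = 0\<close> makes all the kernels vanish there.\<close>
      proof (cases "x = 0")
        case False
        have "(\<lambda>n. norm (x, e n) powr (- b)) \<longlonglongrightarrow> norm (x, 0::real) powr (- b)"
          by (intro tendsto_powr tendsto_norm tendsto_Pair tendsto_const e(2)) (use False in \<open>simp add: norm_Pair\<close>)
        then show ?thesis unfolding kern_def by (intro tendsto_scaleR tendsto_mult tendsto_const)
      qed (simp add: kern_def perp_simps)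
      then have "(\<lambda>n. indicator (ball 0 1) x * norm (kern c b 0 x - kern c b (e n) x)) \<longlonglongrightarrow> indicator (ball 0 1) x * norm (kern c b 0 x - kern c b 0 x)"
        by (intro tendsto_intros)
      then show "(\<lambda>n. indicator (ball 0 1) x * norm (kern c b 0 x - kern c b (e n) x)) \<longlonglongrightarrow> 0" by simp
    qed
  qed simp
  then have "(\<lambda>n. vel_gap C M (e n)) \<longlonglongrightarrow> C * (\<integral>x. 0 \<partial>(lborel :: (real^2) measure)) + M * (\<bar>c\<bar> * b * 0)"
    unfolding vel_gap_def by (intro tendsto_intros e(2))
  then show ?thesis by simp
qed

lemma vel_gap_small:
  assumes "\<eta> > 0" shows "\<exists>r>0. vel_gap C M r \<le> \<eta>"
proof -
  have "(\<lambda>n. vel_gap C M (inverse (real (Suc n)))) \<longlonglongrightarrow> 0"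
    by (rule vel_gap_tendsto[OF _ LIMSEQ_inverse_real_of_nat]) simp
  then have "\<forall>\<^sub>F n in sequentially. vel_gap C M (inverse (real (Suc n))) < \<eta>" using assms order_tendstoD(2) by blast
  then obtain n where "vel_gap C M (inverse (real (Suc n))) < \<eta>" by (auto simp: eventually_sequentially)
  then show ?thesis by (intro exI[of _ "inverse (real (Suc n))"]) auto
qed

lemma vel_lipschitz:
  assumes f: "bdd_L1 C M f" and e: "0 < e"
  shows "norm (vel c b e f y - vel c b e f x) \<le> M * (\<bar>c\<bar> * (1 + b) * e powr (- b) * norm (y - x))"
proof -
  let ?l = "\<bar>c\<bar> * (1 + b) * e powr (- b) * norm (y - x)"
  have fi: "integrable lborel (\<lambda>y. \<bar>f y\<bar>)" using bdd_L1D(3)[OF f] by simp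
  have i: "integrable lborel (\<lambda>w. f w *\<^sub>R (kern c b e (y - w) - kern c b e (x - w)))"
    using vel_integrable[OF f, of e] e by (simp add: scaleR_diff_right)
  have "vel c b e f y - vel c b e f x = (\<integral>w. f w *\<^sub>R (kern c b e (y - w) - kern c b e (x - w)) \<partial>lborel)"
    unfolding vel_def using vel_integrable[OF f, of e] e by (simp add: scaleR_diff_right)
  then have "norm (vel c b e f y - vel c b e f x) \<le> (\<integral>w. norm (f w *\<^sub>R (kern c b e (y - w) - kern c b e (x - w))) \<partial>lborel)"
    by (simp only:) (rule integral_norm_bound)
  also have "\<dots> \<le> (\<integral>w. \<bar>f w\<bar> * ?l \<partial>lborel)"
  proof (rule integral_mono)
    show "norm (f w *\<^sub>R (kern c b e (y - w) - kern c b e (x - w))) \<le> \<bar>f w\<bar> * ?l" for w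
      using kern_lipschitz[OF e, of "y - w" "x - w"] by (auto intro: mult_left_mono)
    show "integrable lborel (\<lambda>w. norm (f w *\<^sub>R (kern c b e (y - w) - kern c b e (x - w))))"
      by (rule integrable_norm[OF i])
    show "integrable lborel (\<lambda>w. \<bar>f w\<bar> * ?l)" by (rule integrable_mult_left[OF fi])
  qed
  also have "\<dots> = (\<integral>w. \<bar>f w\<bar> \<partial>lborel) * ?l" by simp
  also have "\<dots> \<le> M * ?l" using bdd_L1D(4)[OF f] b by (intro mult_right_mono) auto
  finally show ?thesis .
qed

section \<open>Velocities and vortex fluxes under weak convergence\<close>

text \<open>Comparing with a fixed regularisation \<open>r\<close> costs only
  \<open>vel_gap\<close>, uniformly in \<open>n\<close>. At level \<open>r\<close> the kernel seen
  from \<open>x0\<close> is one fixed function vanishing at infinity, so weak convergence applies,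
  and the velocities share a Lipschitz constant, so the evaluation point may move.\<close>

lemma vel_converges:
  assumes f: "\<And>n. bdd_L1 C M (f n)" and g: "bdd_L1 C M g"
    and lim: "\<And>\<phi>. integrable lborel \<phi> \<Longrightarrow> (\<lambda>n. \<integral>x. f n x * \<phi> x \<partial>lborel) \<longlonglongrightarrow> (\<integral>x. g x * \<phi> x \<partial>lborel)"
    and e: "\<And>n. 0 \<le> e n" "e \<longlonglongrightarrow> 0" and x: "x \<longlonglongrightarrow> x0"
  shows "(\<lambda>n. vel c b (e n) (f n) (x n)) \<longlonglongrightarrow> vel c b 0 g x0"
proof (rule tendsto_approx)
  fix \<eta> :: real assume \<eta>: "\<eta> > 0"
  obtain r where r: "r > 0" "vel_gap C M r \<le> \<eta> / 2" using vel_gap_small[of "\<eta>/2"] \<eta> by auto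
  have "\<forall>\<^sub>F n in sequentially. vel_gap C M (e n) < \<eta> / 2" by (rule order_tendstoD(2)[OF vel_gap_tendsto[OF e]]) (use \<eta> in simp)
  then have 1: "\<forall>\<^sub>F n in sequentially. dist (vel c b (e n) (f n) (x n)) (vel c b r (f n) (x n)) \<le> \<eta>"
  proof eventually_elim
    case (elim n)
    have "dist (vel c b (e n) (f n) (x n)) (vel c b r (f n) (x n)) \<le> vel_gap C M (e n) + vel_gap C M r"
      using vel_diff[OF f e(1), of n "x n" n] vel_diff[OF f less_imp_le[OF r(1)], of n "x n"]
        dist_triangle3[of "vel c b (e n) (f n) (x n)" "vel c b r (f n) (x n)" "vel c b 0 (f n) (x n)"] by linarith
    then show ?case using elim r(2) by linarith
  qed
  have 2: "(\<lambda>n. vel c b r (f n) x0) \<longlonglongrightarrow> vel c b r g x0"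
  proof (subst tendsto_componentwise_iff, intro ballI)
    fix i :: "real^2" assume i: "i \<in> Basis"
    let ?\<phi> = "\<lambda>y. kern c b r (x0 - y) \<bullet> i"
    have v: "vel c b r h x0 \<bullet> i = (\<integral>y. h y * ?\<phi> y \<partial>lborel)" if "bdd_L1 C M h" for h
      unfolding vel_def using integral_inner_left[OF vel_integrable[OF that less_imp_le[OF r(1)], of x0], of i] by simp
    have "(\<lambda>n. \<integral>y. f n y * ?\<phi> y \<partial>lborel) \<longlonglongrightarrow> (\<integral>y. g y * ?\<phi> y \<partial>lborel)"
    proof (rule weak_limit_C0[OF f g lim])
      show "?\<phi> \<in> borel_measurable borel" by measurable
      show "\<bar>?\<phi> y\<bar> \<le> \<bar>c\<bar> * r powr (1 - b)" for y
        using Basis_le_norm[OF i, of "kern c b r (x0 - y)"] norm_kern_le[OF r(1), of "x0 - y"] by linarith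
      have fl: "filterlim (\<lambda>y::real^2. x0 - y) at_infinity at_infinity"
      proof (subst filterlim_at_infinity[of 0], simp, intro allI impI)
        fix R :: real
        show "\<forall>\<^sub>F y in at_infinity. R \<le> norm (x0 - y)"
          unfolding eventually_at_infinity
        proof (intro exI[of _ "R + norm x0"] allI impI)
          fix y :: "real^2" assume "R + norm x0 \<le> norm y"
          then show "R \<le> norm (x0 - y)" using norm_triangle_ineq2[of y x0] by (simp add: norm_minus_commute)
        qed
      qed
      have "((\<lambda>y. kern c b r (x0 - y) \<bullet> i) \<longlongrightarrow> 0 \<bullet> i) at_infinity"
        by (rule tendsto_inner[OF filterlim_compose[OF kern_tendsto_0[OF r(1)] fl] tendsto_const])
      then show "(?\<phi> \<longlongrightarrow> 0) at_infinity" by simp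
    qed auto
    then show "(\<lambda>n. vel c b r (f n) x0 \<bullet> i) \<longlonglongrightarrow> vel c b r g x0 \<bullet> i" by (simp add: v[OF f] v[OF g])
  qed
  have 3: "(\<lambda>n. vel c b r (f n) (x n) - vel c b r (f n) x0) \<longlonglongrightarrow> 0"
  proof (rule Lim_null_comparison)
    show "\<forall>\<^sub>F n in sequentially. norm (vel c b r (f n) (x n) - vel c b r (f n) x0) \<le> M * (\<bar>c\<bar> * (1 + b) * r powr (- b) * norm (x n - x0))"
      using vel_lipschitz[OF f r(1)] by auto
    have "(\<lambda>n. M * (\<bar>c\<bar> * (1 + b) * r powr (- b) * norm (x n - x0))) \<longlonglongrightarrow> M * (\<bar>c\<bar> * (1 + b) * r powr (- b) * norm (x0 - x0))"
      by (intro tendsto_intros x)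
    then show "(\<lambda>n. M * (\<bar>c\<bar> * (1 + b) * r powr (- b) * norm (x n - x0))) \<longlonglongrightarrow> 0" by simp
  qed
  have 4: "(\<lambda>n. vel c b r (f n) (x n)) \<longlonglongrightarrow> vel c b r g x0" using tendsto_add[OF 3 2] by simp
  have 5: "dist (vel c b r g x0) (vel c b 0 g x0) \<le> \<eta>"
    using vel_diff[OF g less_imp_le[OF r(1)], of x0] r(2) \<eta> by (simp add: dist_commute)
  show "\<exists>Y m. (\<forall>\<^sub>F n in sequentially. dist (vel c b (e n) (f n) (x n)) (Y n) \<le> \<eta>) \<and> Y \<longlonglongrightarrow> m \<and> dist m (vel c b 0 g x0) \<le> \<eta>"
    using 1 4 5 by (intro exI[of _ "\<lambda>n. vel c b r (f n) (x n)"] exI[of _ "vel c b r g x0"]) auto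
qed

lemma kern_inner_integrable:
  assumes f: "bdd_L1 C M f" and e: "0 \<le> e" and D: "D \<in> borel_measurable borel" "\<And>x. norm (D x) \<le> L"
  shows "integrable lborel (\<lambda>x. f x * (kern c b e (x - z) \<bullet> D x))"
proof (rule Bochner_Integration.integrable_bound[OF integrable_mult_left[OF kern_mult(1)[OF f e, of z], of L]])
  note [measurable] = bdd_L1D(1)[OF f] D(1)
  show "(\<lambda>x. f x * (kern c b e (x - z) \<bullet> D x)) \<in> borel_measurable lborel" by measurable
  show "AE x in lborel. norm (f x * (kern c b e (x - z) \<bullet> D x)) \<le> norm (\<bar>f x\<bar> * norm (kern c b e (x - z)) * L)"
  proof (rule AE_I2)
    fix x
    have "\<bar>kern c b e (x - z) \<bullet> D x\<bar> \<le> norm (kern c b e (x - z)) * L"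
      using Cauchy_Schwarz_ineq2[of "kern c b e (x - z)" "D x"] mult_left_mono[OF D(2)[of x] norm_ge_zero[of "kern c b e (x - z)"]] by linarith
    then have "\<bar>f x\<bar> * \<bar>kern c b e (x - z) \<bullet> D x\<bar> \<le> \<bar>f x\<bar> * (norm (kern c b e (x - z)) * L)" by (intro mult_left_mono) auto
    moreover have "0 \<le> L" using D(2)[of 0] norm_ge_zero order_trans by blast
    ultimately show "norm (f x * (kern c b e (x - z) \<bullet> D x)) \<le> norm (\<bar>f x\<bar> * norm (kern c b e (x - z)) * L)"
      by (simp add: abs_mult mult.assoc)
  qed
qed

lemma kern_inner_diff:
  assumes f: "bdd_L1 C M f" and e: "0 \<le> e" and D: "D \<in> borel_measurable borel" "\<And>x. norm (D x) \<le> L"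
  shows "dist (\<integral>x. f x * (kern c b 0 (x - z) \<bullet> D x) \<partial>lborel) (\<integral>x. f x * (kern c b e (x - z) \<bullet> D x) \<partial>lborel) \<le> vel_gap C M e * L"
proof -
  have L: "0 \<le> L" using D(2)[of 0] norm_ge_zero order_trans by blast
  note i = kern_inner_integrable[OF f _ D]
  let ?d = "\<lambda>x. kern c b 0 (x - z) - kern c b e (x - z)"
  have "dist (\<integral>x. f x * (kern c b 0 (x - z) \<bullet> D x) \<partial>lborel) (\<integral>x. f x * (kern c b e (x - z) \<bullet> D x) \<partial>lborel)
     = \<bar>\<integral>x. f x * (?d x \<bullet> D x) \<partial>lborel\<bar>"
    using i[of 0 z] i[OF e, of z] by (simp add: dist_real_def inner_diff_left right_diff_distrib)
  also have "\<dots> \<le> (\<integral>x. \<bar>f x * (?d x \<bullet> D x)\<bar> \<partial>lborel)" by (rule integral_abs_bound)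
  also have "\<dots> \<le> (\<integral>x. \<bar>f x\<bar> * norm (?d x) * L \<partial>lborel)"
  proof (rule integral_mono)
    show "integrable lborel (\<lambda>x. \<bar>f x * (?d x \<bullet> D x)\<bar>)"
      using i[of 0 z] i[OF e, of z] by (intro integrable_abs) (simp add: inner_diff_left right_diff_distrib)
    show "integrable lborel (\<lambda>x. \<bar>f x\<bar> * norm (?d x) * L)" using kern_mult(3)[OF f e, of z] by (rule integrable_mult_left)
    fix x
    have "\<bar>?d x \<bullet> D x\<bar> \<le> norm (?d x) * L"
      using Cauchy_Schwarz_ineq2[of "?d x" "D x"] mult_left_mono[OF D(2)[of x] norm_ge_zero[of "?d x"]] by linarith
    then have "\<bar>f x\<bar> * \<bar>?d x \<bullet> D x\<bar> \<le> \<bar>f x\<bar> * (norm (?d x) * L)" by (intro mult_left_mono) auto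
    then show "\<bar>f x * (?d x \<bullet> D x)\<bar> \<le> \<bar>f x\<bar> * norm (?d x) * L" by (simp add: abs_mult mult.assoc)
  qed
  also have "\<dots> = (\<integral>x. \<bar>f x\<bar> * norm (?d x) \<partial>lborel) * L" by simp
  also have "\<dots> \<le> vel_gap C M e * L" using kern_mult(4)[OF f e, of z] L by (intro mult_right_mono)
  finally show ?thesis .
qed

text \<open>The singularity sits at the moving point \<open>z n\<close>. At a fixed regularisation
  \<open>r\<close> the kernel times \<open>D\<close> is an integrable test function, and moving
  \<open>z n\<close> to \<open>z0\<close> costs the Lipschitz constant times the mass; the
  comparison with level \<open>r\<close> is uniform because \<open>vel_gap\<close> does not depend
  on the centre.\<close>

lemma kern_inner_converges:
  assumes f: "\<And>n. bdd_L1 C M (f n)" and g: "bdd_L1 C M g"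
    and lim: "\<And>\<phi>. integrable lborel \<phi> \<Longrightarrow> (\<lambda>n. \<integral>x. f n x * \<phi> x \<partial>lborel) \<longlonglongrightarrow> (\<integral>x. g x * \<phi> x \<partial>lborel)"
    and e: "\<And>n. 0 \<le> e n" "e \<longlonglongrightarrow> 0" and z: "z \<longlonglongrightarrow> z0"
    and D: "D \<in> borel_measurable borel" "\<And>x. norm (D x) \<le> L" "integrable lborel D"
  shows "(\<lambda>n. \<integral>x. f n x * (kern c b (e n) (x - z n) \<bullet> D x) \<partial>lborel) \<longlonglongrightarrow> (\<integral>x. g x * (kern c b 0 (x - z0) \<bullet> D x) \<partial>lborel)"
proof (rule tendsto_approx)
  fix \<eta> :: real assume \<eta>: "\<eta> > 0"
  have L: "0 \<le> L" using D(2)[of 0] norm_ge_zero order_trans by blast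
  define I where "I e f z = (\<integral>x. f x * (kern c b e (x - z) \<bullet> D x) \<partial>lborel)" for e z and f :: "real^2 \<Rightarrow> real"
  \<comment> \<open>Two regularisation errors of size at most \<open>\<epsilon> * L\<close> must fit
    into \<eta>; the added 1 allows \<open>L = 0\<close>.\<close>
  define \<epsilon> where "\<epsilon> = \<eta> / (2 * (L + 1))"
  have \<epsilon>: "\<epsilon> > 0" "2 * \<epsilon> * L \<le> \<eta>" using \<eta> L by (auto simp: \<epsilon>_def field_simps)
  obtain r where r: "r > 0" "vel_gap C M r \<le> \<epsilon>" using vel_gap_small[OF \<epsilon>(1)] by auto
  have r0: "0 \<le> r" using r by simp
  have d: "dist (I 0 h w) (I e' h w) \<le> vel_gap C M e' * L" if "bdd_L1 C M h" "0 \<le> e'" for h w e'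
    unfolding I_def by (rule kern_inner_diff[OF that D(1,2)])
  have "\<forall>\<^sub>F n in sequentially. vel_gap C M (e n) < \<epsilon>" using order_tendstoD(2)[OF vel_gap_tendsto[OF e]] \<epsilon>(1) by simp
  then have 1: "\<forall>\<^sub>F n in sequentially. dist (I (e n) (f n) (z n)) (I r (f n) (z n)) \<le> \<eta>"
  proof eventually_elim
    case (elim n)
    have "dist (I (e n) (f n) (z n)) (I r (f n) (z n)) \<le> vel_gap C M (e n) * L + vel_gap C M r * L"
      using d[OF f e(1), of n "z n" n] d[OF f r0, of n "z n"]
        dist_triangle3[of "I (e n) (f n) (z n)" "I r (f n) (z n)" "I 0 (f n) (z n)"] by linarith
    also have "\<dots> \<le> \<epsilon> * L + \<epsilon> * L" using elim r(2) L by (intro add_mono mult_right_mono) auto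
    also have "\<dots> = 2 * \<epsilon> * L" by simp
    finally show ?case using \<epsilon>(2) by (rule order_trans)
  qed
  have ki: "integrable lborel (\<lambda>x. kern c b r (x - z0) \<bullet> D x)"
  proof (rule Bochner_Integration.integrable_bound[OF integrable_mult_right[OF integrable_norm[OF D(3)], of "\<bar>c\<bar> * r powr (1 - b)"]])
    show "(\<lambda>x. kern c b r (x - z0) \<bullet> D x) \<in> borel_measurable lborel" using D(1) by measurable
    show "AE x in lborel. norm (kern c b r (x - z0) \<bullet> D x) \<le> norm (\<bar>c\<bar> * r powr (1 - b) * norm (D x))"
    proof (rule AE_I2)
      fix x
      have "norm (kern c b r (x - z0) \<bullet> D x) \<le> norm (kern c b r (x - z0)) * norm (D x)"
        using Cauchy_Schwarz_ineq2 by simp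
      also have "\<dots> \<le> \<bar>c\<bar> * r powr (1 - b) * norm (D x)" using norm_kern_le[OF r(1)] by (intro mult_right_mono) auto
      finally show "norm (kern c b r (x - z0) \<bullet> D x) \<le> norm (\<bar>c\<bar> * r powr (1 - b) * norm (D x))" by simp
    qed
  qed
  have 2: "(\<lambda>n. I r (f n) z0) \<longlonglongrightarrow> I r g z0" unfolding I_def by (rule lim[OF ki])
  define l where "l = \<bar>c\<bar> * (1 + b) * r powr (- b)"
  have 3: "(\<lambda>n. I r (f n) (z n) - I r (f n) z0) \<longlonglongrightarrow> 0"
  proof (rule Lim_null_comparison)
    show "\<forall>\<^sub>F n in sequentially. norm (I r (f n) (z n) - I r (f n) z0) \<le> l * norm (z n - z0) * L * M"
    proof (rule always_eventually, rule allI)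
      fix n
      let ?d = "\<lambda>x. (kern c b r (x - z n) - kern c b r (x - z0)) \<bullet> D x"
      have dm: "?d \<in> borel_measurable borel" using D(1) by measurable
      have db: "\<bar>?d x\<bar> \<le> l * norm (z n - z0) * L" for x
      proof -
        have "\<bar>?d x\<bar> \<le> norm (kern c b r (x - z n) - kern c b r (x - z0)) * norm (D x)" by (rule Cauchy_Schwarz_ineq2)
        also have "\<dots> \<le> (l * norm (z n - z0)) * L"
          using kern_lipschitz[OF r(1), of "x - z n" "x - z0"] D(2)[of x] b
          by (intro mult_mono) (auto simp: l_def norm_minus_commute)
        finally show ?thesis .
      qed
      have "I r (f n) (z n) - I r (f n) z0 = (\<integral>x. ?d x * f n x \<partial>lborel)"
        unfolding I_def using kern_inner_integrable[OF f r0 D(1,2)]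
        by (subst Bochner_Integration.integral_diff[symmetric]) (auto simp: inner_diff_left algebra_simps)
      then have "norm (I r (f n) (z n) - I r (f n) z0) \<le> l * norm (z n - z0) * L * (\<integral>x. \<bar>f n x\<bar> \<partial>lborel)"
        using integral_bounded_mult_le[OF dm db bdd_L1D(3)[OF f[of n]]] by simp
      also have "\<dots> \<le> l * norm (z n - z0) * L * M"
        using bdd_L1D(4)[OF f[of n]] L b by (intro mult_left_mono) (auto simp: l_def)
      finally show "norm (I r (f n) (z n) - I r (f n) z0) \<le> l * norm (z n - z0) * L * M" .
    qed
    have "(\<lambda>n. l * norm (z n - z0) * L * M) \<longlonglongrightarrow> l * norm (z0 - z0) * L * M" by (intro tendsto_intros z)
    then show "(\<lambda>n. l * norm (z n - z0) * L * M) \<longlonglongrightarrow> 0" by simp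
  qed
  have 4: "(\<lambda>n. I r (f n) (z n)) \<longlonglongrightarrow> I r g z0" using tendsto_add[OF 3 2] by simp
  have "vel_gap C M r * L \<le> \<epsilon> * L" using r(2) L by (intro mult_right_mono)
  moreover have "0 \<le> \<epsilon> * L" using \<epsilon> L by simp
  ultimately have 5: "dist (I r g z0) (I 0 g z0) \<le> \<eta>"
    using d[OF g r0, of z0] \<epsilon>(2) unfolding dist_commute[of "I r g z0"] by linarith
  show "\<exists>Y m. (\<forall>\<^sub>F n in sequentially. dist (\<integral>x. f n x * (kern c b (e n) (x - z n) \<bullet> D x) \<partial>lborel) (Y n) \<le> \<eta>) \<and> Y \<longlonglongrightarrow> m \<and> dist m (\<integral>x. g x * (kern c b 0 (x - z0) \<bullet> D x) \<partial>lborel) \<le> \<eta>"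
    unfolding I_def[symmetric] using 1 4 5 by (intro exI[of _ "\<lambda>n. I r (f n) (z n)"] exI[of _ "I r g z0"]) auto
qed

text \<open>\<open>Psi\<close> is a superposition of translates of \<open>pot\<close> with total
  weight at most \<open>M + 1\<close>: the mass of the vorticity and the unit strength of the
  vortex.\<close>

lemma C11_Psi:
  assumes f: "bdd_L1 C M f" and e: "0 < e"
  shows "C11 (Lpot e * (M + 1)) (Psi c b e f z) (gradPsi c b e f z)"
  unfolding C11_def
proof (intro conjI allI)
  fix x y
  note P = C11D[OF C11_pot[OF e]]
  have fi: "integrable lborel (\<lambda>y. \<bar>f y\<bar>)" using bdd_L1D(3)[OF f] by simp
  note [measurable] = bdd_L1D(1)[OF f]
  have gm[measurable]: "gradpot c b e \<in> borel_measurable borel" unfolding gradpot_def by measurable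
  have pi: "integrable lborel (\<lambda>w. f w * pot c b e (x - w))" for x
    using integrable_bounded_mult[of "\<lambda>w. pot c b e (x - w)", OF _ pot_bound[OF e] bdd_L1D(3)[OF f]] by (simp add: mult.commute)
  have gi: "integrable lborel (\<lambda>w. f w *\<^sub>R gradpot c b e (x - w))" for x
    by (rule Bochner_Integration.integrable_bound[OF integrable_mult_left[OF fi, of "Lpot e"]])
      (use P(1) P(3) in \<open>auto intro!: AE_I2 mult_left_mono simp: abs_mult\<close>)
  have LM: "(\<integral>w. \<bar>f w\<bar> \<partial>lborel) * Lpot e \<le> M * Lpot e" using bdd_L1D(4)[OF f] P(3) by (intro mult_right_mono)
  have "norm (\<integral>w. f w *\<^sub>R gradpot c b e (x - w) \<partial>lborel) \<le> (\<integral>w. norm (f w *\<^sub>R gradpot c b e (x - w)) \<partial>lborel)"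
    by (rule integral_norm_bound)
  also have "\<dots> \<le> (\<integral>w. \<bar>f w\<bar> * Lpot e \<partial>lborel)"
    by (rule integral_mono[OF integrable_norm[OF gi[of x]] integrable_mult_left[OF fi]]) (use P(1) in \<open>auto intro!: mult_left_mono\<close>)
  also have "\<dots> \<le> M * Lpot e" using LM by simp
  finally show "norm (gradPsi c b e f z x) \<le> Lpot e * (M + 1)"
    unfolding gradPsi_def using P(1)[of "x - z"] norm_triangle_ineq[of "\<integral>w. f w *\<^sub>R gradpot c b e (x - w) \<partial>lborel" "gradpot c b e (x - z)"]
    by (simp add: algebra_simps)
  let ?v = "(norm (y - x))\<^sup>2"
  define T where "T w = pot c b e (y - w) - pot c b e (x - w) - gradpot c b e (x - w) \<bullet> (y - x)" for w
  have T: "\<bar>T w\<bar> \<le> Lpot e * ?v" for w using P(2)[of "y - w" "x - w"] by (simp add: T_def)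
  have Tm: "T \<in> borel_measurable borel" unfolding T_def by measurable
  define G where "G w = gradpot c b e (x - w) \<bullet> (y - x)" for w
  have TG: "T w = pot c b e (y - w) - pot c b e (x - w) - G w" for w by (simp add: T_def G_def)
  have e1: "(\<integral>w. f w *\<^sub>R gradpot c b e (x - w) \<partial>lborel) \<bullet> (y - x) = (\<integral>w. f w * G w \<partial>lborel)"
    using integral_inner_left[OF gi[of x], of "y - x"] by (simp add: G_def)
  have gi': "integrable lborel (\<lambda>w. f w * G w)"
    using integrable_inner_left[OF gi[of x], of "y - x"] by (simp add: G_def)
  have "(\<integral>w. T w * f w \<partial>lborel) = (\<integral>w. f w * pot c b e (y - w) - f w * pot c b e (x - w) - f w * G w \<partial>lborel)"
    by (rule Bochner_Integration.integral_cong) (auto simp: TG algebra_simps)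
  also have "\<dots> = (\<integral>w. f w * pot c b e (y - w) \<partial>lborel) - (\<integral>w. f w * pot c b e (x - w) \<partial>lborel) - (\<integral>w. f w * G w \<partial>lborel)"
    using pi[of x] pi[of y] gi' by simp
  finally have "Psi c b e f z y - Psi c b e f z x - gradPsi c b e f z x \<bullet> (y - x) = (\<integral>w. T w * f w \<partial>lborel) + T z"
    unfolding Psi_def gradPsi_def inner_add_left e1 T_def[of z] by simp
  then have "\<bar>Psi c b e f z y - Psi c b e f z x - gradPsi c b e f z x \<bullet> (y - x)\<bar> \<le> Lpot e * ?v * (\<integral>w. \<bar>f w\<bar> \<partial>lborel) + Lpot e * ?v"
    using integral_bounded_mult_le[OF Tm T bdd_L1D(3)[OF f]] T[of z] by linarith
  also have "\<dots> \<le> Lpot e * ?v * M + Lpot e * ?v"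
    using bdd_L1D(4)[OF f] P(3) by (intro add_right_mono mult_left_mono) auto
  finally show "\<bar>Psi c b e f z y - Psi c b e f z x - gradPsi c b e f z x \<bullet> (y - x)\<bar> \<le> Lpot e * (M + 1) * ?v"
    by (simp add: algebra_simps)
qed

lemma perp_gradPsi:
  assumes f: "bdd_L1 C M f" and e: "0 < e"
  shows "perp (gradPsi c b e f z x) = vel c b e f x + kern c b e (x - z)"
proof -
  have fi: "integrable lborel (\<lambda>y. \<bar>f y\<bar>)" using bdd_L1D(3)[OF f] by simp
  note P = C11D[OF C11_pot[OF e]]
  note [measurable] = bdd_L1D(1)[OF f]
  have gm[measurable]: "gradpot c b e \<in> borel_measurable borel" unfolding gradpot_def by measurable
  have gi: "integrable lborel (\<lambda>w. f w *\<^sub>R gradpot c b e (x - w))"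
    by (rule Bochner_Integration.integrable_bound[OF integrable_mult_left[OF fi, of "Lpot e"]])
      (use P(1) P(3) in \<open>auto intro!: AE_I2 mult_left_mono simp: abs_mult\<close>)
  have "perp (\<integral>w. f w *\<^sub>R gradpot c b e (x - w) \<partial>lborel) = (\<integral>w. perp (f w *\<^sub>R gradpot c b e (x - w)) \<partial>lborel)"
    using integral_bounded_linear[OF linear_perp[unfolded linear_conv_bounded_linear] gi] by simp
  then show ?thesis by (simp add: gradPsi_def vel_def perp_simps perp_gradpot)
qed

end

section \<open>The Lax--Friedrichs step\<close>

text \<open>The corners of a square of radius \<open>\<delta>\<close> are cyclically permuted by a quarter turn, and
  \<open>corner \<delta> (j + 2) = - corner \<delta> j\<close>.  Hence the differences of \<open>\<Psi>\<close> in the weights telescope when summed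
  over \<open>j\<close>, both at \<open>x\<close> and along \<open>x - jump \<delta> j\<close>.\<close>

definition corner :: "real \<Rightarrow> nat \<Rightarrow> real^2" where
  "corner \<delta> j = (perp ^^ j) (axis 1 \<delta>)"

definition jump :: "real \<Rightarrow> nat \<Rightarrow> real^2" where
  "jump \<delta> j = corner \<delta> j - corner \<delta> (Suc j)"

text \<open>The points \<open>x - corner \<delta> (Suc j)\<close> and
  \<open>x + corner \<delta> j\<close> are the ends of one edge of the square around
  \<open>x\<close>, and \<open>x + jump \<delta> j\<close> is the centre of the neighbouring square
  across that edge. The difference of \<Psi> is, up to sign, the flux of its rotated gradient
  through the edge.\<close>

definition lf_weight :: "real \<Rightarrow> real \<Rightarrow> (real^2 \<Rightarrow> real) \<Rightarrow> nat \<Rightarrow> real^2 \<Rightarrow> real" where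
  "lf_weight \<beta> \<delta> \<Psi> j x = 1 / 4 - \<beta> * (\<Psi> (x - corner \<delta> (Suc j)) - \<Psi> (x + corner \<delta> j))"

definition lf_step :: "real \<Rightarrow> real \<Rightarrow> (real^2 \<Rightarrow> real) \<Rightarrow> (real^2 \<Rightarrow> real) \<Rightarrow> real^2 \<Rightarrow> real" where
  "lf_step \<beta> \<delta> \<Psi> f x = (\<Sum>j<4. lf_weight \<beta> \<delta> \<Psi> j x * f (x + jump \<delta> j))"

lemma norm_corner: "norm (corner \<delta> j) = \<bar>\<delta>\<bar>"
proof (induction j)
  case 0
  have "norm (axis 1 \<delta> :: real^2) = \<bar>\<delta>\<bar>"
    unfolding norm_eq_sqrt_inner by (simp add: inner_vec_def sum_2 axis_def)
  then show ?case by (simp add: corner_def)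
qed (simp add: corner_def)

lemma norm_jump: "norm (jump \<delta> j) \<le> 2 * \<bar>\<delta>\<bar>"
  using norm_triangle_ineq4[of "corner \<delta> j" "corner \<delta> (Suc j)"] by (simp add: jump_def norm_corner)

lemma corner_simps:
  "corner \<delta> 2 = - corner \<delta> 0" "corner \<delta> 3 = - corner \<delta> 1" "corner \<delta> 4 = corner \<delta> 0"
  by (simp_all add: corner_def eval_nat_numeral perp_simps)

lemma sum_lessThan_4: "(\<Sum>j<(4::nat). g j) = g 0 + g 1 + g 2 + g 3" for g :: "nat \<Rightarrow> 'a::comm_monoid_add"
  by (simp add: eval_nat_numeral)

lemma sum_lf_weight: "(\<Sum>j<4. lf_weight \<beta> \<delta> \<Psi> j x) = 1"
  using corner_simps[of \<delta>] unfolding sum_lessThan_4 lf_weight_def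
  by (simp add: algebra_simps flip: One_nat_def numeral_2_eq_2 numeral_3_eq_3)

lemma lf_weight_shift:
  "lf_weight \<beta> \<delta> \<Psi> j (x - jump \<delta> j) = 1 / 4 - \<beta> * (\<Psi> (x - corner \<delta> j) - \<Psi> (x + corner \<delta> (Suc j)))"
  by (simp add: lf_weight_def jump_def algebra_simps)

lemma sum_lf_weight_shift: "(\<Sum>j<4. lf_weight \<beta> \<delta> \<Psi> j (x - jump \<delta> j)) = 1"
  using corner_simps[of \<delta>] unfolding sum_lessThan_4 lf_weight_shift
  by (simp add: algebra_simps flip: One_nat_def numeral_2_eq_2 numeral_3_eq_3)

lemma lf_weight_nonneg:
  assumes \<Psi>: "C11 L \<Psi> D" and "0 \<le> \<beta>" "0 \<le> \<delta>" "\<beta> * (2 * L * \<delta>) \<le> 1 / 4"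
  shows "0 \<le> lf_weight \<beta> \<delta> \<Psi> j x"
proof -
  have "\<bar>\<Psi> (x - corner \<delta> (Suc j)) - \<Psi> (x + corner \<delta> j)\<bar> \<le> L * norm ((x - corner \<delta> (Suc j)) - (x + corner \<delta> j))"
    by (rule C11_lipschitz[OF \<Psi>])
  also have "\<dots> \<le> L * (2 * \<delta>)"
  proof (rule mult_left_mono[OF _ C11D(3)[OF \<Psi>]])
    have "(x - corner \<delta> (Suc j)) - (x + corner \<delta> j) = - corner \<delta> (Suc j) - corner \<delta> j" by simp
    then show "norm ((x - corner \<delta> (Suc j)) - (x + corner \<delta> j)) \<le> 2 * \<delta>"
      using norm_triangle_ineq4[of "- corner \<delta> (Suc j)" "corner \<delta> j"] assms(3) by (simp add: norm_corner)
  qed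
  finally have "\<beta> * \<bar>\<Psi> (x - corner \<delta> (Suc j)) - \<Psi> (x + corner \<delta> j)\<bar> \<le> \<beta> * (L * (2 * \<delta>))"
    using assms(2) by (rule mult_left_mono)
  then have "\<beta> * \<bar>\<Psi> (x - corner \<delta> (Suc j)) - \<Psi> (x + corner \<delta> j)\<bar> \<le> 1 / 4"
    using assms(4) by (simp add: mult_ac)
  moreover have "\<beta> * (\<Psi> (x - corner \<delta> (Suc j)) - \<Psi> (x + corner \<delta> j)) \<le> \<beta> * \<bar>\<Psi> (x - corner \<delta> (Suc j)) - \<Psi> (x + corner \<delta> j)\<bar>"
    using assms(2) by (intro mult_left_mono) auto
  ultimately show ?thesis by (simp add: lf_weight_def)
qed

text \<open>Jensen's inequality: average the tangent inequality taken at the weighted mean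
  \<open>Y\<close> of the absolute values.\<close>

lemma powr_convex_sum:
  fixes w y :: "nat \<Rightarrow> real"
  assumes p: "1 \<le> p" and w: "\<And>j. j < n \<Longrightarrow> 0 \<le> w j" "(\<Sum>j<n. w j) = 1"
  shows "\<bar>\<Sum>j<n. w j * y j\<bar> powr p \<le> (\<Sum>j<n. w j * \<bar>y j\<bar> powr p)"
proof -
  define Y where "Y = (\<Sum>j<n. w j * \<bar>y j\<bar>)"
  have Y0: "0 \<le> Y" unfolding Y_def using w by (intro sum_nonneg) auto
  have "\<bar>\<Sum>j<n. w j * y j\<bar> \<le> Y"
    unfolding Y_def by (rule order_trans[OF sum_abs]) (use w in \<open>auto simp: abs_mult intro!: sum_mono\<close>)
  then have 1: "\<bar>\<Sum>j<n. w j * y j\<bar> powr p \<le> Y powr p" using p by (intro powr_mono2) auto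
  have "(\<Sum>j<n. w j * (p * (\<bar>y j\<bar> * Y powr (p - 1)))) \<le> (\<Sum>j<n. w j * (\<bar>y j\<bar> powr p + (p - 1) * Y powr p))"
    using powr_tangent_le[OF p _ Y0] w by (intro sum_mono mult_left_mono) auto
  moreover have "(\<Sum>j<n. w j * (p * (\<bar>y j\<bar> * Y powr (p - 1)))) = p * (Y * Y powr (p - 1))"
    unfolding Y_def by (simp add: sum_distrib_left sum_distrib_right mult_ac)
  moreover have "(\<Sum>j<n. w j * (\<bar>y j\<bar> powr p + (p - 1) * Y powr p)) = (\<Sum>j<n. w j * \<bar>y j\<bar> powr p) + (\<Sum>j<n. w j) * ((p - 1) * Y powr p)"
    by (simp add: distrib_left sum.distrib sum_distrib_right)
  moreover have "Y * Y powr (p - 1) = Y powr p" using powr_mult_base[OF Y0, of "p - 1"] by simp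
  ultimately have "Y powr p \<le> (\<Sum>j<n. w j * \<bar>y j\<bar> powr p)" using w(2) by (simp add: algebra_simps)
  with 1 show ?thesis by simp
qed

lemma lf_step_borel:
  assumes [measurable]: "f \<in> borel_measurable borel" "\<Psi> \<in> borel_measurable borel"
  shows "lf_weight \<beta> \<delta> \<Psi> j \<in> borel_measurable borel" "lf_step \<beta> \<delta> \<Psi> f \<in> borel_measurable borel"
  unfolding lf_step_def lf_weight_def by measurable

section \<open>Stability and consistency of one step\<close>

text \<open>\<open>cfl\<close> is the Courant condition: a weight differs from 1/4 by at most
  \<beta> times the variation of \<Psi> along an edge, whose length is at most 2 \<delta>.\<close>

locale lax_step =
  fixes \<beta> \<delta> :: real and \<Psi> :: "real^2 \<Rightarrow> real" and L :: real and D :: "real^2 \<Rightarrow> real^2"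
  assumes \<Psi>: "C11 L \<Psi> D" and \<beta>: "0 \<le> \<beta>" and \<delta>: "0 \<le> \<delta>" and cfl: "\<beta> * (2 * L * \<delta>) \<le> 1 / 4"
begin

abbreviation "w \<equiv> lf_weight \<beta> \<delta> \<Psi>"
abbreviation "q \<equiv> jump \<delta>"
abbreviation "step \<equiv> lf_step \<beta> \<delta> \<Psi>"

lemma w_nonneg: "0 \<le> w j x" by (rule lf_weight_nonneg[OF \<Psi> \<beta> \<delta> cfl])

lemma w_le_1: "j < 4 \<Longrightarrow> w j x \<le> 1"
  using member_le_sum[of j "{..<4}" "\<lambda>j. w j x"] w_nonneg sum_lf_weight[of \<beta> \<delta> \<Psi> x] by simp

lemma w_borel [measurable]: "w j \<in> borel_measurable borel"
  using lf_step_borel(1)[of "\<lambda>_. 0"] C11_borel[OF \<Psi>] by simp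

text \<open>Jensen uses that the weights at \<open>x\<close> sum to 1. After integration, a
  translation by \<open>- q j\<close> moves each weight to \<open>x - q j\<close>, and there the sum
  is 1 again: the first identity gives convexity, the second conservation of mass.\<close>

lemma step_powr_le:
  assumes [measurable]: "f \<in> borel_measurable borel" and p: "1 \<le> p"
  shows "(\<integral>\<^sup>+x. ennreal (\<bar>step f x\<bar> powr p) \<partial>lborel) \<le> (\<integral>\<^sup>+x. ennreal (\<bar>f x\<bar> powr p) \<partial>lborel)"
proof -
  have [measurable]: "(\<lambda>x. \<bar>f x\<bar> powr p) \<in> borel_measurable borel" by measurable
  let ?g = "\<lambda>j x. ennreal (w j (x - q j) * \<bar>f x\<bar> powr p)"
  have g: "?g j \<in> borel_measurable borel" for j by measurable
  have "(\<integral>\<^sup>+x. ennreal (\<bar>step f x\<bar> powr p) \<partial>lborel) \<le> (\<integral>\<^sup>+x. (\<Sum>j<4. ?g j (x + q j)) \<partial>lborel)"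
  proof (rule nn_integral_mono)
    fix x
    have "\<bar>step f x\<bar> powr p \<le> (\<Sum>j<4. w j x * \<bar>f (x + q j)\<bar> powr p)"
      unfolding lf_step_def by (rule powr_convex_sum[OF p w_nonneg sum_lf_weight])
    then have "ennreal (\<bar>step f x\<bar> powr p) \<le> ennreal (\<Sum>j<4. w j x * \<bar>f (x + q j)\<bar> powr p)" by (rule ennreal_leI)
    also have "\<dots> = (\<Sum>j<4. ?g j (x + q j))" using w_nonneg by (subst sum_ennreal[symmetric]) auto
    finally show "ennreal (\<bar>step f x\<bar> powr p) \<le> (\<Sum>j<4. ?g j (x + q j))" .
  qed
  also have "\<dots> = (\<Sum>j<4. \<integral>\<^sup>+x. ?g j (x + q j) \<partial>lborel)"
    by (rule nn_integral_sum) measurable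
  also have "\<dots> = (\<Sum>j<4. \<integral>\<^sup>+x. ?g j x \<partial>lborel)"
    by (rule sum.cong[OF refl]) (rule nn_integral_lborel_shift[OF g])
  also have "\<dots> = (\<integral>\<^sup>+x. (\<Sum>j<4. ?g j x) \<partial>lborel)"
    by (rule nn_integral_sum[symmetric]) measurable
  also have "\<dots> = (\<integral>\<^sup>+x. ennreal (\<bar>f x\<bar> powr p) \<partial>lborel)"
  proof (rule nn_integral_cong)
    fix x
    have "(\<Sum>j<4. ?g j x) = ennreal (\<Sum>j<4. w j (x - q j) * \<bar>f x\<bar> powr p)" using w_nonneg by (subst sum_ennreal) auto
    also have "(\<Sum>j<4. w j (x - q j) * \<bar>f x\<bar> powr p) = \<bar>f x\<bar> powr p"
      using sum_lf_weight_shift[of \<beta> \<delta> \<Psi> x] by (simp flip: sum_distrib_right)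
    finally show "(\<Sum>j<4. ?g j x) = ennreal (\<bar>f x\<bar> powr p)" .
  qed
  finally show ?thesis .
qed

lemma step_bdd_L1:
  assumes f: "bdd_L1 C M f" shows "bdd_L1 C M (step f)"
proof -
  note [measurable] = bdd_L1D(1)[OF f]
  have m[measurable]: "step f \<in> borel_measurable borel" by (rule lf_step_borel(2)[OF bdd_L1D(1)[OF f] C11_borel[OF \<Psi>]])
  have bd: "\<bar>step f x\<bar> \<le> C" for x
  proof -
    have "\<bar>step f x\<bar> \<le> (\<Sum>j<4. \<bar>w j x * f (x + q j)\<bar>)" unfolding lf_step_def by (rule sum_abs)
    also have "\<dots> \<le> (\<Sum>j<4. w j x * C)"
      using w_nonneg bdd_L1D(2)[OF f] by (intro sum_mono) (auto simp: abs_mult intro!: mult_left_mono)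
    also have "\<dots> = C" using sum_lf_weight[of \<beta> \<delta> \<Psi> x] by (simp flip: sum_distrib_right)
    finally show ?thesis .
  qed
  have i: "integrable lborel (step f)"
    unfolding lf_step_def
  proof (rule Bochner_Integration.integrable_sum)
    fix j :: nat assume "j \<in> {..<4}"
    then have "\<bar>w j x\<bar> \<le> 1" for x using w_nonneg[of j x] w_le_1[of j x] by simp
    then show "integrable lborel (\<lambda>x. w j x * f (x + q j))"
      by (rule integrable_bounded_mult[OF w_borel _ integrable_lborel_shift[OF bdd_L1D(3)[OF f]]])
  qed
  have "ennreal (\<integral>x. \<bar>step f x\<bar> \<partial>lborel) \<le> ennreal (\<integral>x. \<bar>f x\<bar> \<partial>lborel)"
    using step_powr_le[OF bdd_L1D(1)[OF f], of 1] i bdd_L1D(3)[OF f]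
    by (simp add: nn_integral_eq_integral)
  then have "(\<integral>x. \<bar>step f x\<bar> \<partial>lborel) \<le> (\<integral>x. \<bar>f x\<bar> \<partial>lborel)" by simp
  then show ?thesis unfolding bdd_L1_def using m bd i bdd_L1D(4)[OF f] by auto
qed

text \<open>Summation by parts: the translations move to the test function, so that consistency
  needs no regularity of the vorticity.\<close>

lemma step_adjoint:
  assumes f: "bdd_L1 C M f" and \<phi>: "\<phi> \<in> borel_measurable borel" "\<And>x. \<bar>\<phi> x\<bar> \<le> B"
  shows "(\<integral>x. step f x * \<phi> x \<partial>lborel) = (\<integral>x. (\<Sum>j<4. w j (x - q j) * \<phi> (x - q j)) * f x \<partial>lborel)"
proof -
  note [measurable] = bdd_L1D(1)[OF f] \<phi>(1)
  let ?g = "\<lambda>j x. (w j (x - q j) * \<phi> (x - q j)) * f x"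
  have gm: "?g j \<in> borel_measurable borel" for j by measurable
  have gi: "integrable lborel (?g j)" if "j < 4" for j
  proof (rule integrable_bounded_mult[OF _ _ bdd_L1D(3)[OF f]])
    show "(\<lambda>x. w j (x - q j) * \<phi> (x - q j)) \<in> borel_measurable borel" by measurable
    have "B \<ge> 0" using \<phi>(2)[of 0] by linarith
    then show "\<bar>w j (x - q j) * \<phi> (x - q j)\<bar> \<le> 1 * B" for x
      unfolding abs_mult using w_nonneg[of j "x - q j"] w_le_1[OF that, of "x - q j"] \<phi>(2) by (intro mult_mono) auto
  qed
  have "(\<integral>x. step f x * \<phi> x \<partial>lborel) = (\<integral>x. (\<Sum>j<4. ?g j (x + q j)) \<partial>lborel)"
    unfolding lf_step_def sum_distrib_right by (intro Bochner_Integration.integral_cong sum.cong) (auto simp: mult_ac)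
  also have "\<dots> = (\<Sum>j<4. \<integral>x. ?g j (x + q j) \<partial>lborel)"
    by (rule Bochner_Integration.integral_sum) (rule integrable_lborel_shift[OF gi], simp)
  also have "\<dots> = (\<Sum>j<4. \<integral>x. ?g j x \<partial>lborel)"
    by (rule sum.cong[OF refl]) (rule integral_lborel_shift[OF gm])
  also have "\<dots> = (\<integral>x. (\<Sum>j<4. ?g j x) \<partial>lborel)"
    by (rule Bochner_Integration.integral_sum[symmetric]) (use gi in simp)
  finally show ?thesis by (simp add: sum_distrib_right)
qed

text \<open>The first order Taylor term of \<phi> meets centred differences of \<Psi> along two
  orthogonal vectors of length \<delta>. Replacing them by derivatives leaves a two by two
  determinant, which is \<delta>^2 times \<open>perp (D x) \<bullet> E x\<close>. The first error is
  the numerical diffusion, from jumps of length at most 2 \<delta>; the second comes from the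
  remainders of \<Psi>.\<close>

lemma step_pointwise:
  assumes \<phi>: "C11 K \<phi> E"
  shows "\<bar>(\<Sum>j<4. w j (x - q j) * \<phi> (x - q j)) - \<phi> x - 4 * \<beta> * \<delta>\<^sup>2 * (perp (D x) \<bullet> E x)\<bar>
    \<le> 4 * K * \<delta>\<^sup>2 + 8 * \<beta> * \<delta>^3 * L * K"
proof -
  define W where "W j = w j (x - q j)" for j
  have W0: "0 \<le> W j" for j by (simp add: W_def w_nonneg)
  have W1: "(\<Sum>j<4. W j) = 1" unfolding W_def by (rule sum_lf_weight_shift)
  have K0: "0 \<le> K" and L0: "0 \<le> L" using C11D(3) \<phi> \<Psi> by auto
  define R where "R j = \<phi> (x - q j) - \<phi> x + E x \<bullet> q j" for j
  have R: "\<bar>R j\<bar> \<le> 4 * K * \<delta>\<^sup>2" for j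
  proof -
    have "\<bar>R j\<bar> \<le> K * (norm (q j))\<^sup>2" using C11D(2)[OF \<phi>, of "x - q j" x] by (simp add: R_def)
    also have "\<dots> \<le> K * (2 * \<delta>)\<^sup>2" using norm_jump[of \<delta> j] \<delta> K0 by (intro mult_left_mono power_mono) auto
    finally show ?thesis by (simp add: power_mult_distrib mult_ac)
  qed
  have sumR: "\<bar>\<Sum>j<4. W j * R j\<bar> \<le> 4 * K * \<delta>\<^sup>2"
  proof -
    have "\<bar>\<Sum>j<4. W j * R j\<bar> \<le> (\<Sum>j<4. W j * (4 * K * \<delta>\<^sup>2))"
      by (rule order_trans[OF sum_abs]) (use W0 R in \<open>auto simp: abs_mult intro!: sum_mono mult_left_mono\<close>)
    also have "\<dots> = 4 * K * \<delta>\<^sup>2" using W1 by (simp flip: sum_distrib_right)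
    finally show ?thesis .
  qed
  define a b where "a = corner \<delta> 0" and "b = corner \<delta> 1"
  have c: "corner \<delta> 0 = a" "corner \<delta> (Suc 0) = b" "corner \<delta> (Suc (Suc 0)) = - a" "corner \<delta> (Suc (Suc (Suc 0))) = - b"
      "corner \<delta> (Suc (Suc (Suc (Suc 0)))) = a"
    using corner_simps[of \<delta>] by (simp_all add: a_def b_def eval_nat_numeral)
  define Da where "Da = \<Psi> (x + a) - \<Psi> (x - a) - 2 * (D x \<bullet> a)"
  define Db where "Db = \<Psi> (x + b) - \<Psi> (x - b) - 2 * (D x \<bullet> b)"
  have nab: "norm a = \<delta>" "norm b = \<delta>" using norm_corner \<delta> by (auto simp: a_def b_def)
  have Dbound: "\<bar>\<Psi> (x + v) - \<Psi> (x - v) - 2 * (D x \<bullet> v)\<bar> \<le> 2 * L * \<delta>\<^sup>2" if "norm v = \<delta>" for v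
    using C11D(2)[OF \<Psi>, of "x + v" x] C11D(2)[OF \<Psi>, of "x - v" x] that by (simp add: abs_le_iff)
  have Ebound: "\<bar>E x \<bullet> v\<bar> \<le> K * \<delta>" if "norm v = \<delta>" for v
    using Cauchy_Schwarz_ineq2[of "E x" v] mult_right_mono[OF C11D(1)[OF \<phi>, of x] \<delta>] that by simp
  \<comment> \<open>The constant parts 1/4 of the weights cancel since the jumps come in opposite
    pairs; only the stream function survives.\<close>
  have e1: "(\<Sum>j<4. W j * (E x \<bullet> q j)) = - 2 * \<beta> * ((\<Psi> (x - b) - \<Psi> (x + b)) * (E x \<bullet> a) + (\<Psi> (x + a) - \<Psi> (x - a)) * (E x \<bullet> b))"
    unfolding W_def lf_weight_shift unfolding jump_def
    by (simp add: eval_nat_numeral c inner_diff_right inner_add_right algebra_simps)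
  have e2: "(\<Sum>j<4. W j * \<phi> (x - q j)) - \<phi> x = (\<Sum>j<4. W j * R j) - (\<Sum>j<4. W j * (E x \<bullet> q j))"
  proof -
    have "(\<Sum>j<4. W j * R j) = (\<Sum>j<4. W j * \<phi> (x - q j)) - (\<Sum>j<4. W j) * \<phi> x + (\<Sum>j<4. W j * (E x \<bullet> q j))"
      unfolding R_def by (simp add: algebra_simps sum.distrib sum_subtractf sum_distrib_left)
    then show ?thesis using W1 by simp
  qed
  have e3: "\<delta>\<^sup>2 * (perp (D x) \<bullet> E x) = (D x \<bullet> a) * (E x \<bullet> b) - (D x \<bullet> b) * (E x \<bullet> a)"
    by (simp add: a_def b_def corner_def perp_def inner_vec_def sum_2 axis_def power2_eq_square algebra_simps)
  have eq: "(\<Sum>j<4. W j * \<phi> (x - q j)) - \<phi> x - 4 * \<beta> * (\<delta>\<^sup>2 * (perp (D x) \<bullet> E x))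
     = (\<Sum>j<4. W j * R j) + 2 * \<beta> * (Da * (E x \<bullet> b) - Db * (E x \<bullet> a))"
    unfolding e2 unfolding e1 e3 Da_def Db_def by (simp add: algebra_simps)
  have "\<bar>Da * (E x \<bullet> b)\<bar> \<le> 2 * L * \<delta>\<^sup>2 * (K * \<delta>)" unfolding abs_mult Da_def
    using Dbound[OF nab(1)] Ebound[OF nab(2)] L0 by (intro mult_mono) auto
  moreover have "\<bar>Db * (E x \<bullet> a)\<bar> \<le> 2 * L * \<delta>\<^sup>2 * (K * \<delta>)" unfolding abs_mult Db_def
    using Dbound[OF nab(2)] Ebound[OF nab(1)] L0 by (intro mult_mono) auto
  ultimately have Z: "\<bar>Da * (E x \<bullet> b) - Db * (E x \<bullet> a)\<bar> \<le> 4 * L * \<delta>\<^sup>2 * (K * \<delta>)" (is "\<bar>?Z\<bar> \<le> _") by linarith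
  have "\<bar>2 * \<beta> * ?Z\<bar> = 2 * \<beta> * \<bar>?Z\<bar>" unfolding abs_mult using \<beta> by simp
  also have "\<dots> \<le> 2 * \<beta> * (4 * L * \<delta>\<^sup>2 * (K * \<delta>))" using \<beta> Z by (intro mult_left_mono) auto
  also have "\<dots> = 8 * \<beta> * \<delta>^3 * L * K" by (simp add: power2_eq_square power3_eq_cube mult_ac)
  finally have "\<bar>2 * \<beta> * ?Z\<bar> \<le> 8 * \<beta> * \<delta>^3 * L * K" .
  then show ?thesis using sumR eq unfolding W_def[symmetric] by (simp add: mult.assoc)
qed

lemma step_consistent:
  assumes f: "bdd_L1 C M f" and \<phi>: "C11 K \<phi> E" "\<And>x. \<bar>\<phi> x\<bar> \<le> B" and m: "E \<in> borel_measurable borel" "D \<in> borel_measurable borel"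
    and i: "integrable lborel (\<lambda>x. f x * (perp (D x) \<bullet> E x))"
  shows "\<bar>(\<integral>x. step f x * \<phi> x \<partial>lborel) - (\<integral>x. f x * \<phi> x \<partial>lborel) - 4 * \<beta> * \<delta>\<^sup>2 * (\<integral>x. f x * (perp (D x) \<bullet> E x) \<partial>lborel)\<bar>
    \<le> (4 * K * \<delta>\<^sup>2 + 8 * \<beta> * \<delta>^3 * L * K) * M"
proof -
  note [measurable] = bdd_L1D(1)[OF f] m C11_borel[OF \<phi>(1)]
  let ?S = "\<lambda>x. (\<Sum>j<4. w j (x - q j) * \<phi> (x - q j))"
  let ?T = "\<lambda>x. ?S x - \<phi> x - 4 * \<beta> * \<delta>\<^sup>2 * (perp (D x) \<bullet> E x)"
  have Sm: "?S \<in> borel_measurable borel" by measurable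
  have Tm: "?T \<in> borel_measurable borel" by measurable
  have B0: "0 \<le> B" using \<phi>(2)[of 0] by linarith
  have Sb: "\<bar>?S x\<bar> \<le> B" for x
  proof -
    have "\<bar>?S x\<bar> \<le> (\<Sum>j<4. w j (x - q j) * B)"
      by (rule order_trans[OF sum_abs]) (use w_nonneg \<phi>(2) in \<open>auto simp: abs_mult intro!: sum_mono mult_left_mono\<close>)
    also have "\<dots> = B" using sum_lf_weight_shift[of \<beta> \<delta> \<Psi> x] by (simp flip: sum_distrib_right)
    finally show ?thesis .
  qed
  have si: "integrable lborel (\<lambda>x. ?S x * f x)" by (rule integrable_bounded_mult[OF Sm Sb bdd_L1D(3)[OF f]])
  have pi: "integrable lborel (\<lambda>x. \<phi> x * f x)" by (rule integrable_bounded_mult[OF C11_borel[OF \<phi>(1)] \<phi>(2) bdd_L1D(3)[OF f]])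
  have ii: "integrable lborel (\<lambda>x. 4 * \<beta> * \<delta>\<^sup>2 * (f x * (perp (D x) \<bullet> E x)))" by (rule integrable_mult_right[OF i])
  have "(\<integral>x. ?T x * f x \<partial>lborel) = (\<integral>x. ?S x * f x - \<phi> x * f x - 4 * \<beta> * \<delta>\<^sup>2 * (f x * (perp (D x) \<bullet> E x)) \<partial>lborel)"
    by (rule Bochner_Integration.integral_cong) (simp_all add: algebra_simps)
  also have "\<dots> = (\<integral>x. ?S x * f x \<partial>lborel) - (\<integral>x. \<phi> x * f x \<partial>lborel) - (\<integral>x. 4 * \<beta> * \<delta>\<^sup>2 * (f x * (perp (D x) \<bullet> E x)) \<partial>lborel)"
    using si pi ii by (subst Bochner_Integration.integral_diff[OF Bochner_Integration.integrable_diff[OF si pi] ii], subst Bochner_Integration.integral_diff[OF si pi]) (rule refl)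
  also have "\<dots> = (\<integral>x. step f x * \<phi> x \<partial>lborel) - (\<integral>x. f x * \<phi> x \<partial>lborel) - 4 * \<beta> * \<delta>\<^sup>2 * (\<integral>x. f x * (perp (D x) \<bullet> E x) \<partial>lborel)"
    by (simp only: step_adjoint[OF f C11_borel[OF \<phi>(1)] \<phi>(2)] integral_mult_right_zero mult.commute[of "f _"])
  finally have "\<bar>(\<integral>x. step f x * \<phi> x \<partial>lborel) - (\<integral>x. f x * \<phi> x \<partial>lborel) - 4 * \<beta> * \<delta>\<^sup>2 * (\<integral>x. f x * (perp (D x) \<bullet> E x) \<partial>lborel)\<bar>
    = \<bar>\<integral>x. ?T x * f x \<partial>lborel\<bar>" by simp
  also have "\<dots> \<le> (4 * K * \<delta>\<^sup>2 + 8 * \<beta> * \<delta>^3 * L * K) * (\<integral>x. \<bar>f x\<bar> \<partial>lborel)"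
    by (rule integral_bounded_mult_le[OF Tm step_pointwise[OF \<phi>(1)] bdd_L1D(3)[OF f]])
  also have "\<dots> \<le> (4 * K * \<delta>\<^sup>2 + 8 * \<beta> * \<delta>^3 * L * K) * M"
    using bdd_L1D(4)[OF f] C11D(3)[OF \<phi>(1)] C11D(3)[OF \<Psi>] \<beta> \<delta> by (intro mult_left_mono) auto
  finally show ?thesis .
qed

end

section \<open>Weak compactness\<close>

text \<open>The companion of \<open>tendsto_approx\<close> for a limit that is not yet known, by
  completeness.\<close>

lemma convergent_approx:
  fixes X :: "nat \<Rightarrow> 'a::complete_space"
  assumes "\<And>\<eta>. \<eta> > 0 \<Longrightarrow> \<exists>Y. convergent Y \<and> (\<forall>\<^sub>F n in sequentially. dist (X n) (Y n) \<le> \<eta>)"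
  shows "convergent X"
proof -
  have "Cauchy X"
  proof (rule metric_CauchyI)
    fix e :: real assume e: "e > 0"
    then obtain Y where Y: "convergent Y" "\<forall>\<^sub>F n in sequentially. dist (X n) (Y n) \<le> e / 4" using assms[of "e/4"] by auto
    obtain N1 where N1: "\<And>n. n \<ge> N1 \<Longrightarrow> dist (X n) (Y n) \<le> e / 4" using Y(2) by (auto simp: eventually_sequentially)
    have e4: "e / 4 > 0" using e by simp
    obtain N2 where N2: "\<And>m n. m \<ge> N2 \<Longrightarrow> n \<ge> N2 \<Longrightarrow> dist (Y m) (Y n) < e / 4"
      using metric_CauchyD[OF convergent_Cauchy[OF Y(1)] e4] by auto
    have "dist (X m) (X n) < e" if "m \<ge> max N1 N2" "n \<ge> max N1 N2" for m n
    proof -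
      have "dist (X m) (X n) \<le> dist (X m) (Y m) + dist (Y m) (Y n) + dist (X n) (Y n)"
        using dist_triangle[of "X m" "X n" "Y m"] dist_triangle[of "Y m" "X n" "Y n"] dist_commute[of "Y n" "X n"] by linarith
      then show ?thesis using N1[of m] N1[of n] N2[of m n] that e by auto
    qed
    then show "\<exists>M. \<forall>m\<ge>M. \<forall>n\<ge>M. dist (X m) (X n) < e" by blast
  qed
  then show ?thesis by (rule Cauchy_convergent)
qed

text \<open>The approximations are piecewise constant in time, so they are equicontinuous only up to
  the length \<open>h n\<close> of a step; since it vanishes, convergence still spreads from
  rational times to all times.\<close>

lemma convergent_equicontinuous:
  fixes X :: "nat \<Rightarrow> real \<Rightarrow> 'a::complete_space"
  assumes eq: "\<And>n s t. 0 \<le> s \<Longrightarrow> 0 \<le> t \<Longrightarrow> dist (X n s) (X n t) \<le> c * (\<bar>s - t\<bar> + h n)"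
    and h: "h \<longlonglongrightarrow> 0" and q: "\<And>q. q \<in> \<rat> \<Longrightarrow> 0 \<le> q \<Longrightarrow> convergent (\<lambda>n. X n q)" and t: "0 \<le> t"
  shows "convergent (\<lambda>n. X n t)"
proof (rule convergent_approx)
  fix \<eta> :: real assume \<eta>: "\<eta> > 0"
  define K where "K = \<bar>c\<bar> + 1"
  have K: "0 < K" "\<bar>c\<bar> \<le> K" by (auto simp: K_def)
  define a where "a = \<eta> / (2 * K)"
  have aa: "a + a = \<eta> / K" using K by (simp add: a_def field_simps)
  have "\<bar>c\<bar> * (\<eta> / K) \<le> K * (\<eta> / K)" using K \<eta> by (intro mult_right_mono) auto
  then have a: "a > 0" "\<bar>c\<bar> * (a + a) \<le> \<eta>" unfolding aa using \<eta> K by (auto simp: a_def)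
  obtain q where q': "q \<in> \<rat>" "t < q" "q < t + a" using Rats_dense_in_real[of t "t + a"] a by auto
  have "\<forall>\<^sub>F n in sequentially. \<bar>h n\<bar> < a" using tendstoD[OF h a(1)] by simp
  then have "\<forall>\<^sub>F n in sequentially. dist (X n t) (X n q) \<le> \<eta>"
  proof eventually_elim
    case (elim n)
    have "dist (X n t) (X n q) \<le> c * (\<bar>t - q\<bar> + h n)" using eq[of t q n] t q' by simp
    also have "\<dots> \<le> \<bar>c * (\<bar>t - q\<bar> + h n)\<bar>" by simp
    also have "\<dots> \<le> \<bar>c\<bar> * (a + a)" unfolding abs_mult using elim q' by (intro mult_left_mono) auto
    finally show ?case using a(2) by simp
  qed
  then show "\<exists>Y. convergent Y \<and> (\<forall>\<^sub>F n in sequentially. dist (X n t) (Y n) \<le> \<eta>)"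
    using q[of q] q' t by (intro exI[of _ "\<lambda>n. X n q"]) auto
qed

lemma integral_mult_diff_le:
  fixes f \<phi> \<psi> :: "'a::euclidean_space \<Rightarrow> real"
  assumes f: "f \<in> borel_measurable borel" "\<And>x. \<bar>f x\<bar> \<le> C" and i: "integrable lborel \<phi>" "integrable lborel \<psi>"
  shows "dist (\<integral>x. f x * \<phi> x \<partial>lborel) (\<integral>x. f x * \<psi> x \<partial>lborel) \<le> C * (\<integral>x. \<bar>\<phi> x - \<psi> x\<bar> \<partial>lborel)"
  using integral_bounded_mult_le[OF f Bochner_Integration.integrable_diff[OF i]]
    integrable_bounded_mult[OF f i(1)] integrable_bounded_mult[OF f i(2)]
  by (simp add: dist_real_def right_diff_distrib)

lemma weak_convergent_bump:
  fixes f :: "nat \<Rightarrow> 'a::euclidean_space \<Rightarrow> real"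
  assumes f: "\<And>n. f n \<in> borel_measurable borel" "\<And>n x. \<bar>f n x\<bar> \<le> C"
    and b: "\<And>k a b. rational_box a b \<Longrightarrow> convergent (\<lambda>n. \<integral>x. f n x * bump k a b x \<partial>lborel)"
    and \<phi>: "integrable lborel \<phi>"
  shows "convergent (\<lambda>n. \<integral>x. f n x * \<phi> x \<partial>lborel)"
  using \<phi>
proof (induction rule: L1_induct_bump)
  case (bump k a b) then show ?case by (rule b)
next
  case (add \<phi> \<psi>)
  have "(\<lambda>n. \<integral>x. f n x * (\<phi> x + \<psi> x) \<partial>lborel) = (\<lambda>n. (\<integral>x. f n x * \<phi> x \<partial>lborel) + (\<integral>x. f n x * \<psi> x \<partial>lborel))"
    using integrable_bounded_mult[OF f add(1)] integrable_bounded_mult[OF f add(2)] by (simp add: distrib_left)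
  then show ?case using convergent_add[OF add(3,4)] by simp
next
  case (scale c \<phi>)
  have "(\<lambda>n. \<integral>x. f n x * (c * \<phi> x) \<partial>lborel) = (\<lambda>n. c * (\<integral>x. f n x * \<phi> x \<partial>lborel))"
    by (simp add: mult.left_commute)
  then show ?case using convergent_mult[OF convergent_const[of c] scale(2)] by simp
next
  case (lim \<phi>)
  show ?case
  proof (rule convergent_approx)
    fix \<eta> :: real assume \<eta>: "\<eta> > 0"
    have C: "0 \<le> C" using f(2)[of 0 0] by linarith
    have "\<eta> / (C + 1) > 0" using \<eta> C by simp
    from lim(2)[OF this] obtain g where g: "integrable lborel g" "convergent (\<lambda>n. \<integral>x. f n x * g x \<partial>lborel)"
      "(\<integral>x. \<bar>\<phi> x - g x\<bar> \<partial>lborel) \<le> \<eta> / (C + 1)" by blast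
    have "dist (\<integral>x. f n x * \<phi> x \<partial>lborel) (\<integral>x. f n x * g x \<partial>lborel) \<le> \<eta>" for n
    proof -
      have "dist (\<integral>x. f n x * \<phi> x \<partial>lborel) (\<integral>x. f n x * g x \<partial>lborel) \<le> C * (\<integral>x. \<bar>\<phi> x - g x\<bar> \<partial>lborel)"
        by (rule integral_mult_diff_le[OF f lim(1) g(1)])
      also have "\<dots> \<le> C * (\<eta> / (C + 1))" using g(3) C by (intro mult_left_mono)
      also have "\<dots> \<le> \<eta>" using C \<eta> by (simp add: field_simps)
      finally show ?thesis .
    qed
    then show "\<exists>Y. convergent Y \<and> (\<forall>\<^sub>F n in sequentially. dist (\<integral>x. f n x * \<phi> x \<partial>lborel) (Y n) \<le> \<eta>)"
      using g(2) by (intro exI[of _ "\<lambda>n. \<integral>x. f n x * g x \<partial>lborel"]) auto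
  qed
qed

text \<open>Uniqueness follows from convergence: the alternating sequence f, g, f, g, ... has
  constant pairings with bumps, hence convergent pairings with \<phi>, and its even and odd terms
  must have the same limit.\<close>

lemma integral_eq_of_bump:
  fixes f g :: "'a::euclidean_space \<Rightarrow> real"
  assumes f: "f \<in> borel_measurable borel" "\<And>x. \<bar>f x\<bar> \<le> C" and g: "g \<in> borel_measurable borel" "\<And>x. \<bar>g x\<bar> \<le> C"
    and b: "\<And>k a b. rational_box a b \<Longrightarrow> (\<integral>x. f x * bump k a b x \<partial>lborel) = (\<integral>x. g x * bump k a b x \<partial>lborel)"
    and \<phi>: "integrable lborel \<phi>"
  shows "(\<integral>x. f x * \<phi> x \<partial>lborel) = (\<integral>x. g x * \<phi> x \<partial>lborel)"
proof -
  define F where "F n = (if even n then f else g)" for n :: nat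
  have F: "F n \<in> borel_measurable borel" "\<bar>F n x\<bar> \<le> C" for n x using f g by (auto simp: F_def)
  have "convergent (\<lambda>n. \<integral>x. F n x * \<phi> x \<partial>lborel)"
  proof (rule weak_convergent_bump[OF F _ \<phi>])
    fix k :: nat and a b :: 'a assume "rational_box a b"
    then have "(\<lambda>n. \<integral>x. F n x * bump k a b x \<partial>lborel) = (\<lambda>n. \<integral>x. f x * bump k a b x \<partial>lborel)"
      using b by (auto simp: F_def)
    then show "convergent (\<lambda>n. \<integral>x. F n x * bump k a b x \<partial>lborel)" by (simp add: convergent_const)
  qed
  then obtain l where l: "(\<lambda>n. \<integral>x. F n x * \<phi> x \<partial>lborel) \<longlonglongrightarrow> l" by (auto simp: convergent_def)
  have "((\<lambda>n. \<integral>x. F n x * \<phi> x \<partial>lborel) \<circ> (\<lambda>n. 2 * n)) \<longlonglongrightarrow> l"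
    by (rule LIMSEQ_subseq_LIMSEQ[OF l]) (auto simp: strict_mono_def)
  then have 1: "(\<integral>x. f x * \<phi> x \<partial>lborel) = l" by (simp add: o_def F_def LIMSEQ_const_iff)
  have "((\<lambda>n. \<integral>x. F n x * \<phi> x \<partial>lborel) \<circ> (\<lambda>n. 2 * n + 1)) \<longlonglongrightarrow> l"
    by (rule LIMSEQ_subseq_LIMSEQ[OF l]) (auto simp: strict_mono_def)
  then have 2: "(\<integral>x. g x * \<phi> x \<partial>lborel) = l" by (simp add: o_def F_def LIMSEQ_const_iff)
  show ?thesis using 1 2 by simp
qed

lemma weak_limit_ex:
  fixes f :: "nat \<Rightarrow> 'a::euclidean_space \<Rightarrow> real"
  assumes "\<And>n. f n \<in> borel_measurable borel" "\<And>n x. \<bar>f n x\<bar> \<le> C"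
    and "\<And>\<phi>. integrable lborel \<phi> \<Longrightarrow> convergent (\<lambda>n. \<integral>x. f n x * \<phi> x \<partial>lborel)"
  shows "\<exists>g. g \<in> borel_measurable borel \<and> (\<forall>x. \<bar>g x\<bar> \<le> C) \<and>
      (\<forall>\<phi>. integrable lborel \<phi> \<longrightarrow> (\<lambda>n. \<integral>x. f n x * \<phi> x \<partial>lborel) \<longlonglongrightarrow> (\<integral>x. g x * \<phi> x \<partial>lborel))"
proof (rule weak_limit_exists[OF assms(1,2)])
  fix g assume "g \<in> borel_measurable borel" "\<And>x. \<bar>g x\<bar> \<le> C"
    "\<And>\<phi>. integrable lborel \<phi> \<Longrightarrow> (\<lambda>n. \<integral>x. f n x * \<phi> x \<partial>lborel) \<longlonglongrightarrow> (\<integral>x. g x * \<phi> x \<partial>lborel)"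
  then show ?thesis by (intro exI[of _ g] conjI allI impI)
qed (rule assms(3))

section \<open>Joint measurability of limits chosen time by time\<close>

text \<open>The \<open>g t\<close> are unrelated choices and may fail to be measurable in
  \<open>t\<close>. A space-time weak limit \<open>G\<close> of the same sequence is jointly Borel,
  and by Fubini its sections have the right pairing with each bump for almost every
  \<open>t\<close>; countably many bumps produce a single null set of bad times. There
  \<open>g t\<close> is kept, so the pairings hold at every time, at the price of Lebesgue instead
  of Borel measurability.\<close>

lemma jointly_measurable_version:
  fixes f :: "nat \<Rightarrow> real \<times> 'a::euclidean_space \<Rightarrow> real" and g :: "real \<Rightarrow> 'a \<Rightarrow> real"
  assumes f[measurable]: "\<And>n. f n \<in> borel_measurable borel" and fC: "\<And>n p. \<bar>f n p\<bar> \<le> C"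
    and g[measurable]: "\<And>t. g t \<in> borel_measurable borel" and gC: "\<And>t x. \<bar>g t x\<bar> \<le> C"
    and lim: "\<And>t \<phi>. integrable lborel \<phi> \<Longrightarrow> (\<lambda>n. \<integral>x. f n (t, x) * \<phi> x \<partial>lborel) \<longlonglongrightarrow> (\<integral>x. g t x * \<phi> x \<partial>lborel)"
  shows "\<exists>g'. (\<lambda>(t, x). g' t x) \<in> borel_measurable lebesgue \<and>
    (\<forall>t. g' t \<in> borel_measurable borel) \<and> (\<forall>t x. \<bar>g' t x\<bar> \<le> C) \<and>
    (\<forall>t \<phi>. integrable lborel \<phi> \<longrightarrow> (\<integral>x. g' t x * \<phi> x \<partial>lborel) = (\<integral>x. g t x * \<phi> x \<partial>lborel))"
proof -
  have prod: "(lborel :: (real \<times> 'a) measure) = lborel \<Otimes>\<^sub>M lborel" by (rule lborel_prod[symmetric])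
  have C0: "0 \<le> C" using fC[of 0 0] by linarith
  have meas_pair: "h \<in> borel_measurable (lborel \<Otimes>\<^sub>M lborel)" if "h \<in> borel_measurable borel" for h :: "real \<times> 'a \<Rightarrow> real"
    using that by (simp add: borel_prod[symmetric] cong: measurable_cong_sets)
  have fub: "(\<integral>p. h p \<partial>lborel) = (\<integral>t. (\<integral>x. h (t, x) \<partial>lborel) \<partial>lborel)" if "integrable lborel h" for h :: "real \<times> 'a \<Rightarrow> real"
    using lborel_pair.integral_fst'[of h] that unfolding prod by simp
  \<comment> \<open>Sections of an integrable function are integrable for almost every
    \<open>t\<close> only; the conditional makes the integrands converge at every \<open>t\<close>,
    which yields measurability of the limit.\<close>
  have key: "(\<lambda>n. \<integral>p. f n p * \<Phi> p \<partial>lborel) \<longlonglongrightarrow> (\<integral>t. (if integrable lborel (\<lambda>x. \<Phi> (t, x)) then \<integral>x. g t x * \<Phi> (t, x) \<partial>lborel else 0) \<partial>lborel)"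
    if \<Phi>: "integrable lborel \<Phi>" for \<Phi>
  proof -
    have \<Phi>m: "\<Phi> \<in> borel_measurable borel" using borel_measurable_integrable[OF \<Phi>] by simp
    note [measurable] = meas_pair[OF \<Phi>m] meas_pair[OF f]
    have \<Phi>i: "integrable (lborel \<Otimes>\<^sub>M lborel) \<Phi>" using \<Phi> prod by simp
    have sec: "AE t in lborel. integrable lborel (\<lambda>x. \<Phi> (t, x))"
      using lborel_pair.AE_integrable_fst'[OF \<Phi>i] by simp
    have [measurable]: "Measurable.pred lborel (\<lambda>t. integrable lborel (\<lambda>x. \<Phi> (t, x)))" by measurable
    let ?I = "\<lambda>n t. if integrable lborel (\<lambda>x. \<Phi> (t, x)) then \<integral>x. f n (t, x) * \<Phi> (t, x) \<partial>lborel else 0"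
    let ?J = "\<lambda>t. if integrable lborel (\<lambda>x. \<Phi> (t, x)) then \<integral>x. g t x * \<Phi> (t, x) \<partial>lborel else 0"
    have Im: "?I n \<in> borel_measurable lborel" for n by measurable
    have IJ: "(\<lambda>n. ?I n t) \<longlonglongrightarrow> ?J t" for t using lim[of "\<lambda>x. \<Phi> (t, x)" t] by auto
    have Jm: "?J \<in> borel_measurable lborel" by (rule borel_measurable_LIMSEQ_real[OF IJ Im])
    have "(\<lambda>n. \<integral>t. ?I n t \<partial>lborel) \<longlonglongrightarrow> (\<integral>t. ?J t \<partial>lborel)"
    proof (rule integral_dominated_convergence[OF Jm Im, where w="\<lambda>t. C * (\<integral>x. \<bar>\<Phi> (t, x)\<bar> \<partial>lborel)"])
      show "integrable lborel (\<lambda>t. C * (\<integral>x. \<bar>\<Phi> (t, x)\<bar> \<partial>lborel))"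
        using lborel_pair.integrable_fst'[OF integrable_abs[OF \<Phi>i]] by simp
      show "AE t in lborel. norm (?I n t) \<le> C * (\<integral>x. \<bar>\<Phi> (t, x)\<bar> \<partial>lborel)" for n
      proof (rule AE_I2)
        fix t
        show "norm (?I n t) \<le> C * (\<integral>x. \<bar>\<Phi> (t, x)\<bar> \<partial>lborel)"
        proof (cases "integrable lborel (\<lambda>x. \<Phi> (t, x))")
          case True
          have "(\<lambda>x. f n (t, x)) \<in> borel_measurable borel" by measurable
          from integral_bounded_mult_le[OF this fC True] True show ?thesis by simp
        qed (use C0 in simp)
      qed
    qed (use IJ in auto)
    moreover have "(\<integral>p. f n p * \<Phi> p \<partial>lborel) = (\<integral>t. ?I n t \<partial>lborel)" for n
    proof -
      have "(\<integral>p. f n p * \<Phi> p \<partial>lborel) = (\<integral>t. (\<integral>x. f n (t, x) * \<Phi> (t, x) \<partial>lborel) \<partial>lborel)"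
        by (rule fub) (rule integrable_bounded_mult[OF f fC \<Phi>])
      also have "\<dots> = (\<integral>t. ?I n t \<partial>lborel)"
        by (rule integral_cong_AE) (use sec in \<open>auto\<close>)
      finally show ?thesis .
    qed
    ultimately show ?thesis by simp
  qed
  obtain G where G[measurable]: "G \<in> borel_measurable borel" and GC: "\<And>p. \<bar>G p\<bar> \<le> C"
    and Glim: "\<And>\<Phi>. integrable lborel \<Phi> \<Longrightarrow> (\<lambda>n. \<integral>p. f n p * \<Phi> p \<partial>lborel) \<longlonglongrightarrow> (\<integral>p. G p * \<Phi> p \<partial>lborel)"
    using weak_limit_ex[OF f fC convergentI[OF key]] by auto
  note Gp[measurable] = meas_pair[OF G]
  have Gt: "(\<lambda>x. G (t, x)) \<in> borel_measurable borel" for t by measurable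
  have ae: "AE t in lborel. (\<integral>x. g t x * \<phi> x \<partial>lborel) = (\<integral>x. G (t, x) * \<phi> x \<partial>lborel)" if \<phi>: "integrable lborel \<phi>" for \<phi>
  proof -
    have \<phi>m[measurable]: "\<phi> \<in> borel_measurable borel" using borel_measurable_integrable[OF \<phi>] by simp
    note fp[measurable] = meas_pair[OF f]
    have gm: "(\<lambda>t. \<integral>x. g t x * \<phi> x \<partial>lborel) \<in> borel_measurable lborel"
      by (rule borel_measurable_LIMSEQ_real[OF lim[OF \<phi>]]) measurable
    define d where "d t = (\<integral>x. g t x * \<phi> x \<partial>lborel) - (\<integral>x. G (t, x) * \<phi> x \<partial>lborel)" for t
    have dm[measurable]: "d \<in> borel_measurable borel" unfolding d_def using gm by measurable
    have dk: "AE t in lborel. t \<in> {- real k..real k} \<longrightarrow> d t = 0" for k :: nat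
    proof -
      \<comment> \<open>Testing with the sign of the discrepancy, cut to a bounded interval, turns
        equality of the space-time pairings into a vanishing integral of
        \<open>\<bar>d t\<bar>\<close>.\<close>
      define \<sigma> where "\<sigma> t = sgn (d t) * indicator {- real k..real k} t" for t
      have \<sigma>m[measurable]: "\<sigma> \<in> borel_measurable borel" unfolding \<sigma>_def by measurable
      have i1: "integrable lborel (indicator {- real k..real k} :: real \<Rightarrow> real)"
        by (rule integrable_real_indicator) auto
      have \<sigma>i: "integrable lborel \<sigma>" unfolding \<sigma>_def
        by (rule integrable_bounded_mult[OF _ _ i1, where C=1]) (auto simp: sgn_real_def)
      define \<Phi> where "\<Phi> = (\<lambda>p. \<sigma> (fst p) * \<phi> (snd p))"
      have \<Phi>i: "integrable lborel \<Phi>" unfolding prod \<Phi>_def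
      proof (rule lborel_pair.Fubini_integrable)
        show "(\<lambda>p. \<sigma> (fst p) * \<phi> (snd p)) \<in> borel_measurable (lborel \<Otimes>\<^sub>M lborel)" by measurable
        show "integrable lborel (\<lambda>t. \<integral>x. norm (\<sigma> (fst (t, x)) * \<phi> (snd (t, x))) \<partial>lborel)"
          using \<sigma>i by (simp add: abs_mult)
      qed (use \<phi> in simp)
      have sec: "integrable lborel (\<lambda>x. \<Phi> (t, x))" for t unfolding \<Phi>_def using \<phi> by simp
      have pull: "(\<integral>x. u x * \<Phi> (t, x) \<partial>lborel) = \<sigma> t * (\<integral>x. u x * \<phi> x \<partial>lborel)" for u t
        unfolding \<Phi>_def by (simp add: mult.left_commute)
      have "(\<integral>t. \<sigma> t * (\<integral>x. g t x * \<phi> x \<partial>lborel) \<partial>lborel) = (\<integral>p. G p * \<Phi> p \<partial>lborel)"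
        using LIMSEQ_unique[OF key[OF \<Phi>i] Glim[OF \<Phi>i]] sec by (simp add: pull)
      also have "\<dots> = (\<integral>t. (\<integral>x. G (t, x) * \<Phi> (t, x) \<partial>lborel) \<partial>lborel)"
        by (rule fub) (rule integrable_bounded_mult[OF G GC \<Phi>i])
      also have "\<dots> = (\<integral>t. \<sigma> t * (\<integral>x. G (t, x) * \<phi> x \<partial>lborel) \<partial>lborel)" by (simp add: pull)
      finally have eq: "(\<integral>t. \<sigma> t * (\<integral>x. g t x * \<phi> x \<partial>lborel) \<partial>lborel) = (\<integral>t. \<sigma> t * (\<integral>x. G (t, x) * \<phi> x \<partial>lborel) \<partial>lborel)" .
      have bi: "integrable lborel (\<lambda>t. \<sigma> t * u t)" if u: "u \<in> borel_measurable borel" "\<And>t. \<bar>u t\<bar> \<le> C * (\<integral>x. \<bar>\<phi> x\<bar> \<partial>lborel)" for u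
        using integrable_bounded_mult[OF u \<sigma>i] by (simp add: mult.commute)
      have b1: "integrable lborel (\<lambda>t. \<sigma> t * (\<integral>x. g t x * \<phi> x \<partial>lborel))"
        by (rule bi) (use gm integral_bounded_mult_le[OF g gC \<phi>] in auto)
      have b2: "integrable lborel (\<lambda>t. \<sigma> t * (\<integral>x. G (t, x) * \<phi> x \<partial>lborel))"
      proof (rule bi)
        show "(\<lambda>t. \<integral>x. G (t, x) * \<phi> x \<partial>lborel) \<in> borel_measurable borel" by measurable
        show "\<bar>\<integral>x. G (t, x) * \<phi> x \<partial>lborel\<bar> \<le> C * (\<integral>x. \<bar>\<phi> x\<bar> \<partial>lborel)" for t
          by (rule integral_bounded_mult_le[OF Gt GC \<phi>])
      qed
      have sd: "\<sigma> t * (\<integral>x. g t x * \<phi> x \<partial>lborel) - \<sigma> t * (\<integral>x. G (t, x) * \<phi> x \<partial>lborel) = \<bar>d t\<bar> * indicator {- real k..real k} t" for t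
        unfolding right_diff_distrib[symmetric] d_def[symmetric] by (simp add: \<sigma>_def abs_sgn mult_ac)
      have "(\<integral>t. \<bar>d t\<bar> * indicator {- real k..real k} t \<partial>lborel) = 0"
        using Bochner_Integration.integral_diff[OF b1 b2] eq unfolding sd by simp
      moreover have "integrable lborel (\<lambda>t. \<bar>d t\<bar> * indicator {- real k..real k} t)"
        using Bochner_Integration.integrable_diff[OF b1 b2] unfolding sd .
      ultimately have "AE t in lborel. \<bar>d t\<bar> * indicator {- real k..real k} t = 0"
        by (subst (asm) integral_nonneg_eq_0_iff_AE) auto
      then show ?thesis by eventually_elim (auto simp: indicator_def split: if_splits)
    qed
    have "AE t in lborel. \<forall>k::nat. t \<in> {- real k..real k} \<longrightarrow> d t = 0"
      unfolding AE_all_countable using dk by blast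
    then show ?thesis
    proof eventually_elim
      case (elim t)
      obtain k :: nat where "\<bar>t\<bar> \<le> real k" using real_arch_simple by blast
      then have "d t = 0" using elim by (auto simp: abs_le_iff)
      then show ?case by (simp add: d_def)
    qed
  qed
  define S where "S = {a::'a. \<forall>i\<in>Basis. a \<bullet> i \<in> \<rat>}"
  have S: "countable (UNIV \<times> S \<times> S :: (nat \<times> 'a \<times> 'a) set)" unfolding S_def using countable_rational_points by auto
  have "AE t in lborel. \<forall>i\<in>UNIV \<times> S \<times> S. (\<integral>x. g t x * bump (fst i) (fst (snd i)) (snd (snd i)) x \<partial>lborel) = (\<integral>x. G (t, x) * bump (fst i) (fst (snd i)) (snd (snd i)) x \<partial>lborel)"
    by (subst AE_ball_countable[OF S]) (auto intro!: ae bump_integrable)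
  then obtain N where N: "N \<in> null_sets lborel" and
    Nb: "\<And>t. t \<notin> N \<Longrightarrow> \<forall>i\<in>UNIV \<times> S \<times> S. (\<integral>x. g t x * bump (fst i) (fst (snd i)) (snd (snd i)) x \<partial>lborel) = (\<integral>x. G (t, x) * bump (fst i) (fst (snd i)) (snd (snd i)) x \<partial>lborel)"
    by (auto elim!: AE_E3)
  have good: "(\<integral>x. g t x * \<phi> x \<partial>lborel) = (\<integral>x. G (t, x) * \<phi> x \<partial>lborel)" if "t \<notin> N" "integrable lborel \<phi>" for t \<phi>
  proof (rule integral_eq_of_bump[OF g gC Gt GC _ that(2)])
    fix k :: nat and a b :: 'a assume "rational_box a b"
    then have "(k, a, b) \<in> UNIV \<times> S \<times> S" by (auto simp: S_def rational_box_def)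
    then show "(\<integral>x. g t x * bump k a b x \<partial>lborel) = (\<integral>x. G (t, x) * bump k a b x \<partial>lborel)"
      using Nb[OF that(1)] by force
  qed
  define g' where "g' t x = (if t \<in> N then g t x else G (t, x))" for t x
  show ?thesis
  proof (intro exI[of _ g'] conjI allI impI)
    have Nn: "N \<times> (UNIV :: 'a set) \<in> null_sets lborel"
    proof -
      have Ns: "N \<in> sets borel" using N by auto
      then have "N \<times> (UNIV :: 'a set) \<in> sets (lborel \<Otimes>\<^sub>M lborel)" by (intro pair_measureI) auto
      moreover have "emeasure (lborel \<Otimes>\<^sub>M lborel) (N \<times> (UNIV :: 'a set)) = 0"
        using N Ns by (subst lborel.emeasure_pair_measure_Times) auto
      ultimately show ?thesis unfolding prod by (rule null_setsI[rotated])
    qed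
    have Gl: "G \<in> borel_measurable lebesgue" using measurable_completion[of G lborel borel] G by simp
    have "AE p in lebesgue. G p = (case p of (t, x) \<Rightarrow> g' t x)"
    proof (rule AE_completion, rule AE_I'[OF Nn])
      show "{p \<in> space lborel. G p \<noteq> (case p of (t, x) \<Rightarrow> g' t x)} \<subseteq> N \<times> UNIV" by (auto simp: g'_def split: if_splits)
    qed
    then show "(\<lambda>(t, x). g' t x) \<in> borel_measurable lebesgue" by (rule borel_measurable_AE[OF Gl])
    show "g' t \<in> borel_measurable borel" for t
      unfolding g'_def[abs_def] using g[of t] Gt[of t] by (cases "t \<in> N") auto
    show "\<bar>g' t x\<bar> \<le> C" for t x using gC GC by (simp add: g'_def)
    show "(\<integral>x. g' t x * \<phi> x \<partial>lborel) = (\<integral>x. g t x * \<phi> x \<partial>lborel)" if "integrable lborel \<phi>" for t \<phi>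
      using good[OF _ that, of t] by (cases "t \<in> N") (auto simp: g'_def)
  qed
qed

lemma dist_discrete_lipschitz:
  fixes A :: "nat \<Rightarrow> 'a::metric_space"
  assumes "\<And>k. dist (A (Suc k)) (A k) \<le> d"
  shows "dist (A k) (A l) \<le> d * \<bar>real k - real l\<bar>"
proof -
  have le: "dist (A (l + m)) (A l) \<le> d * real m" for l m
  proof (induction m)
    case (Suc m)
    have "dist (A (l + Suc m)) (A l) \<le> dist (A (Suc (l + m))) (A (l + m)) + dist (A (l + m)) (A l)"
      using dist_triangle[of "A (Suc (l + m))" "A l" "A (l + m)"] by simp
    also have "\<dots> \<le> d + d * real m" using assms[of "l + m"] Suc by linarith
    finally show ?case by (simp add: algebra_simps)
  qed simp
  show ?thesis
  proof (cases "l \<le> k")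
    case True
    then show ?thesis using le[of l "k - l"] by (simp add: of_nat_diff)
  next
    case False
    then show ?thesis using le[of k "l - k"] by (simp add: of_nat_diff dist_commute)
  qed
qed

lemma gradPsi_borel [measurable]:
  assumes [measurable]: "f \<in> borel_measurable borel"
  shows "gradPsi c b e f z \<in> borel_measurable borel"
proof -
  have [measurable]: "gradpot c b e \<in> borel_measurable borel" unfolding gradpot_def by measurable
  show ?thesis unfolding gradPsi_def by measurable
qed

section \<open>The scheme and its limit\<close>

definition flux :: "real \<Rightarrow> real \<Rightarrow> real \<Rightarrow> (real^2 \<Rightarrow> real) \<Rightarrow> real^2 \<Rightarrow> (real^2 \<Rightarrow> real^2) \<Rightarrow> real" where
  "flux c b e f z E = (\<integral>x. f x * ((vel c b e f x + kern c b e (x - z)) \<bullet> E x) \<partial>lborel)"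

context riesz
begin

lemma vel_inner_bound:
  assumes f: "bdd_L1 C M f" and e: "0 \<le> e" and E: "\<And>x. norm (E x) \<le> K"
  shows "\<bar>vel c b e f x \<bullet> E x\<bar> \<le> Vmax C M * K"
proof -
  have "\<bar>vel c b e f x \<bullet> E x\<bar> \<le> norm (vel c b e f x) * norm (E x)" by (rule Cauchy_Schwarz_ineq2)
  also have "\<dots> \<le> Vmax C M * K" using vel_bound[OF f e, of x] E[of x]
    by (intro mult_mono) (auto intro: order_trans[OF norm_ge_zero])
  finally show ?thesis .
qed

lemma vel_inner_integrable:
  assumes f: "bdd_L1 C M f" and e: "0 \<le> e" and E: "E \<in> borel_measurable borel" "\<And>x. norm (E x) \<le> K"
  shows "integrable lborel (\<lambda>x. f x * (vel c b e f x \<bullet> E x))"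
proof -
  note [measurable] = bdd_L1D(1)[OF f] E(1)
  have vm: "(\<lambda>x. vel c b e f x \<bullet> E x) \<in> borel_measurable borel" by measurable
  have vb: "\<bar>vel c b e f x \<bullet> E x\<bar> \<le> Vmax C M * K" for x by (rule vel_inner_bound[OF f e E(2)])
  from integrable_bounded_mult[OF vm vb bdd_L1D(3)[OF f]]
  show ?thesis by (simp add: mult.commute)
qed

lemma flux_split:
  assumes f: "bdd_L1 C M f" and e: "0 \<le> e" and E: "E \<in> borel_measurable borel" "\<And>x. norm (E x) \<le> K"
  shows "integrable lborel (\<lambda>x. f x * ((vel c b e f x + kern c b e (x - z)) \<bullet> E x))"
    "flux c b e f z E = (\<integral>x. f x * (vel c b e f x \<bullet> E x) \<partial>lborel) + (\<integral>x. f x * (kern c b e (x - z) \<bullet> E x) \<partial>lborel)"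
  using vel_inner_integrable[OF assms] kern_inner_integrable[OF assms, of z]
  by (simp_all add: flux_def inner_add_left distrib_left)

text \<open>The self-advection contributes \<open>M\<close> times the speed bound; the vortex field
  is unbounded, but its product with the vorticity has integral at most the same speed bound, which
  accounts for the added 1.\<close>

lemma flux_bound:
  assumes f: "bdd_L1 C M f" and e: "0 \<le> e" and E: "E \<in> borel_measurable borel" "\<And>x. norm (E x) \<le> K"
  shows "\<bar>flux c b e f z E\<bar> \<le> (M + 1) * Vmax C M * K"
proof -
  note [measurable] = bdd_L1D(1)[OF f] E(1)
  have K: "0 \<le> K" using E(2)[of 0] norm_ge_zero order_trans by blast
  have V: "0 \<le> Vmax C M" using vel_bound[OF f e, of 0] norm_ge_zero order_trans by blast
  have vm: "(\<lambda>x. vel c b e f x \<bullet> E x) \<in> borel_measurable borel" by measurable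
  have vb: "\<bar>vel c b e f x \<bullet> E x\<bar> \<le> Vmax C M * K" for x by (rule vel_inner_bound[OF f e E(2)])
  have "\<bar>\<integral>x. f x * (vel c b e f x \<bullet> E x) \<partial>lborel\<bar> \<le> Vmax C M * K * (\<integral>x. \<bar>f x\<bar> \<partial>lborel)"
    using integral_bounded_mult_le[OF vm vb bdd_L1D(3)[OF f]] by (simp add: mult.commute)
  also have "\<dots> \<le> Vmax C M * K * M" using bdd_L1D(4)[OF f] K V by (intro mult_left_mono) auto
  finally have 1: "\<bar>\<integral>x. f x * (vel c b e f x \<bullet> E x) \<partial>lborel\<bar> \<le> Vmax C M * K * M" .
  have "\<bar>\<integral>x. f x * (kern c b e (x - z) \<bullet> E x) \<partial>lborel\<bar> \<le> (\<integral>x. \<bar>f x * (kern c b e (x - z) \<bullet> E x)\<bar> \<partial>lborel)"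
    by (rule integral_abs_bound)
  also have "\<dots> \<le> (\<integral>x. \<bar>f x\<bar> * norm (kern c b e (x - z)) * K \<partial>lborel)"
  proof (rule integral_mono)
    show "integrable lborel (\<lambda>x. \<bar>f x * (kern c b e (x - z) \<bullet> E x)\<bar>)"
      by (rule integrable_abs[OF kern_inner_integrable[OF f e E]])
    show "integrable lborel (\<lambda>x. \<bar>f x\<bar> * norm (kern c b e (x - z)) * K)"
      by (rule integrable_mult_left[OF kern_mult(1)[OF f e]])
    fix x
    have "\<bar>kern c b e (x - z) \<bullet> E x\<bar> \<le> norm (kern c b e (x - z)) * K"
      using Cauchy_Schwarz_ineq2[of "kern c b e (x - z)" "E x"] mult_left_mono[OF E(2)[of x] norm_ge_zero[of "kern c b e (x - z)"]] by linarith
    then have "\<bar>f x\<bar> * \<bar>kern c b e (x - z) \<bullet> E x\<bar> \<le> \<bar>f x\<bar> * (norm (kern c b e (x - z)) * K)" by (intro mult_left_mono) auto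
    then show "\<bar>f x * (kern c b e (x - z) \<bullet> E x)\<bar> \<le> \<bar>f x\<bar> * norm (kern c b e (x - z)) * K" by (simp add: abs_mult mult.assoc)
  qed
  also have "\<dots> = (\<integral>x. \<bar>f x\<bar> * norm (kern c b e (x - z)) \<partial>lborel) * K" by simp
  also have "\<dots> \<le> Vmax C M * K" using kern_mult(2)[OF f e, of z] K by (intro mult_right_mono)
  finally have 2: "\<bar>\<integral>x. f x * (kern c b e (x - z) \<bullet> E x) \<partial>lborel\<bar> \<le> Vmax C M * K" .
  show ?thesis unfolding flux_split(2)[OF f e E] using 1 2 by (simp add: algebra_simps)
qed

end

locale scheme = riesz c b for c b :: real +
  fixes C M :: real and f0 :: "real^2 \<Rightarrow> real" and z0 :: "real^2"
  assumes f0: "bdd_L1 C M f0"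
begin

text \<open>The time step and the mesh are tied by \<open>tstep = 4 ratio mesh\<^sup>2\<close>, and \<open>slope\<close> bounds the second order
  behaviour of all stream functions that occur, which makes the weights nonnegative and the
  consistency error of order \<open>eps\<close>.\<close>

definition eps :: "nat \<Rightarrow> real" where "eps n = inverse (real (Suc n))"
text \<open>The added 1 keeps \<open>slope n\<close> at least 1, so that it may be divided by and
  \<open>mesh n\<close> stays below \<open>eps n\<close>.\<close>

definition slope :: "nat \<Rightarrow> real" where "slope n = Lpot (eps n) * (M + 1) + 1"
definition mesh :: "nat \<Rightarrow> real" where "mesh n = eps n / slope n"
definition ratio :: "nat \<Rightarrow> real" where "ratio n = 1 / (8 * slope n * mesh n)"
definition tstep :: "nat \<Rightarrow> real" where "tstep n = mesh n / (2 * slope n)"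

primrec state :: "nat \<Rightarrow> nat \<Rightarrow> (real^2 \<Rightarrow> real) \<times> (real^2)" where
  "state n 0 = (f0, z0)"
| "state n (Suc k) = (lf_step (ratio n) (mesh n) (Psi c b (eps n) (fst (state n k)) (snd (state n k))) (fst (state n k)),
     snd (state n k) + tstep n *\<^sub>R vel c b (eps n) (fst (state n k)) (snd (state n k)))"

abbreviation F :: "nat \<Rightarrow> nat \<Rightarrow> real^2 \<Rightarrow> real" where "F n k \<equiv> fst (state n k)"
abbreviation Z :: "nat \<Rightarrow> nat \<Rightarrow> real^2" where "Z n k \<equiv> snd (state n k)"
abbreviation "V \<equiv> Vmax C M"

lemma eps: "0 < eps n" "eps n \<le> 1" "0 \<le> eps n"
  by (auto simp: eps_def inverse_le_1_iff)

lemma eps_lim: "eps \<longlonglongrightarrow> 0"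
  unfolding eps_def[abs_def] by (rule LIMSEQ_inverse_real_of_nat)

lemma C0: "0 \<le> C" and M0: "0 \<le> M" using bdd_L1D(5,6)[OF f0] by auto

lemma slope: "1 \<le> slope n" "Lpot (eps n) * (M + 1) \<le> slope n"
  using C11D(3)[OF C11_pot[OF eps(1)[of n]]] M0 by (auto simp: slope_def)

lemma mesh: "0 < mesh n" "mesh n \<le> eps n"
  using slope(1)[of n] eps(1)[of n] by (auto simp: mesh_def divide_le_eq mult_le_cancel_left1)

lemma tstep: "0 < tstep n" "tstep n \<le> eps n" "4 * ratio n * (mesh n)\<^sup>2 = tstep n"
proof -
  show "0 < tstep n" using mesh(1)[of n] slope(1)[of n] by (simp add: tstep_def)
  have "mesh n \<le> mesh n * (2 * slope n)" using mesh(1)[of n] slope(1)[of n] by (simp add: mult_le_cancel_left1)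
  then have "tstep n \<le> mesh n" using slope(1)[of n] by (simp add: tstep_def divide_le_eq)
  then show "tstep n \<le> eps n" using mesh(2)[of n] by simp
  show "4 * ratio n * (mesh n)\<^sup>2 = tstep n" using mesh(1)[of n] slope(1)[of n] by (simp add: ratio_def tstep_def power2_eq_square)
qed

lemma tstep_lim: "tstep \<longlonglongrightarrow> 0"
  by (rule tendsto_sandwich[OF _ _ tendsto_const eps_lim]) (use tstep in \<open>auto intro!: always_eventually less_imp_le\<close>)

lemma V0: "0 \<le> V" using vel_bound[OF f0, of 0 0] norm_ge_zero order_trans by blast

lemma lax:
  assumes "bdd_L1 C M f"
  shows "lax_step (ratio n) (mesh n) (Psi c b (eps n) f z) (slope n) (gradPsi c b (eps n) f z)"
proof
  show "C11 (slope n) (Psi c b (eps n) f z) (gradPsi c b (eps n) f z)"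
    by (rule C11_mono[OF C11_Psi[OF assms eps(1)] slope(2)])
  show "0 \<le> ratio n" using mesh(1)[of n] slope(1)[of n] by (simp add: ratio_def)
  show "0 \<le> mesh n" using mesh(1)[of n] by simp
  show "ratio n * (2 * slope n * mesh n) \<le> 1 / 4" using mesh(1)[of n] slope(1)[of n] by (simp add: ratio_def)
qed

lemma F_bdd: "bdd_L1 C M (F n k)"
proof (induction k)
  case (Suc k) show ?case using lax_step.step_bdd_L1[OF lax[OF Suc] Suc] by simp
qed (simp add: f0)

lemma F_powr:
  assumes p: "1 \<le> p"
  shows "(\<integral>\<^sup>+x. ennreal (\<bar>F n k x\<bar> powr p) \<partial>lborel) \<le> (\<integral>\<^sup>+x. ennreal (\<bar>f0 x\<bar> powr p) \<partial>lborel)"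
proof (induction k)
  case (Suc k)
  show ?case using order_trans[OF lax_step.step_powr_le[OF lax[OF F_bdd] bdd_L1D(1)[OF F_bdd] p] Suc] by simp
qed simp

text \<open>The constant 10 is 8 + 2. By the choice of parameters mesh^2 = 2 tstep eps, so the
  diffusion error 4 K mesh^2 M is 8 tstep eps K M, and the second error reduces to 2 tstep (mesh
  slope) K M = 2 tstep eps K M.\<close>

lemma F_step:
  assumes \<phi>: "C11 K \<phi> E" "\<And>x. \<bar>\<phi> x\<bar> \<le> B" and E: "E \<in> borel_measurable borel"
  shows "\<bar>(\<integral>x. F n (Suc k) x * \<phi> x \<partial>lborel) - (\<integral>x. F n k x * \<phi> x \<partial>lborel) - tstep n * flux c b (eps n) (F n k) (Z n k) E\<bar>
    \<le> tstep n * (10 * M * K * eps n)"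
proof -
  let ?G = "gradPsi c b (eps n) (F n k) (Z n k)"
  have pg: "perp (?G x) = vel c b (eps n) (F n k) x + kern c b (eps n) (x - Z n k)" for x
    by (rule perp_gradPsi[OF F_bdd eps(1)])
  have i: "integrable lborel (\<lambda>x. F n k x * (perp (?G x) \<bullet> E x))"
    unfolding pg by (rule flux_split(1)[OF F_bdd eps(3) E C11D(1)[OF \<phi>(1)]])
  have fl: "(\<integral>x. F n k x * (perp (?G x) \<bullet> E x) \<partial>lborel) = flux c b (eps n) (F n k) (Z n k) E"
    unfolding pg flux_def by simp
  have "\<bar>(\<integral>x. F n (Suc k) x * \<phi> x \<partial>lborel) - (\<integral>x. F n k x * \<phi> x \<partial>lborel) - tstep n * flux c b (eps n) (F n k) (Z n k) E\<bar>
    \<le> (4 * K * (mesh n)\<^sup>2 + 8 * ratio n * (mesh n)^3 * slope n * K) * M"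
    using lax_step.step_consistent[OF lax[OF F_bdd] F_bdd \<phi> E gradPsi_borel[OF bdd_L1D(1)[OF F_bdd]] i]
    unfolding fl tstep(3) by simp
  also have "8 * ratio n * (mesh n)^3 * slope n * K = 2 * tstep n * mesh n * slope n * K"
    unfolding tstep(3)[symmetric] by (simp add: power2_eq_square power3_eq_cube)
  also have "(mesh n)\<^sup>2 = 2 * tstep n * (mesh n * slope n)"
    using slope(1)[of n] by (simp add: tstep_def power2_eq_square)
  also have "2 * tstep n * mesh n * slope n * K = 2 * tstep n * (mesh n * slope n) * K" by simp
  also have "mesh n * slope n = eps n" using slope(1)[of n] by (simp add: mesh_def)
  finally show ?thesis by (simp add: algebra_simps)
qed

text \<open>The Lipschitz rate in time of the pairing with a test function whose C11 constant is 1: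
  the flux bound plus the consistency error, estimated with \<open>eps n <= 1\<close>.\<close>

definition Lam :: real where "Lam = (M + 1) * V + 10 * M"

lemma F_step_lip:
  assumes \<phi>: "C11 K \<phi> E" "\<And>x. \<bar>\<phi> x\<bar> \<le> B" and E: "E \<in> borel_measurable borel"
  shows "dist (\<integral>x. F n (Suc k) x * \<phi> x \<partial>lborel) (\<integral>x. F n k x * \<phi> x \<partial>lborel) \<le> tstep n * (Lam * K)"
proof -
  have K: "0 \<le> K" using C11D(3)[OF \<phi>(1)] .
  have "\<bar>tstep n * flux c b (eps n) (F n k) (Z n k) E\<bar> \<le> tstep n * ((M + 1) * V * K)"
    unfolding abs_mult using flux_bound[OF F_bdd eps(3) E C11D(1)[OF \<phi>(1)]] tstep(1)[of n] by (simp add: mult_left_mono)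
  moreover have "tstep n * (10 * M * K * eps n) \<le> tstep n * (10 * M * K * 1)"
    using tstep(1)[of n] eps(2)[of n] M0 K by (intro mult_left_mono) auto
  ultimately have "dist (\<integral>x. F n (Suc k) x * \<phi> x \<partial>lborel) (\<integral>x. F n k x * \<phi> x \<partial>lborel) \<le> tstep n * ((M + 1) * V * K) + tstep n * (10 * M * K * 1)"
    using F_step[OF assms, of n k] unfolding dist_real_def by linarith
  also have "\<dots> = tstep n * (Lam * K)" by (simp add: Lam_def algebra_simps)
  finally show ?thesis .
qed

lemma Z_step: "dist (Z n (Suc k)) (Z n k) \<le> tstep n * V"
  using vel_bound[OF F_bdd[of n k] eps(3)[of n], of "Z n k"] tstep(1)[of n] by (simp add: dist_norm mult_left_mono)

section \<open>Interpolation in time and extraction of a subsequence\<close>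

definition tindex :: "nat \<Rightarrow> real \<Rightarrow> nat" where "tindex n t = nat \<lfloor>t / tstep n\<rfloor>"
definition approx :: "nat \<Rightarrow> real \<Rightarrow> real^2 \<Rightarrow> real" where "approx n t = F n (tindex n t)"
definition track :: "nat \<Rightarrow> real \<Rightarrow> real^2" where "track n t = Z n (tindex n t)"

lemma tindex_diff:
  assumes "0 \<le> s" "0 \<le> t"
  shows "tstep n * \<bar>real (tindex n s) - real (tindex n t)\<bar> \<le> \<bar>s - t\<bar> + tstep n"
proof -
  have r: "real (tindex n u) = of_int \<lfloor>u / tstep n\<rfloor>" if "0 \<le> u" for u using that tstep(1)[of n] by (simp add: tindex_def)
  have "\<bar>real (tindex n s) - real (tindex n t)\<bar> \<le> \<bar>s / tstep n - t / tstep n\<bar> + 1" unfolding r[OF assms(1)] r[OF assms(2)] by linarith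
  then have "tstep n * \<bar>real (tindex n s) - real (tindex n t)\<bar> \<le> tstep n * (\<bar>s / tstep n - t / tstep n\<bar> + 1)"
    using tstep(1)[of n] by (intro mult_left_mono) auto
  also have "\<dots> = \<bar>s - t\<bar> + tstep n"
  proof -
    have "tstep n * \<bar>s / tstep n - t / tstep n\<bar> = \<bar>tstep n * (s / tstep n - t / tstep n)\<bar>" using tstep(1)[of n] by (simp add: abs_mult)
    also have "tstep n * (s / tstep n - t / tstep n) = s - t" using tstep(1)[of n] by (simp add: field_simps)
    finally show ?thesis by (simp add: distrib_left)
  qed
  finally show ?thesis .
qed

lemma tindex_on: 
  assumes "real k * tstep n \<le> t" "t < real (Suc k) * tstep n" shows "tindex n t = k"
proof -
  have "\<lfloor>t / tstep n\<rfloor> = int k" using assms tstep(1)[of n] by (intro floor_unique) (auto simp: field_simps)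
  then show ?thesis by (simp add: tindex_def)
qed

lemma approx_bdd: "bdd_L1 C M (approx n t)" unfolding approx_def by (rule F_bdd)

lemma approx_powr: "1 \<le> p \<Longrightarrow> (\<integral>\<^sup>+x. ennreal (\<bar>approx n t x\<bar> powr p) \<partial>lborel) \<le> (\<integral>\<^sup>+x. ennreal (\<bar>f0 x\<bar> powr p) \<partial>lborel)"
  unfolding approx_def by (rule F_powr)

lemma approx_equicont:
  assumes \<phi>: "C11 K \<phi> E" "\<And>x. \<bar>\<phi> x\<bar> \<le> B" and E: "E \<in> borel_measurable borel" and state: "0 \<le> s" "0 \<le> t"
  shows "dist (\<integral>x. approx n s x * \<phi> x \<partial>lborel) (\<integral>x. approx n t x * \<phi> x \<partial>lborel) \<le> (Lam * K) * (\<bar>s - t\<bar> + tstep n)"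
proof -
  have "dist (\<integral>x. approx n s x * \<phi> x \<partial>lborel) (\<integral>x. approx n t x * \<phi> x \<partial>lborel) \<le> tstep n * (Lam * K) * \<bar>real (tindex n s) - real (tindex n t)\<bar>"
    unfolding approx_def by (rule dist_discrete_lipschitz) (rule F_step_lip[OF \<phi> E])
  also have "\<dots> = (Lam * K) * (tstep n * \<bar>real (tindex n s) - real (tindex n t)\<bar>)" by simp
  also have "\<dots> \<le> (Lam * K) * (\<bar>s - t\<bar> + tstep n)"
    using tindex_diff[OF state] C11D(3)[OF \<phi>(1)] M0 V0 by (intro mult_left_mono) (auto simp: Lam_def)
  finally show ?thesis .
qed

lemma track_equicont:
  assumes state: "0 \<le> s" "0 \<le> t"
  shows "dist (track n s) (track n t) \<le> V * (\<bar>s - t\<bar> + tstep n)"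
proof -
  have "dist (track n s) (track n t) \<le> tstep n * V * \<bar>real (tindex n s) - real (tindex n t)\<bar>"
    unfolding track_def by (rule dist_discrete_lipschitz) (rule Z_step)
  also have "\<dots> = V * (tstep n * \<bar>real (tindex n s) - real (tindex n t)\<bar>)" by simp
  also have "\<dots> \<le> V * (\<bar>s - t\<bar> + tstep n)" using tindex_diff[OF state] V0 by (intro mult_left_mono)
  finally show ?thesis .
qed

text \<open>\<open>C11\<close> does not ask the gradient to be measurable; this is recovered from
  difference quotients with increments 1/(n+1).\<close>

lemma bump_grad_borel: "C11 K \<phi> E \<Longrightarrow> E \<in> borel_measurable borel" for \<phi> :: "real^2 \<Rightarrow> real"
proof -
  assume \<phi>: "C11 K \<phi> E"
  have "E x = (\<Sum>i\<in>Basis. (E x \<bullet> i) *\<^sub>R i)" for x by (simp add: euclidean_representation)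
  moreover have "(\<lambda>x. E x \<bullet> i) \<in> borel_measurable borel" for i
  proof (rule borel_measurable_LIMSEQ_real)
    have d: "((\<lambda>s. \<phi> (x + s *\<^sub>R i)) has_real_derivative E x \<bullet> i) (at 0)" for x
    proof -
      have "((\<lambda>s. \<phi> (x + s *\<^sub>R i)) has_derivative (\<lambda>s. E x \<bullet> (s *\<^sub>R i))) (at 0)"
        by (rule has_derivative_compose[of "\<lambda>s. x + s *\<^sub>R i" "\<lambda>s. s *\<^sub>R i" 0 UNIV \<phi> "\<lambda>h. E x \<bullet> h"])
          (auto intro!: derivative_eq_intros C11_has_derivative[OF \<phi>])
      moreover have "(\<lambda>s. E x \<bullet> (s *\<^sub>R i)) = (*) (E x \<bullet> i)" by (auto simp: mult.commute)
      ultimately show ?thesis by (simp add: has_field_derivative_def)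
    qed
    show "(\<lambda>n. (\<phi> (x + inverse (real (Suc n)) *\<^sub>R i) - \<phi> x) / inverse (real (Suc n))) \<longlonglongrightarrow> E x \<bullet> i" for x
    proof -
      have "((\<lambda>h. (\<phi> (x + h *\<^sub>R i) - \<phi> x) / h) \<longlongrightarrow> E x \<bullet> i) (at 0)"
        using d[of x] by (simp add: has_field_derivative_iff)
      moreover have "filterlim (\<lambda>n. inverse (real (Suc n))) (at 0) sequentially"
        unfolding filterlim_at by (auto intro: LIMSEQ_inverse_real_of_nat always_eventually simp del: of_nat_Suc)
      ultimately show ?thesis by (rule filterlim_compose)
    qed
    show "(\<lambda>x. (\<phi> (x + inverse (real (Suc n)) *\<^sub>R i) - \<phi> x) / inverse (real (Suc n))) \<in> borel_measurable borel" for n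
      using C11_borel[OF \<phi>] by measurable
  qed
  ultimately show ?thesis by (subst borel_measurable_euclidean_space) auto
qed

text \<open>Two successive diagonal subsequences: rational times against rational bumps, then
  rational times against the coordinates of the track. Equicontinuity reaches the other times and
  density the other test functions, so one subsequence serves at every time.\<close>

lemma extraction:
  obtains r \<theta> z where "strict_mono (r :: nat \<Rightarrow> nat)" "(\<lambda>(t, x). \<theta> t x) \<in> borel_measurable lebesgue"
    "\<And>t. 0 \<le> t \<Longrightarrow> bdd_L1 C M (\<theta> t)"
    "\<And>t \<phi>. 0 \<le> t \<Longrightarrow> integrable lborel \<phi> \<Longrightarrow> (\<lambda>n. \<integral>x. approx (r n) t x * \<phi> x \<partial>lborel) \<longlonglongrightarrow> (\<integral>x. \<theta> t x * \<phi> x \<partial>lborel)"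
    "\<And>t. 0 \<le> t \<Longrightarrow> (\<lambda>n. track (r n) t) \<longlonglongrightarrow> z t"
    "\<And>t p. 0 \<le> t \<Longrightarrow> 1 \<le> p \<Longrightarrow> (\<integral>\<^sup>+x. ennreal (\<bar>\<theta> t x\<bar> powr p) \<partial>lborel) \<le> (\<integral>\<^sup>+x. ennreal (\<bar>f0 x\<bar> powr p) \<partial>lborel)"
proof -
  define Q where "Q = {q::real. q \<in> \<rat> \<and> 0 \<le> q}"
  have Qc: "countable Q" unfolding Q_def using countable_rat by (rule countable_subset[rotated]) auto
  define S where "S = {a::real^2. \<forall>i\<in>Basis. a \<bullet> i \<in> \<rat>}"
  have Sc: "countable S" unfolding S_def by (rule countable_rational_points)
  have "\<exists>r::nat\<Rightarrow>nat. strict_mono r \<and> (\<forall>i\<in>Q \<times> UNIV \<times> S \<times> S. convergent (\<lambda>n. case i of (q, k, a, b) \<Rightarrow> \<integral>x. approx (r n) q x * bump k a b x \<partial>lborel))"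
  proof (rule diagonal_extraction)
    show "countable (Q \<times> (UNIV :: nat set) \<times> S \<times> S)" using Qc Sc by auto
    fix i :: "real \<times> nat \<times> (real^2) \<times> (real^2)"
    obtain q k a b where i: "i = (q, k, a, b)" by (cases i)
    show "bounded (range (\<lambda>n. case i of (q, k, a, b) \<Rightarrow> \<integral>x. approx n q x * bump k a b x \<partial>lborel))"
    proof (rule boundedI)
      fix y assume "y \<in> range (\<lambda>n. case i of (q, k, a, b) \<Rightarrow> \<integral>x. approx n q x * bump k a b x \<partial>lborel)"
      then obtain n where y: "y = (\<integral>x. approx n q x * bump k a b x \<partial>lborel)" by (auto simp: i)
      show "norm y \<le> C * (\<integral>x. \<bar>bump k a b x\<bar> \<partial>lborel)"
        unfolding y real_norm_def by (rule integral_bounded_mult_le[OF bdd_L1D(1,2)[OF approx_bdd] bump_integrable])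
    qed
  qed
  then obtain r1 :: "nat \<Rightarrow> nat" where r1: "strict_mono r1"
    and c1: "\<And>q k a b. q \<in> Q \<Longrightarrow> a \<in> S \<Longrightarrow> b \<in> S \<Longrightarrow> convergent (\<lambda>n. \<integral>x. approx (r1 n) q x * bump k a b x \<partial>lborel)"
    by fastforce
  have "\<exists>r::nat\<Rightarrow>nat. strict_mono r \<and> (\<forall>i\<in>Q \<times> Basis. convergent (\<lambda>n. track (r1 (r n)) (fst i) \<bullet> snd i))"
  proof (rule diagonal_extraction)
    show "countable (Q \<times> (Basis :: (real^2) set))" using Qc by (auto simp: countable_finite)
    fix i :: "real \<times> (real^2)" assume "i \<in> Q \<times> Basis"
    then obtain q j where i: "i = (q, j)" "0 \<le> q" "j \<in> Basis" by (auto simp: Q_def)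
    show "bounded (range (\<lambda>n. track (r1 n) (fst i) \<bullet> snd i))"
    proof (rule boundedI)
      fix y assume "y \<in> range (\<lambda>n. track (r1 n) (fst i) \<bullet> snd i)"
      then obtain n where y: "y = track (r1 n) q \<bullet> j" by (auto simp: i)
      have "norm y \<le> norm (track (r1 n) q)" unfolding y using Basis_le_norm[OF i(3)] by simp
      also have "\<dots> \<le> norm (track (r1 n) 0) + dist (track (r1 n) q) (track (r1 n) 0)"
        using norm_triangle_ineq2[of "track (r1 n) q" "track (r1 n) 0"] by (simp add: dist_norm)
      also have "\<dots> \<le> norm z0 + V * (\<bar>q - 0\<bar> + tstep (r1 n))"
        using track_equicont[of q 0 "r1 n"] i(2) by (simp add: track_def tindex_def)
      also have "\<dots> \<le> norm z0 + V * (q + 1)"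
        using i(2) tstep(2)[of "r1 n"] eps(2)[of "r1 n"] V0 by (intro add_left_mono mult_left_mono) auto
      finally show "norm y \<le> norm z0 + V * (q + 1)" .
    qed
  qed
  then obtain r2 :: "nat \<Rightarrow> nat" where r2: "strict_mono r2"
    and c2: "\<And>q j. q \<in> Q \<Longrightarrow> j \<in> Basis \<Longrightarrow> convergent (\<lambda>n. track (r1 (r2 n)) q \<bullet> j)" by fastforce
  define r where "r = r1 \<circ> r2"
  have r: "strict_mono r" unfolding r_def by (rule strict_mono_o[OF r1 r2])
  have hr: "(\<lambda>n. tstep (r n)) \<longlonglongrightarrow> 0" using LIMSEQ_subseq_LIMSEQ[OF tstep_lim r] by (simp add: o_def)
  have cb: "convergent (\<lambda>n. \<integral>x. approx (r n) t x * bump k a b x \<partial>lborel)" if t: "0 \<le> t" and ab: "rational_box a b" for t k a b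
  proof -
    obtain K E where KE: "C11 K (bump k a b) E" using C11_bump by blast
    have B: "\<bar>bump k a b x\<bar> \<le> 1" for x using bump_bounds[of k a b x] by simp
    show ?thesis
    proof (rule convergent_equicontinuous[OF _ hr _ t])
      show "dist (\<integral>x. approx (r n) s x * bump k a b x \<partial>lborel) (\<integral>x. approx (r n) t x * bump k a b x \<partial>lborel) \<le> (Lam * K) * (\<bar>s - t\<bar> + tstep (r n))"
        if "0 \<le> s" "0 \<le> t" for n s t by (rule approx_equicont[OF KE B bump_grad_borel[OF KE] that])
      fix q :: real assume "q \<in> \<rat>" "0 \<le> q"
      then have "convergent (\<lambda>n. \<integral>x. approx (r1 n) q x * bump k a b x \<partial>lborel)"
        using c1 ab by (auto simp: Q_def S_def rational_box_def)
      from convergent_subseq_convergent[OF this r2]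
      show "convergent (\<lambda>n. \<integral>x. approx (r n) q x * bump k a b x \<partial>lborel)" by (simp add: o_def r_def)
    qed
  qed
  have cth: "convergent (\<lambda>n. \<integral>x. approx (r n) t x * \<phi> x \<partial>lborel)" if "0 \<le> t" "integrable lborel \<phi>" for t \<phi>
    by (rule weak_convergent_bump[OF bdd_L1D(1,2)[OF approx_bdd] cb[OF that(1)] that(2)])
  have cz: "convergent (\<lambda>n. track (r n) t)" if t: "0 \<le> t" for t
  proof (rule convergent_equicontinuous[OF _ hr _ t])
    show "dist (track (r n) s) (track (r n) t) \<le> V * (\<bar>s - t\<bar> + tstep (r n))" if "0 \<le> s" "0 \<le> t" for n s t
      by (rule track_equicont[OF that])
    fix q :: real assume "q \<in> \<rat>" "0 \<le> q"
    then have "\<forall>j\<in>Basis. \<exists>l. (\<lambda>n. track (r n) q \<bullet> j) \<longlonglongrightarrow> l"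
      using c2[of q] by (auto simp: Q_def r_def convergent_def)
    then obtain l where l: "\<And>j. j \<in> Basis \<Longrightarrow> (\<lambda>n. track (r n) q \<bullet> j) \<longlonglongrightarrow> l j" by metis
    have "(\<lambda>n. track (r n) q) \<longlonglongrightarrow> (\<Sum>j\<in>Basis. l j *\<^sub>R j)"
      by (subst tendsto_componentwise_iff) (use l in auto)
    then show "convergent (\<lambda>n. track (r n) q)" by (rule convergentI)
  qed
  \<comment> \<open>Extended by 0 to negative times, so that the measurability lemma can be applied
    on the whole of space-time.\<close>
  define f where "f n p = (if 0 \<le> fst p then approx (r n) (fst p) (snd p) else 0)" for n and p :: "real \<times> (real^2)"
  have fm: "f n \<in> borel_measurable borel" for n
  proof -
    have F: "(\<lambda>p. F (r n) k (snd p)) \<in> borel_measurable (borel :: (real \<times> (real^2)) measure)" for k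
      using bdd_L1D(1)[OF F_bdd, of "r n" k] unfolding borel_prod[symmetric] by measurable
    have k: "(\<lambda>p::real \<times> (real^2). tindex (r n) (fst p)) \<in> borel \<rightarrow>\<^sub>M count_space UNIV"
      unfolding tindex_def borel_prod[symmetric] by measurable
    have "(\<lambda>p. approx (r n) (fst p) (snd p)) \<in> borel_measurable (borel :: (real \<times> (real^2)) measure)"
      unfolding approx_def using measurable_compose_countable[OF F k] .
    then show ?thesis unfolding f_def[abs_def] borel_prod[symmetric] by measurable
  qed
  have fC: "\<bar>f n p\<bar> \<le> C" for n p using bdd_L1D(2)[OF approx_bdd] C0 by (simp add: f_def)
  have "\<exists>g. g \<in> borel_measurable borel \<and> (\<forall>x. \<bar>g x\<bar> \<le> C) \<and>
      (\<forall>\<phi>. integrable lborel \<phi> \<longrightarrow> (\<lambda>n. \<integral>x. f n (t, x) * \<phi> x \<partial>lborel) \<longlonglongrightarrow> (\<integral>x. g x * \<phi> x \<partial>lborel))" for t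
  proof (cases "0 \<le> t")
    case True
    then have ft: "f n (t, x) = approx (r n) t x" for n x by (simp add: f_def)
    show ?thesis unfolding ft by (rule weak_limit_ex[OF bdd_L1D(1,2)[OF approx_bdd] cth[OF True]])
  next
    case False
    then show ?thesis by (intro exI[of _ "\<lambda>x. 0"]) (use C0 in \<open>auto simp: f_def\<close>)
  qed
  then have "\<forall>t. \<exists>g. g \<in> borel_measurable borel \<and> (\<forall>x. \<bar>g x\<bar> \<le> C) \<and>
      (\<forall>\<phi>. integrable lborel \<phi> \<longrightarrow> (\<lambda>n. \<integral>x. f n (t, x) * \<phi> x \<partial>lborel) \<longlonglongrightarrow> (\<integral>x. g x * \<phi> x \<partial>lborel))" by (rule allI)
  from choice[OF this] obtain g where weak: "\<forall>t. g t \<in> borel_measurable borel \<and> (\<forall>x. \<bar>g t x\<bar> \<le> C) \<and>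
      (\<forall>\<phi>. integrable lborel \<phi> \<longrightarrow> (\<lambda>n. \<integral>x. f n (t, x) * \<phi> x \<partial>lborel) \<longlonglongrightarrow> (\<integral>x. g t x * \<phi> x \<partial>lborel))"
    by (elim exE)
  then have g: "\<And>t. g t \<in> borel_measurable borel" "\<And>t x. \<bar>g t x\<bar> \<le> C"
      "\<And>t \<phi>. integrable lborel \<phi> \<Longrightarrow> (\<lambda>n. \<integral>x. f n (t, x) * \<phi> x \<partial>lborel) \<longlonglongrightarrow> (\<integral>x. g t x * \<phi> x \<partial>lborel)"
    by (simp_all only:)
  \<comment> \<open>The replacement keeps all pairings at every time, hence the weak convergence
    obtained so far.\<close>
  obtain \<theta> where \<theta>: "(\<lambda>(t, x). \<theta> t x) \<in> borel_measurable lebesgue"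
    "\<And>t. \<theta> t \<in> borel_measurable borel" "\<And>t x. \<bar>\<theta> t x\<bar> \<le> C"
    "\<And>t \<phi>. integrable lborel \<phi> \<Longrightarrow> (\<integral>x. \<theta> t x * \<phi> x \<partial>lborel) = (\<integral>x. g t x * \<phi> x \<partial>lborel)"
    using jointly_measurable_version[OF fm fC g] by auto
  have wl: "(\<lambda>n. \<integral>x. approx (r n) t x * \<phi> x \<partial>lborel) \<longlonglongrightarrow> (\<integral>x. \<theta> t x * \<phi> x \<partial>lborel)" if "0 \<le> t" "integrable lborel \<phi>" for t \<phi>
    using g(3)[OF that(2), of t] that(1) \<theta>(4)[OF that(2), of t] by (simp add: f_def)
  have powr: "(\<integral>\<^sup>+x. ennreal (\<bar>\<theta> t x\<bar> powr p) \<partial>lborel) \<le> (\<integral>\<^sup>+x. ennreal (\<bar>f0 x\<bar> powr p) \<partial>lborel)" if "0 \<le> t" "1 \<le> p" for t p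
    by (rule weak_limit_powr_le[OF bdd_L1D(1,2)[OF approx_bdd] \<theta>(2,3) wl[OF that(1)] that(2) approx_powr[OF that(2)]])
  have bdd: "bdd_L1 C M (\<theta> t)" if t: "0 \<le> t" for t
  proof -
    have f0i: "(\<integral>\<^sup>+x. ennreal \<bar>f0 x\<bar> \<partial>lborel) = ennreal (\<integral>x. \<bar>f0 x\<bar> \<partial>lborel)"
      by (rule nn_integral_eq_integral) (use bdd_L1D(3)[OF f0] in auto)
    have le: "(\<integral>\<^sup>+x. ennreal \<bar>\<theta> t x\<bar> \<partial>lborel) \<le> ennreal (\<integral>x. \<bar>f0 x\<bar> \<partial>lborel)"
      using powr[OF t, of 1] f0i by simp
    have i: "integrable lborel (\<theta> t)"
      by (rule integrableI_bounded) (use \<theta>(2) le_less_trans[OF le ennreal_less_top] in auto)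
    have "(\<integral>\<^sup>+x. ennreal \<bar>\<theta> t x\<bar> \<partial>lborel) = ennreal (\<integral>x. \<bar>\<theta> t x\<bar> \<partial>lborel)"
      by (rule nn_integral_eq_integral) (use i in auto)
    then have "(\<integral>x. \<bar>\<theta> t x\<bar> \<partial>lborel) \<le> (\<integral>x. \<bar>f0 x\<bar> \<partial>lborel)" using le by simp
    then show ?thesis unfolding bdd_L1_def using \<theta>(2,3) i bdd_L1D(4)[OF f0] by auto
  qed
  show ?thesis
  proof (rule that[OF r \<theta>(1) bdd wl _ powr])
    show "(\<lambda>n. track (r n) t) \<longlonglongrightarrow> lim (\<lambda>n. track (r n) t)" if "0 \<le> t" for t
      using cz[OF that] by (simp add: convergent_LIMSEQ_iff)
  qed
qed

end

section \<open>From one-step identities to limits of time integrals\<close>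

text \<open>On each step the increment of \<open>A\<close>, divided by \<open>h\<close>, is within
  \<open>e\<close> of every value of \<open>f\<close> there, hence of its average. Used with
  \<open>e = 0\<close> for the vortex and with \<open>e = defect n\<close> for the
  vorticity.\<close>

lemma telescoping_integral:
  fixes f :: "real \<Rightarrow> 'a::euclidean_space" and A :: "nat \<Rightarrow> 'a"
  assumes h: "0 < h" and f: "set_integrable lborel {0..<real N * h} f"
    and step: "\<And>k \<tau>. k < N \<Longrightarrow> real k * h \<le> \<tau> \<Longrightarrow> \<tau> < real (Suc k) * h \<Longrightarrow> norm (A (Suc k) - A k - h *\<^sub>R f \<tau>) \<le> h * e"
  shows "norm (A N - A 0 - (LINT \<tau>:{0..<real N * h}|lborel. f \<tau>)) \<le> real N * h * e"
  using f step
proof (induction N)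
  case 0
  then show ?case by (simp add: set_lebesgue_integral_def)
next
  case (Suc N)
  define p q where "p = real N * h" and "q = real (Suc N) * h"
  have q: "q = p + h" and p0: "0 \<le> p" using h by (auto simp: p_def q_def algebra_simps)
  let ?I = "{0..<p}" and ?J = "{p..<q}"
  have un: "{0..<q} = ?I \<union> ?J" using h q p0 by auto
  have fS: "set_integrable lborel {0..<q} f" using Suc.prems(1) by (simp only: q_def)
  have fI: "set_integrable lborel ?I f" and fJ: "set_integrable lborel ?J f"
    using fS unfolding un by (auto intro: set_integrable_subset)
  have I: "norm (A N - A 0 - (LINT \<tau>:?I|lborel. f \<tau>)) \<le> p * e"
    unfolding p_def by (rule Suc.IH[OF fI[unfolded p_def]]) (use Suc.prems(2) in auto)
  have add: "(LINT \<tau>:{0..<q}|lborel. f \<tau>) = (LINT \<tau>:?I|lborel. f \<tau>) + (LINT \<tau>:?J|lborel. f \<tau>)"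
    unfolding un by (rule set_integral_Un[OF _ fI fJ]) auto
  have mJ: "measure lborel ?J = h" using h q by simp
  have eJ: "emeasure lborel ?J < \<infinity>" using h q by simp
  have ci: "set_integrable lborel ?J (\<lambda>\<tau>. v)" for v :: 'a
    unfolding set_integrable_def by (rule integrable_scaleR_left, rule integrable_real_indicator) (use eJ in auto)
  define v where "v = (1 / h) *\<^sub>R (A (Suc N) - A N)"
  have hv: "h *\<^sub>R v = A (Suc N) - A N" using h by (simp add: v_def)
  have 1: "(LINT \<tau>:?J|lborel. v - f \<tau>) = h *\<^sub>R v - (LINT \<tau>:?J|lborel. f \<tau>)"
  proof -
    have "(LINT \<tau>:?J|lborel. v) = (\<integral>\<tau>. indicator ?J \<tau> \<partial>lborel) *\<^sub>R v"
      unfolding set_lebesgue_integral_def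
      by (rule integral_scaleR_left) (use eJ in \<open>auto intro!: integrable_real_indicator\<close>)
    also have "(\<integral>\<tau>. indicator ?J \<tau> \<partial>lborel) = h" using mJ by simp
    finally show ?thesis using set_integral_diff(2)[OF ci[of v] fJ] by simp
  qed
  have 2: "norm (LINT \<tau>:?J|lborel. v - f \<tau>) \<le> (LINT \<tau>|lborel. indicator ?J \<tau> * e)"
    unfolding set_lebesgue_integral_def
  proof (rule order_trans[OF integral_norm_bound integral_mono])
    show "integrable lborel (\<lambda>\<tau>. norm (indicator ?J \<tau> *\<^sub>R (v - f \<tau>)))"
      using set_integral_diff(1)[OF ci fJ] unfolding set_integrable_def by (rule integrable_norm)
    show "integrable lborel (\<lambda>\<tau>. indicator ?J \<tau> * e)"
      by (intro integrable_mult_left integrable_real_indicator) (use eJ in auto)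
    fix \<tau>
    show "norm (indicator ?J \<tau> *\<^sub>R (v - f \<tau>)) \<le> indicator ?J \<tau> * e"
    proof (cases "\<tau> \<in> ?J")
      case True
      have "h * norm (v - f \<tau>) = norm (h *\<^sub>R (v - f \<tau>))" using h by simp
      also have "\<dots> = norm (A (Suc N) - A N - h *\<^sub>R f \<tau>)" by (simp add: scaleR_diff_right hv)
      also have "\<dots> \<le> h * e" using Suc.prems(2)[of N \<tau>] True by (simp add: p_def q_def)
      finally have "norm (v - f \<tau>) \<le> e" using h by simp
      then show ?thesis using True by simp
    qed simp
  qed
  have "(LINT \<tau>|lborel. indicator ?J \<tau> * e) = h * e" using mJ by simp
  then have J: "norm (A (Suc N) - A N - (LINT \<tau>:?J|lborel. f \<tau>)) \<le> h * e" using 1 2 by (simp only: hv)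
  have "A (Suc N) - A 0 - (LINT \<tau>:{0..<q}|lborel. f \<tau>) =
     (A N - A 0 - (LINT \<tau>:?I|lborel. f \<tau>)) + (A (Suc N) - A N - (LINT \<tau>:?J|lborel. f \<tau>))"
    unfolding add by simp
  then have "norm (A (Suc N) - A 0 - (LINT \<tau>:{0..<q}|lborel. f \<tau>)) \<le> p * e + h * e"
    using norm_triangle_le[OF add_mono[OF I J]] by (simp only:)
  also have "\<dots> = q * e" by (simp add: q distrib_right)
  finally show ?case by (simp only: q_def)
qed

locale limit_solution = scheme c b C M f0 z0 for c b C M f0 z0 +
  fixes r :: "nat \<Rightarrow> nat" and \<theta> :: "real \<Rightarrow> real^2 \<Rightarrow> real" and z :: "real \<Rightarrow> real^2"
  assumes r: "strict_mono r"
    and \<theta>: "\<And>t. 0 \<le> t \<Longrightarrow> bdd_L1 C M (\<theta> t)"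
    and lim: "\<And>t \<phi>. 0 \<le> t \<Longrightarrow> integrable lborel \<phi> \<Longrightarrow> (\<lambda>n. \<integral>x. approx (r n) t x * \<phi> x \<partial>lborel) \<longlonglongrightarrow> (\<integral>x. \<theta> t x * \<phi> x \<partial>lborel)"
    and z: "\<And>t. 0 \<le> t \<Longrightarrow> (\<lambda>n. track (r n) t) \<longlonglongrightarrow> z t"
begin

lemma eps_r: "(\<lambda>n. eps (r n)) \<longlonglongrightarrow> 0" and tstep_r: "(\<lambda>n. tstep (r n)) \<longlonglongrightarrow> 0"
  using LIMSEQ_subseq_LIMSEQ[OF eps_lim r] LIMSEQ_subseq_LIMSEQ[OF tstep_lim r] by (simp_all add: o_def)

lemma tindex_measurable [measurable]: "tindex n \<in> borel \<rightarrow>\<^sub>M count_space UNIV"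
  unfolding tindex_def by measurable

lemma tindex_fst_measurable: "(\<lambda>p::real \<times> (real^2). tindex n (fst p)) \<in> borel \<rightarrow>\<^sub>M count_space UNIV"
  unfolding borel_prod[symmetric] by measurable

lemma approx_pair: "(\<lambda>p. approx n (fst p) (snd p)) \<in> borel_measurable (borel :: (real \<times> (real^2)) measure)"
proof -
  have F: "(\<lambda>p. F n k (snd p)) \<in> borel_measurable (borel :: (real \<times> (real^2)) measure)" for k
    using bdd_L1D(1)[OF F_bdd, of n k] unfolding borel_prod[symmetric] by measurable
  show ?thesis unfolding approx_def using measurable_compose_countable[OF F tindex_fst_measurable] .
qed

lemma vel_pair: "(\<lambda>p. vel c b (eps n) (approx n (fst p)) (snd p)) \<in> borel_measurable (borel :: (real \<times> (real^2)) measure)"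
proof -
  have F: "(\<lambda>p. vel c b (eps n) (F n k) (snd p)) \<in> borel_measurable (borel :: (real \<times> (real^2)) measure)" for k
    using vel_borel[OF bdd_L1D(1)[OF F_bdd], of c b "eps n" n k] unfolding borel_prod[symmetric] by measurable
  show ?thesis unfolding approx_def using measurable_compose_countable[OF F tindex_fst_measurable] .
qed

lemma track_borel: "track n \<in> borel_measurable borel"
  unfolding track_def using measurable_compose_countable[OF borel_measurable_const tindex_measurable] .

lemma V_borel: "(\<lambda>\<tau>. vel c b (eps n) (approx n \<tau>) (track n \<tau>)) \<in> borel_measurable borel"
proof -
  have "(\<lambda>\<tau>. (\<lambda>k \<tau>. vel c b (eps n) (F n k) (Z n k)) (tindex n \<tau>) \<tau>) \<in> borel_measurable borel"
    by (rule measurable_compose_countable[OF borel_measurable_const tindex_measurable])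
  then show ?thesis by (simp add: approx_def track_def)
qed

lemma vel_limit:
  assumes "0 \<le> t" "x \<longlonglongrightarrow> x0"
  shows "(\<lambda>n. vel c b (eps (r n)) (approx (r n) t) (x n)) \<longlonglongrightarrow> vel c b 0 (\<theta> t) x0"
  by (rule vel_converges[OF approx_bdd \<theta>[OF assms(1)] lim[OF assms(1)] eps(3) eps_r assms(2)])

lemma floor_mult:
  assumes "0 \<le> t"
  shows "real (tindex n t) * tstep n \<le> t" "t < real (tindex n t) * tstep n + tstep n"
proof -
  have r: "real (tindex n t) = of_int \<lfloor>t / tstep n\<rfloor>" using assms tstep(1)[of n] by (simp add: tindex_def)
  have "of_int \<lfloor>t / tstep n\<rfloor> * tstep n \<le> t / tstep n * tstep n"
    by (rule mult_right_mono[OF of_int_floor_le]) (use tstep(1)[of n] in simp)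
  moreover have "t / tstep n * tstep n < (of_int \<lfloor>t / tstep n\<rfloor> + 1) * tstep n"
    by (rule mult_strict_right_mono[OF _ tstep(1)]) linarith
  moreover have "t / tstep n * tstep n = t" using tstep(1)[of n] by simp
  ultimately show "real (tindex n t) * tstep n \<le> t" "t < real (tindex n t) * tstep n + tstep n"
    unfolding r by (simp_all only: distrib_right mult_1)
qed

text \<open>The limits are controlled at nonnegative times only, hence the cut-off; the function is
  then a pointwise limit of Borel functions.\<close>

lemma velocity_borel: "(\<lambda>\<tau>. indicator {0..} \<tau> *\<^sub>R vel c b 0 (\<theta> \<tau>) (z \<tau>)) \<in> borel_measurable borel"
proof (rule borel_measurable_LIMSEQ_metric)
  show "(\<lambda>\<tau>. indicator {0..} \<tau> *\<^sub>R vel c b (eps (r n)) (approx (r n) \<tau>) (track (r n) \<tau>)) \<in> borel_measurable borel" for n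
    using V_borel by measurable
  show "(\<lambda>n. indicator {0..} \<tau> *\<^sub>R vel c b (eps (r n)) (approx (r n) \<tau>) (track (r n) \<tau>)) \<longlonglongrightarrow> indicator {0..} \<tau> *\<^sub>R vel c b 0 (\<theta> \<tau>) (z \<tau>)" for \<tau>
    by (cases "0 \<le> \<tau>") (auto intro!: vel_limit z)
qed

text \<open>The discrete trajectory satisfies an exact integral equation up to the last grid time
  not exceeding \<open>t\<close>. This time tends to \<open>t\<close>, the velocities converge along
  the moving positions, and the speed bound dominates.\<close>

lemma z_equation:
  assumes t: "0 \<le> t"
  shows "z t = z0 + (LINT \<tau>:{0..t}|lborel. vel c b 0 (\<theta> \<tau>) (z \<tau>))"
proof -
  let ?v = "\<lambda>n \<tau>. vel c b (eps n) (approx n \<tau>) (track n \<tau>)"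
  let ?I = "\<lambda>n. {0..<real (tindex n t) * tstep n}"
  have ti: "integrable lborel (\<lambda>\<tau>. indicator {0..t} \<tau> * V)"
    by (intro integrable_mult_left integrable_real_indicator) (use t in auto)
  have vb: "norm (indicator (?I n) \<tau> *\<^sub>R ?v n \<tau>) \<le> indicator {0..t} \<tau> * V" for n \<tau>
    using vel_bound[OF approx_bdd[of n \<tau>] eps(3)[of n], of "track n \<tau>"] floor_mult(1)[OF t, of n] V0 by (auto simp: indicator_def)
  have vm: "(\<lambda>\<tau>. indicator (?I n) \<tau> *\<^sub>R ?v n \<tau>) \<in> borel_measurable lborel" for n using V_borel by measurable
  have vi: "set_integrable lborel (?I n) (?v n)" for n
    unfolding set_integrable_def
  proof (rule Bochner_Integration.integrable_bound[OF ti vm])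
    show "AE \<tau> in lborel. norm (indicator (?I n) \<tau> *\<^sub>R ?v n \<tau>) \<le> norm (indicator {0..t} \<tau> * V)"
    proof (rule AE_I2)
      fix \<tau> show "norm (indicator (?I n) \<tau> *\<^sub>R ?v n \<tau>) \<le> norm (indicator {0..t} \<tau> * V)"
        using vb[of n \<tau>] unfolding real_norm_def by linarith
    qed
  qed
  have zn: "track n t = z0 + (LINT \<tau>:?I n|lborel. ?v n \<tau>)" for n
  proof -
    \<comment> \<open>The error is 0: the discrete velocity is constant on each step, so the Euler
      update integrates it exactly.\<close>
    have "norm (Z n (tindex n t) - Z n 0 - (LINT \<tau>:?I n|lborel. ?v n \<tau>)) \<le> real (tindex n t) * tstep n * 0"
    proof (rule telescoping_integral[OF tstep(1) vi])
      fix k \<tau> assume "real k * tstep n \<le> \<tau>" "\<tau> < real (Suc k) * tstep n"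
      then have "tindex n \<tau> = k" by (rule tindex_on)
      then show "norm (Z n (Suc k) - Z n k - tstep n *\<^sub>R ?v n \<tau>) \<le> tstep n * 0" by (simp add: approx_def track_def)
    qed
    then show ?thesis by (simp add: track_def algebra_simps)
  qed
  have "(\<lambda>n. LINT \<tau>:?I (r n)|lborel. ?v (r n) \<tau>) \<longlonglongrightarrow> (LINT \<tau>:{0..<t}|lborel. vel c b 0 (\<theta> \<tau>) (z \<tau>))"
    unfolding set_lebesgue_integral_def
  proof (rule integral_dominated_convergence[OF _ vm ti])
    have "(\<lambda>\<tau>. indicator {0..<t} \<tau> *\<^sub>R (indicator {0..} \<tau> *\<^sub>R vel c b 0 (\<theta> \<tau>) (z \<tau>))) \<in> borel_measurable borel"
      using velocity_borel by measurable
    moreover have "(\<lambda>\<tau>. indicator {0..<t} \<tau> *\<^sub>R (indicator {0..} \<tau> *\<^sub>R vel c b 0 (\<theta> \<tau>) (z \<tau>))) = (\<lambda>\<tau>. indicator {0..<t} \<tau> *\<^sub>R vel c b 0 (\<theta> \<tau>) (z \<tau>))"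
      by (auto simp: indicator_def)
    ultimately show "(\<lambda>\<tau>. indicator {0..<t} \<tau> *\<^sub>R vel c b 0 (\<theta> \<tau>) (z \<tau>)) \<in> borel_measurable lborel" by simp
    show "AE \<tau> in lborel. norm (indicator (?I (r n)) \<tau> *\<^sub>R ?v (r n) \<tau>) \<le> indicator {0..t} \<tau> * V" for n
      using vb by (intro AE_I2)
    show "AE \<tau> in lborel. (\<lambda>n. indicator (?I (r n)) \<tau> *\<^sub>R ?v (r n) \<tau>) \<longlonglongrightarrow> indicator {0..<t} \<tau> *\<^sub>R vel c b 0 (\<theta> \<tau>) (z \<tau>)"
    proof (rule AE_I2)
      fix \<tau>
      show "(\<lambda>n. indicator (?I (r n)) \<tau> *\<^sub>R ?v (r n) \<tau>) \<longlonglongrightarrow> indicator {0..<t} \<tau> *\<^sub>R vel c b 0 (\<theta> \<tau>) (z \<tau>)"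
      proof (cases "0 \<le> \<tau> \<and> \<tau> < t")
        case True
        have "\<forall>\<^sub>F n in sequentially. tstep (r n) < t - \<tau>" using order_tendstoD(2)[OF tstep_r] True by simp
        then have "\<forall>\<^sub>F n in sequentially. indicator (?I (r n)) \<tau> *\<^sub>R ?v (r n) \<tau> = ?v (r n) \<tau>"
        proof eventually_elim
          case (elim n)
          then have "\<tau> \<in> ?I (r n)" using floor_mult(2)[OF t, of "r n"] True by auto
          then show ?case by simp
        qed
        moreover have "(\<lambda>n. ?v (r n) \<tau>) \<longlonglongrightarrow> vel c b 0 (\<theta> \<tau>) (z \<tau>)" using True by (intro vel_limit z) auto
        ultimately show ?thesis using True by (simp add: tendsto_cong)
      next
        case False
        then have "\<tau> \<notin> ?I (r n)" for n using floor_mult(1)[OF t, of "r n"] by auto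
        then show ?thesis using False by auto
      qed
    qed
  qed
  then have "(\<lambda>n. track (r n) t) \<longlonglongrightarrow> z0 + (LINT \<tau>:{0..<t}|lborel. vel c b 0 (\<theta> \<tau>) (z \<tau>))"
    unfolding zn by (intro tendsto_intros)
  from LIMSEQ_unique[OF z[OF t] this]
  have "z t = z0 + (LINT \<tau>:{0..<t}|lborel. vel c b 0 (\<theta> \<tau>) (z \<tau>))" .
  also have "(LINT \<tau>:{0..<t}|lborel. vel c b 0 (\<theta> \<tau>) (z \<tau>)) = (LINT \<tau>:{0..t}|lborel. vel c b 0 (\<theta> \<tau>) (z \<tau>))"
    unfolding set_lebesgue_integral_def
  proof (rule integral_cong_AE)
    have e: "(\<lambda>\<tau>. indicator S \<tau> *\<^sub>R (indicator {0..} \<tau> *\<^sub>R vel c b 0 (\<theta> \<tau>) (z \<tau>))) = (\<lambda>\<tau>. indicator S \<tau> *\<^sub>R vel c b 0 (\<theta> \<tau>) (z \<tau>))"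
      if "S \<subseteq> {0..}" for S
    proof (rule ext)
      fix \<tau> show "indicator S \<tau> *\<^sub>R (indicator {0..} \<tau> *\<^sub>R vel c b 0 (\<theta> \<tau>) (z \<tau>)) = indicator S \<tau> *\<^sub>R vel c b 0 (\<theta> \<tau>) (z \<tau>)"
        using that by (cases "\<tau> \<in> S") auto
    qed
    have m: "(\<lambda>\<tau>. indicator S \<tau> *\<^sub>R vel c b 0 (\<theta> \<tau>) (z \<tau>)) \<in> borel_measurable lborel" if [measurable]: "S \<in> sets borel" and "S \<subseteq> {0..}" for S
      unfolding e[OF that(2), symmetric] using velocity_borel by measurable
    show "(\<lambda>\<tau>. indicator {0..<t} \<tau> *\<^sub>R vel c b 0 (\<theta> \<tau>) (z \<tau>)) \<in> borel_measurable lborel"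
      "(\<lambda>\<tau>. indicator {0..t} \<tau> *\<^sub>R vel c b 0 (\<theta> \<tau>) (z \<tau>)) \<in> borel_measurable lborel" by (rule m; auto)+
    show "AE \<tau> in lborel. indicator {0..<t} \<tau> *\<^sub>R vel c b 0 (\<theta> \<tau>) (z \<tau>) = indicator {0..t} \<tau> *\<^sub>R vel c b 0 (\<theta> \<tau>) (z \<tau>)"
      using AE_lborel_singleton[of t] by eventually_elim (auto simp: indicator_def)
  qed
  finally show ?thesis .
qed

lemma z_lipschitz:
  assumes "0 \<le> s" "0 \<le> t"
  shows "dist (z s) (z t) \<le> V * \<bar>s - t\<bar>"
proof (rule LIMSEQ_le[OF tendsto_dist[OF z[OF assms(1)] z[OF assms(2)]]])
  have "(\<lambda>n. V * (\<bar>s - t\<bar> + tstep (r n))) \<longlonglongrightarrow> V * (\<bar>s - t\<bar> + 0)" by (intro tendsto_intros tstep_r)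
  then show "(\<lambda>n. V * (\<bar>s - t\<bar> + tstep (r n))) \<longlonglongrightarrow> V * \<bar>s - t\<bar>" by simp
qed (use track_equicont[OF assms] in auto)

lemma \<theta>_lipschitz:
  assumes \<phi>: "C11 K \<phi> E" "\<And>x. \<bar>\<phi> x\<bar> \<le> B" "integrable lborel \<phi>" and state: "0 \<le> s" "0 \<le> t"
  shows "dist (\<integral>x. \<theta> s x * \<phi> x \<partial>lborel) (\<integral>x. \<theta> t x * \<phi> x \<partial>lborel) \<le> (Lam * K) * \<bar>s - t\<bar>"
proof (rule LIMSEQ_le[OF tendsto_dist[OF lim[OF state(1) \<phi>(3)] lim[OF state(2) \<phi>(3)]]])
  have "(\<lambda>n. (Lam * K) * (\<bar>s - t\<bar> + tstep (r n))) \<longlonglongrightarrow> (Lam * K) * (\<bar>s - t\<bar> + 0)" by (intro tendsto_intros tstep_r)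
  then show "(\<lambda>n. (Lam * K) * (\<bar>s - t\<bar> + tstep (r n))) \<longlonglongrightarrow> (Lam * K) * \<bar>s - t\<bar>" by simp
qed (use approx_equicont[OF \<phi>(1,2) bump_grad_borel[OF \<phi>(1)] state] in auto)

text \<open>In the self-advection term both factors vary. The velocities converge pointwise and are
  bounded, so after multiplication by the integrable field \<open>E\<close> they converge in L^1;
  with the limit velocity in place, weak convergence of the vorticity finishes. The vortex term is
  \<open>kern_inner_converges\<close>.\<close>

lemma flux_limit:
  assumes t: "0 \<le> t" and E: "E \<in> borel_measurable borel" "\<And>x. norm (E x) \<le> K" "integrable lborel E"
  shows "(\<lambda>n. flux c b (eps (r n)) (approx (r n) t) (track (r n) t) E) \<longlonglongrightarrow> flux c b 0 (\<theta> t) (z t) E"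
  unfolding flux_split(2)[OF approx_bdd eps(3) E(1,2)] flux_split(2)[OF \<theta>[OF t] order_refl E(1,2)]
proof (rule tendsto_add)
  show "(\<lambda>n. \<integral>x. approx (r n) t x * (kern c b (eps (r n)) (x - track (r n) t) \<bullet> E x) \<partial>lborel) \<longlonglongrightarrow> (\<integral>x. \<theta> t x * (kern c b 0 (x - z t) \<bullet> E x) \<partial>lborel)"
    by (rule kern_inner_converges[OF approx_bdd \<theta>[OF t] lim[OF t] eps(3) eps_r z[OF t] E])
  let ?w = "vel c b 0 (\<theta> t)" and ?v = "\<lambda>n. vel c b (eps (r n)) (approx (r n) t)"
  have wm[measurable]: "?w \<in> borel_measurable borel" using vel_borel[OF bdd_L1D(1)[OF \<theta>[OF t]]] .
  have vm[measurable]: "?v n \<in> borel_measurable borel" for n using vel_borel[OF bdd_L1D(1)[OF approx_bdd]] .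
  note [measurable] = E(1)
  have Ei: "integrable lborel (\<lambda>x. norm (E x))" using E(3) by (rule integrable_norm)
  have b1: "norm (u \<bullet> E x) \<le> norm u * norm (E x)" for u x using Cauchy_Schwarz_ineq2 by simp
  have wi: "integrable lborel (\<lambda>x. ?w x \<bullet> E x)"
  proof (rule Bochner_Integration.integrable_bound[OF integrable_mult_right[OF Ei, of V]])
    show "AE x in lborel. norm (?w x \<bullet> E x) \<le> norm (V * norm (E x))"
    proof (rule AE_I2)
      fix x
      have "norm (?w x \<bullet> E x) \<le> V * norm (E x)"
        using b1[of "?w x" x] mult_right_mono[OF vel_bound[OF \<theta>[OF t] order_refl, of x] norm_ge_zero[of "E x"]] by linarith
      then show "norm (?w x \<bullet> E x) \<le> norm (V * norm (E x))" unfolding real_norm_def by linarith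
    qed
  qed measurable
  have "(\<lambda>n. C * (\<integral>x. \<bar>(?v n x - ?w x) \<bullet> E x\<bar> \<partial>lborel)) \<longlonglongrightarrow> C * (\<integral>x. 0 \<partial>(lborel::(real^2) measure))"
  proof (intro tendsto_mult_left integral_dominated_convergence[where w="\<lambda>x. 2 * V * norm (E x)"])
    show "integrable lborel (\<lambda>x. 2 * V * norm (E x))" by (rule integrable_mult_right[OF Ei])
    show "(\<lambda>x. \<bar>(?v n x - ?w x) \<bullet> E x\<bar>) \<in> borel_measurable lborel" for n by measurable
    show "AE x in lborel. norm \<bar>(?v n x - ?w x) \<bullet> E x\<bar> \<le> 2 * V * norm (E x)" for n
    proof (rule AE_I2)
      fix x
      have "norm (?v n x - ?w x) \<le> 2 * V"
        using norm_triangle_ineq4[of "?v n x" "?w x"] vel_bound[OF approx_bdd[of "r n" t] eps(3)[of "r n"], of x] vel_bound[OF \<theta>[OF t] order_refl, of x] by linarith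
      then have "norm (?v n x - ?w x) * norm (E x) \<le> 2 * V * norm (E x)" by (rule mult_right_mono) simp
      then show "norm \<bar>(?v n x - ?w x) \<bullet> E x\<bar> \<le> 2 * V * norm (E x)" using b1[of "?v n x - ?w x" x] by simp
    qed
    show "AE x in lborel. (\<lambda>n. \<bar>(?v n x - ?w x) \<bullet> E x\<bar>) \<longlonglongrightarrow> 0"
    proof (rule AE_I2)
      fix x
      have "(\<lambda>n. \<bar>(?v n x - ?w x) \<bullet> E x\<bar>) \<longlonglongrightarrow> \<bar>(?w x - ?w x) \<bullet> E x\<bar>"
        by (intro tendsto_intros vel_limit t)
      then show "(\<lambda>n. \<bar>(?v n x - ?w x) \<bullet> E x\<bar>) \<longlonglongrightarrow> 0" by simp
    qed
  qed simp
  then have 0: "(\<lambda>n. C * (\<integral>x. \<bar>(?v n x - ?w x) \<bullet> E x\<bar> \<partial>lborel)) \<longlonglongrightarrow> 0" by simp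
  have vi: "integrable lborel (\<lambda>x. ?v n x \<bullet> E x)" for n
  proof (rule Bochner_Integration.integrable_bound[OF integrable_mult_right[OF Ei, of V]])
    show "AE x in lborel. norm (?v n x \<bullet> E x) \<le> norm (V * norm (E x))"
    proof (rule AE_I2)
      fix x
      have "norm (?v n x \<bullet> E x) \<le> V * norm (E x)"
        using b1[of "?v n x" x] mult_right_mono[OF vel_bound[OF approx_bdd[of "r n" t] eps(3)[of "r n"], of x] norm_ge_zero[of "E x"]] by linarith
      then show "norm (?v n x \<bullet> E x) \<le> norm (V * norm (E x))" unfolding real_norm_def by linarith
    qed
  qed measurable
  have "(\<lambda>n. (\<integral>x. approx (r n) t x * (?v n x \<bullet> E x) \<partial>lborel) - (\<integral>x. approx (r n) t x * (?w x \<bullet> E x) \<partial>lborel)) \<longlonglongrightarrow> 0"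
  proof (rule Lim_null_comparison[OF always_eventually 0], rule allI)
    fix n
    show "norm ((\<integral>x. approx (r n) t x * (?v n x \<bullet> E x) \<partial>lborel) - (\<integral>x. approx (r n) t x * (?w x \<bullet> E x) \<partial>lborel)) \<le> C * (\<integral>x. \<bar>(?v n x - ?w x) \<bullet> E x\<bar> \<partial>lborel)"
      using integral_mult_diff_le[OF bdd_L1D(1,2)[OF approx_bdd] vi wi] unfolding dist_norm inner_diff_left .
  qed
  from tendsto_add[OF this lim[OF t wi]]
  show "(\<lambda>n. \<integral>x. approx (r n) t x * (?v n x \<bullet> E x) \<partial>lborel) \<longlonglongrightarrow> (\<integral>x. \<theta> t x * (?w x \<bullet> E x) \<partial>lborel)" by simp
qed

end

section \<open>The weak formulation\<close>

text \<open>A test function \<open>\<psi>\<close> together with its time derivative \<open>\<psi>'\<close> and its gradient \<open>G\<close>, the latter two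
  extended by \<open>0\<close> outside \<open>[0, T)\<close>.\<close>

locale test_data =
  fixes T T' L R :: real and \<psi> \<psi>' :: "real \<Rightarrow> real^2 \<Rightarrow> real" and G :: "real \<Rightarrow> real^2 \<Rightarrow> real^2"
  assumes T: "0 < T" and T': "T' < T" and L: "0 \<le> L"
    and space: "\<And>t. 0 \<le> t \<Longrightarrow> t < T \<Longrightarrow> C11 L (\<psi> t) (G t)"
    and bound: "\<And>t x. 0 \<le> t \<Longrightarrow> t < T \<Longrightarrow> \<bar>\<psi> t x\<bar> \<le> L" "\<And>t x. \<bar>\<psi>' t x\<bar> \<le> L"
    and time: "\<And>t \<tau> t' x. 0 \<le> t \<Longrightarrow> t \<le> \<tau> \<Longrightarrow> \<tau> \<le> t' \<Longrightarrow> t' < T \<Longrightarrow> \<bar>\<psi> t' x - \<psi> t x - (t' - t) * \<psi>' \<tau> x\<bar> \<le> L * (t' - t)\<^sup>2"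
    and grad_time: "\<And>t \<tau> x. 0 \<le> t \<Longrightarrow> t < T \<Longrightarrow> 0 \<le> \<tau> \<Longrightarrow> \<tau> < T \<Longrightarrow> norm (G \<tau> x - G t x) \<le> L * \<bar>\<tau> - t\<bar>"
    and outside: "\<And>t x. t < 0 \<or> T \<le> t \<or> T' \<le> t \<or> R \<le> norm x \<Longrightarrow> \<psi>' t x = 0"
      "\<And>t x. t < 0 \<or> T \<le> t \<or> T' \<le> t \<or> R \<le> norm x \<Longrightarrow> G t x = 0"
      "\<And>t x. 0 \<le> t \<Longrightarrow> T' \<le> t \<Longrightarrow> t < T \<Longrightarrow> \<psi> t x = 0"
    and meas: "(\<lambda>p. \<psi>' (fst p) (snd p)) \<in> borel_measurable borel" "(\<lambda>p. G (fst p) (snd p)) \<in> borel_measurable borel"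
begin

lemma section_borel [measurable]: "\<psi>' t \<in> borel_measurable borel" "G t \<in> borel_measurable borel"
proof -
  have p: "(\<lambda>x. (t, x)) \<in> borel \<rightarrow>\<^sub>M (borel :: (real \<times> (real^2)) measure)" unfolding borel_prod[symmetric] by measurable
  show "\<psi>' t \<in> borel_measurable borel" "G t \<in> borel_measurable borel"
    using measurable_compose[OF p meas(1)] measurable_compose[OF p meas(2)] by simp_all
qed

lemma G_bound: "norm (G t x) \<le> L"
  using C11D(1)[OF space, of t x] outside(2)[of t x] L by (cases "0 \<le> t \<and> t < T") auto

lemma integrable_supported:
  fixes u :: "real^2 \<Rightarrow> 'b::{banach,second_countable_topology}"
  assumes "u \<in> borel_measurable borel" "\<And>x. norm (u x) \<le> L" "\<And>x. R \<le> norm x \<Longrightarrow> u x = 0"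
  shows "integrable lborel u"
proof (rule Bochner_Integration.integrable_bound)
  show "integrable lborel (\<lambda>x::real^2. L * indicator (ball 0 R) x)"
    by (intro integrable_mult_right integrable_real_indicator) (use emeasure_lborel_ball_finite[of "0::real^2" R] in simp_all)
  show "AE x in lborel. norm (u x) \<le> norm (L * indicator (ball 0 R) x)"
  proof (rule AE_I2)
    fix x show "norm (u x) \<le> norm (L * indicator (ball 0 R) x)"
      using assms(2)[of x] assms(3)[of x] L by (auto simp: indicator_def not_less)
  qed
qed (use assms(1) in simp)

lemma section_integrable: "integrable lborel (\<psi>' t)" "integrable lborel (G t)"
  by (rule integrable_supported; use bound(2) G_bound outside in auto)+

end

locale weak_form = limit_solution c b C M f0 z0 r \<theta> z + test_data T T' L R \<psi> \<psi>' G
  for c b C M f0 z0 r \<theta> z T T' L R \<psi> \<psi>' G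
begin

definition approx_weak :: "nat \<Rightarrow> real \<Rightarrow> real" where
  "approx_weak n \<tau> = (\<integral>x. approx n \<tau> x * \<psi>' \<tau> x \<partial>lborel) + flux c b (eps n) (approx n \<tau>) (track n \<tau>) (G \<tau>)"

definition weak :: "real \<Rightarrow> real" where
  "weak \<tau> = (\<integral>x. \<theta> \<tau> x * \<psi>' \<tau> x \<partial>lborel) + flux c b 0 (\<theta> \<tau>) (z \<tau>) (G \<tau>)"

lemma approx_weak_borel: "approx_weak n \<in> borel_measurable borel"
proof -
  note prod = borel_prod[symmetric, where 'a=real and 'b="real^2"]
  note m = approx_pair[of n, unfolded prod] vel_pair[of n, unfolded prod] meas[unfolded prod]
  note [measurable] = m track_borel
  have "(\<lambda>(\<tau>, x). approx n \<tau> x) \<in> borel_measurable (borel \<Otimes>\<^sub>M borel)" "(\<lambda>(\<tau>, x). \<psi>' \<tau> x) \<in> borel_measurable (borel \<Otimes>\<^sub>M borel)"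
    "(\<lambda>(\<tau>, x). G \<tau> x) \<in> borel_measurable (borel \<Otimes>\<^sub>M borel)" "(\<lambda>(\<tau>, x). vel c b (eps n) (approx n \<tau>) x) \<in> borel_measurable (borel \<Otimes>\<^sub>M borel)"
    using m by (simp_all add: case_prod_unfold)
  note [measurable] = this
  show ?thesis unfolding approx_weak_def flux_def by measurable
qed

lemma approx_weak_bound: "\<bar>approx_weak n \<tau>\<bar> \<le> L * M + (M + 1) * V * L"
proof -
  have "\<bar>\<integral>x. \<psi>' \<tau> x * approx n \<tau> x \<partial>lborel\<bar> \<le> L * (\<integral>x. \<bar>approx n \<tau> x\<bar> \<partial>lborel)"
    by (rule integral_bounded_mult_le[OF section_borel(1) bound(2) bdd_L1D(3)[OF approx_bdd]])
  also have "\<dots> \<le> L * M" using bdd_L1D(4)[OF approx_bdd] L by (intro mult_left_mono)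
  finally show ?thesis
    using flux_bound[OF approx_bdd[of n \<tau>] eps(3)[of n] section_borel(2)[of \<tau>] G_bound, of "track n \<tau>"] unfolding approx_weak_def by (simp add: mult.commute)
qed

lemma approx_weak_outside: "\<tau> < 0 \<or> T' \<le> \<tau> \<Longrightarrow> approx_weak n \<tau> = 0"
proof -
  assume "\<tau> < 0 \<or> T' \<le> \<tau>"
  then have "\<psi>' \<tau> x = 0" "G \<tau> x = 0" for x using outside by auto
  then show ?thesis by (simp add: approx_weak_def flux_def)
qed

lemma approx_weak_limit: "0 \<le> \<tau> \<Longrightarrow> (\<lambda>n. approx_weak (r n) \<tau>) \<longlonglongrightarrow> weak \<tau>"
  unfolding approx_weak_def weak_def
  by (intro tendsto_add lim flux_limit[OF _ section_borel(2) G_bound section_integrable(2)] section_integrable)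

lemma weak_outside: "\<tau> < 0 \<or> T' \<le> \<tau> \<Longrightarrow> weak \<tau> = 0"
proof -
  assume "\<tau> < 0 \<or> T' \<le> \<tau>"
  then have "\<psi>' \<tau> x = 0" "G \<tau> x = 0" for x using outside by auto
  then show ?thesis by (simp add: weak_def flux_def)
qed

lemma approx_weak_limit': "(\<lambda>n. approx_weak (r n) \<tau>) \<longlonglongrightarrow> weak \<tau>"
  using approx_weak_limit[of \<tau>] approx_weak_outside[of \<tau>] weak_outside[of \<tau>] by (cases "0 \<le> \<tau>") auto

lemma weak_borel: "weak \<in> borel_measurable borel"
  by (rule borel_measurable_LIMSEQ_real[OF approx_weak_limit' approx_weak_borel])

text \<open>Three errors per unit time: freezing the time derivative and freezing the gradient of
  the test function within a step, both of order \<open>tstep n\<close>, and the inconsistency of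
  the scheme, of order \<open>eps n\<close>.\<close>

definition defect :: "nat \<Rightarrow> real" where
  "defect n = (L * M + (M + 1) * V * L) * tstep n + 10 * M * L * eps n"

lemma defect_lim: "(\<lambda>n. defect (r n)) \<longlonglongrightarrow> 0"
proof -
  have "(\<lambda>n. defect (r n)) \<longlonglongrightarrow> (L * M + (M + 1) * V * L) * 0 + 10 * M * L * 0"
    unfolding defect_def by (intro tendsto_intros tstep_r eps_r)
  then show ?thesis by simp
qed

text \<open>A discrete product rule: first the test function changes from one grid time to the next
  with the vorticity fixed, then the vorticity changes with the test function at the later time. The
  gradient at that time is finally moved to the intermediate time \<tau>.\<close>

lemma step_error:
  assumes k: "real (Suc k) * tstep n < T" and \<tau>: "real k * tstep n \<le> \<tau>" "\<tau> < real (Suc k) * tstep n"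
  shows "\<bar>(\<integral>x. F n (Suc k) x * \<psi> (real (Suc k) * tstep n) x \<partial>lborel) - (\<integral>x. F n k x * \<psi> (real k * tstep n) x \<partial>lborel) - tstep n * approx_weak n \<tau>\<bar> \<le> tstep n * defect n"
proof -
  define t t' where "t = real k * tstep n" and "t' = real (Suc k) * tstep n"
  have tp: "0 \<le> real k * tstep n" using tstep(1)[of n] by simp
  have \<tau>0: "0 \<le> \<tau>" using tp \<tau>(1) by linarith
  have h: "t' - t = tstep n" "0 \<le> t" "t \<le> \<tau>" "\<tau> \<le> t'" "t' < T" "0 \<le> t'" "t < T" "0 \<le> \<tau>" "\<tau> < T"
    using \<tau> k tstep(1)[of n] \<tau>0 by (auto simp: t_def t'_def distrib_right)
  have tindex: "tindex n \<tau> = k" using tindex_on[OF \<tau>] .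
  have approx_weak: "approx_weak n \<tau> = (\<integral>x. F n k x * \<psi>' \<tau> x \<partial>lborel) + flux c b (eps n) (F n k) (Z n k) (G \<tau>)"
    by (simp add: approx_weak_def approx_def track_def tindex)
  have h0: "0 \<le> tstep n" using tstep(1)[of n] by simp
  note Fi = bdd_L1D(3)[OF F_bdd[of n k]] and Fm = bdd_L1D(1,2)[OF F_bdd]
  have pm: "\<psi> s \<in> borel_measurable borel" if "0 \<le> s" "s < T" for s using C11_borel[OF space[OF that]] .
  have pi: "integrable lborel (\<lambda>x. F n k x * \<psi> s x)" if "0 \<le> s" "s < T" for s
    using integrable_bounded_mult[OF pm[OF that] bound(1)[OF that] Fi] by (simp add: mult.commute)
  have p'i: "integrable lborel (\<lambda>x. F n k x * \<psi>' \<tau> x)"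
    using integrable_bounded_mult[OF section_borel(1) bound(2) Fi] by (simp add: mult.commute)
  define P where "P s = (\<integral>x. F n k x * \<psi> s x \<partial>lborel)" for s
  have 1: "\<bar>P t' - P t - tstep n * (\<integral>x. F n k x * \<psi>' \<tau> x \<partial>lborel)\<bar> \<le> tstep n * (L * M * tstep n)"
  proof -
    let ?u = "\<lambda>x. \<psi> t' x - \<psi> t x - tstep n * \<psi>' \<tau> x"
    have um: "?u \<in> borel_measurable borel" using pm[OF h(6,5)] pm[OF h(2,7)] by measurable
    have ub: "\<bar>?u x\<bar> \<le> L * (tstep n)\<^sup>2" for x using time[OF h(2-5), of x] h(1) by simp
    have "P t' - P t - tstep n * (\<integral>x. F n k x * \<psi>' \<tau> x \<partial>lborel) = (\<integral>x. F n k x * \<psi> t' x - F n k x * \<psi> t x - tstep n * (F n k x * \<psi>' \<tau> x) \<partial>lborel)"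
      unfolding P_def using pi[OF h(6,5)] pi[OF h(2,7)] p'i by simp
    also have "\<dots> = (\<integral>x. ?u x * F n k x \<partial>lborel)"
      by (rule Bochner_Integration.integral_cong) (simp_all add: algebra_simps)
    finally have "\<bar>P t' - P t - tstep n * (\<integral>x. F n k x * \<psi>' \<tau> x \<partial>lborel)\<bar> \<le> L * (tstep n)\<^sup>2 * (\<integral>x. \<bar>F n k x\<bar> \<partial>lborel)"
      using integral_bounded_mult_le[OF um ub Fi] by simp
    also have "\<dots> \<le> L * (tstep n)\<^sup>2 * M" using bdd_L1D(4)[OF F_bdd] L by (intro mult_left_mono) auto
    finally show ?thesis by (simp add: power2_eq_square mult_ac)
  qed
  have 2: "\<bar>tstep n * flux c b (eps n) (F n k) (Z n k) (G t') - tstep n * flux c b (eps n) (F n k) (Z n k) (G \<tau>)\<bar> \<le> tstep n * ((M + 1) * V * L * tstep n)"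
  proof -
    let ?E = "\<lambda>x. G t' x - G \<tau> x"
    have Eb: "norm (?E x) \<le> L * tstep n" for x
    proof -
      have "norm (?E x) \<le> L * \<bar>t' - \<tau>\<bar>" by (rule grad_time[OF h(8,9) h(6,5)])
      also have "\<dots> \<le> L * tstep n" using h L by (intro mult_left_mono) auto
      finally show ?thesis .
    qed
    have Em: "?E \<in> borel_measurable borel" by measurable
    have "flux c b (eps n) (F n k) (Z n k) (G t') - flux c b (eps n) (F n k) (Z n k) (G \<tau>) = flux c b (eps n) (F n k) (Z n k) ?E"
      using flux_split(1)[OF F_bdd eps(3) section_borel(2) G_bound] unfolding flux_def
      by (subst Bochner_Integration.integral_diff[symmetric]) (auto simp: inner_diff_right right_diff_distrib)
    then have "\<bar>flux c b (eps n) (F n k) (Z n k) (G t') - flux c b (eps n) (F n k) (Z n k) (G \<tau>)\<bar> \<le> (M + 1) * V * (L * tstep n)"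
      using flux_bound[OF F_bdd eps(3) Em Eb] by simp
    then have "tstep n * \<bar>flux c b (eps n) (F n k) (Z n k) (G t') - flux c b (eps n) (F n k) (Z n k) (G \<tau>)\<bar> \<le> tstep n * ((M + 1) * V * (L * tstep n))"
      using h0 by (rule mult_left_mono)
    then show ?thesis using h0 by (simp add: abs_mult mult.assoc flip: right_diff_distrib)
  qed
  have 3: "\<bar>(\<integral>x. F n (Suc k) x * \<psi> t' x \<partial>lborel) - P t' - tstep n * flux c b (eps n) (F n k) (Z n k) (G t')\<bar> \<le> tstep n * (10 * M * L * eps n)"
    unfolding P_def by (rule F_step[OF space[OF h(6,5)] bound(1)[OF h(6,5)] section_borel(2)])
  have "\<bar>(\<integral>x. F n (Suc k) x * \<psi> t' x \<partial>lborel) - P t - tstep n * approx_weak n \<tau>\<bar> \<le> tstep n * (L * M * tstep n) + tstep n * ((M + 1) * V * L * tstep n) + tstep n * (10 * M * L * eps n)"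
    using 1 2 3 unfolding approx_weak distrib_left by linarith
  also have "\<dots> = tstep n * defect n" by (simp add: defect_def algebra_simps)
  finally show ?thesis unfolding P_def t_def t'_def .
qed

text \<open>Summing the one-step identities leaves two boundary terms. The initial one is the datum
  term; the final one vanishes once the time step is shorter than \<open>T - T'\<close>, because the
  last grid time then lies beyond the support of the test function.\<close>

lemma weak_equation: "(\<integral>\<tau>. weak \<tau> \<partial>lborel) + (\<integral>x. f0 x * \<psi> 0 x \<partial>lborel) = 0"
proof -
  have i0: "integrable lborel (\<lambda>\<tau>. indicator {0..T} \<tau> * (L * M + (M + 1) * V * L))"
    by (intro integrable_mult_left integrable_real_indicator) (use T in auto)
  have gb: "norm (approx_weak n \<tau>) \<le> indicator {0..T} \<tau> * (L * M + (M + 1) * V * L)" for n \<tau>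
    using approx_weak_bound[of n \<tau>] approx_weak_outside[of \<tau> n] T' by (auto simp: indicator_def)
  have gi: "integrable lborel (approx_weak n)" for n
  proof (rule Bochner_Integration.integrable_bound[OF i0])
    show "AE \<tau> in lborel. norm (approx_weak n \<tau>) \<le> norm (indicator {0..T} \<tau> * (L * M + (M + 1) * V * L))"
    proof (rule AE_I2)
      fix \<tau> show "norm (approx_weak n \<tau>) \<le> norm (indicator {0..T} \<tau> * (L * M + (M + 1) * V * L))"
        using gb[of n \<tau>] unfolding real_norm_def by linarith
    qed
  qed (use approx_weak_borel in simp)
  have lim1: "(\<lambda>n. \<integral>\<tau>. approx_weak (r n) \<tau> \<partial>lborel) \<longlonglongrightarrow> (\<integral>\<tau>. weak \<tau> \<partial>lborel)"
    by (rule integral_dominated_convergence[OF _ _ i0]) (use weak_borel approx_weak_borel approx_weak_limit' gb in auto)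
  have "\<forall>\<^sub>F n in sequentially. tstep (r n) < T - T'" using order_tendstoD(2)[OF tstep_r] T' by simp
  then have "\<forall>\<^sub>F n in sequentially. norm ((\<integral>x. f0 x * \<psi> 0 x \<partial>lborel) + (\<integral>\<tau>. approx_weak (r n) \<tau> \<partial>lborel)) \<le> T * \<bar>defect (r n)\<bar>"
  proof eventually_elim
    case (elim n)
    let ?m = "r n"
    \<comment> \<open>The largest index with grid time strictly below \<open>T\<close>, since the
      test function is controlled on [0,T) only; hence the ceiling minus 1 instead of a
      floor.\<close>
    define N where "N = nat (\<lceil>T / tstep ?m\<rceil> - 1)"
    have c1: "1 \<le> \<lceil>T / tstep ?m\<rceil>" using T tstep(1)[of ?m] by (simp add: one_le_ceiling)
    then have rN: "real N = of_int \<lceil>T / tstep ?m\<rceil> - 1" by (simp add: N_def)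
    have "real N < T / tstep ?m" "T / tstep ?m \<le> real N + 1" unfolding rN by linarith+
    then have N: "real N * tstep ?m < T" "T \<le> real N * tstep ?m + tstep ?m"
      using tstep(1)[of ?m] by (simp_all add: pos_less_divide_eq pos_divide_le_eq distrib_right)
    have N0: "0 \<le> real N * tstep ?m" using tstep(1)[of ?m] by simp
    have NT': "T' \<le> real N * tstep ?m" using N elim by linarith
    define A where "A k = (\<integral>x. F ?m k x * \<psi> (real k * tstep ?m) x \<partial>lborel)" for k
    have "norm (A N - A 0 - (LINT \<tau>:{0..<real N * tstep ?m}|lborel. approx_weak ?m \<tau>)) \<le> real N * tstep ?m * defect ?m"
    proof (rule telescoping_integral[OF tstep(1)])
      show "set_integrable lborel {0..<real N * tstep ?m} (approx_weak ?m)"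
        unfolding set_integrable_def by (rule integrable_mult_indicator) (use gi in auto)
      fix k \<tau> assume k: "k < N" and \<tau>: "real k * tstep ?m \<le> \<tau>" "\<tau> < real (Suc k) * tstep ?m"
      have "real (Suc k) * tstep ?m \<le> real N * tstep ?m" using k tstep(1)[of ?m] by (intro mult_right_mono) auto
      then have "real (Suc k) * tstep ?m < T" using N(1) by linarith
      from step_error[OF this \<tau>]
      show "norm (A (Suc k) - A k - tstep ?m *\<^sub>R approx_weak ?m \<tau>) \<le> tstep ?m * defect ?m" by (simp only: A_def real_norm_def real_scaleR_def)
    qed
    moreover have "A N = 0" unfolding A_def using outside(3)[OF N0 NT' N(1)] by simp
    moreover have "(LINT \<tau>:{0..<real N * tstep ?m}|lborel. approx_weak ?m \<tau>) = (\<integral>\<tau>. approx_weak ?m \<tau> \<partial>lborel)"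
      unfolding set_lebesgue_integral_def
    proof (rule Bochner_Integration.integral_cong)
      fix \<tau> show "indicator {0..<real N * tstep ?m} \<tau> *\<^sub>R approx_weak ?m \<tau> = approx_weak ?m \<tau>"
        using approx_weak_outside[of \<tau> ?m] NT' by (cases "\<tau> < 0 \<or> T' \<le> \<tau>") auto
    qed simp
    moreover have "A 0 = (\<integral>x. f0 x * \<psi> 0 x \<partial>lborel)" by (simp add: A_def)
    ultimately have "norm ((\<integral>x. f0 x * \<psi> 0 x \<partial>lborel) + (\<integral>\<tau>. approx_weak ?m \<tau> \<partial>lborel)) \<le> real N * tstep ?m * defect ?m"
      by (simp add: abs_minus_commute) 
    also have "\<dots> \<le> real N * tstep ?m * \<bar>defect ?m\<bar>" using N0 by (intro mult_left_mono) auto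
    also have "\<dots> \<le> T * \<bar>defect ?m\<bar>" using N(1) by (intro mult_right_mono) auto
    finally show ?case .
  qed
  moreover have "(\<lambda>n. T * \<bar>defect (r n)\<bar>) \<longlonglongrightarrow> 0"
    using tendsto_mult_right_zero[OF tendsto_rabs_zero[OF defect_lim], of T] by simp
  ultimately have "(\<lambda>n. (\<integral>x. f0 x * \<psi> 0 x \<partial>lborel) + (\<integral>\<tau>. approx_weak (r n) \<tau> \<partial>lborel)) \<longlonglongrightarrow> 0"
    by (rule Lim_null_comparison)
  moreover have "(\<lambda>n. (\<integral>x. f0 x * \<psi> 0 x \<partial>lborel) + (\<integral>\<tau>. approx_weak (r n) \<tau> \<partial>lborel)) \<longlonglongrightarrow> (\<integral>x. f0 x * \<psi> 0 x \<partial>lborel) + (\<integral>\<tau>. weak \<tau> \<partial>lborel)"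
    by (intro tendsto_add tendsto_const lim1)
  ultimately show ?thesis using LIMSEQ_unique by fastforce
qed

end

section \<open>Smooth test functions\<close>

text \<open>At \<open>t = 0\<close> the point is not interior, so only directions pointing forward
  in time stay inside the domain. Along those \<open>f\<close> vanishes on a short segment; the
  remaining directions follow by linearity from \<open>- h\<close>.\<close>

lemma has_derivative_zero_outside:
  fixes f :: "real \<times> 'a::euclidean_space \<Rightarrow> real"
  assumes d: "(f has_derivative D) (at p within {0..<T} \<times> UNIV)" and p: "p \<in> {0..<T} \<times> UNIV" "p \<notin> K"
    and K: "closed K" and z: "\<And>q. q \<in> {0..<T} \<times> UNIV - K \<Longrightarrow> f q = 0"
  shows "D h = 0"
proof -
  let ?S = "{0..<T} \<times> (UNIV :: 'a set)"
  interpret D: bounded_linear D using d by (rule has_derivative_bounded_linear)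
  have pos: "D h = 0" if h: "0 \<le> fst h" for h
  proof -
    have "\<forall>x\<in>- K. \<exists>e>0. ball x e \<subseteq> - K" using open_Compl[OF K] by (simp only: open_contains_ball)
    then obtain \<epsilon> where \<epsilon>: "\<epsilon> > 0" "ball p \<epsilon> \<inter> K = {}"
      using p(2) by blast
    define m where "m = min \<epsilon> (T - fst p)"
    have m: "0 < m" "m \<le> \<epsilon>" "m \<le> T - fst p" using \<epsilon> p by (auto simp: m_def)
    define N where "N = norm h + 1"
    have n1: "0 < N" "norm h \<le> N" unfolding N_def by (auto intro: add_nonneg_pos)
    \<comment> \<open>Short enough for the segment to stay both in the ball avoiding
      \<open>K\<close> and below time \<open>T\<close>; \<open>N\<close> exceeds the norm of
      \<open>h\<close> strictly, so \<open>h = 0\<close> does no harm.\<close>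
    define s where "s = m / (2 * N)"
    have s: "0 < s" using m n1 by (simp add: s_def)
    have small: "\<rho> * norm h < m" if "0 \<le> \<rho>" "\<rho> \<le> s" for \<rho>
    proof -
      have "\<rho> * norm h \<le> s * N" using that s n1 by (intro mult_mono) auto
      also have "\<dots> = m / 2" using n1 by (simp add: s_def)
      finally show ?thesis using m by simp
    qed
    have in_S: "p + \<rho> *\<^sub>R h \<in> ?S - K" if "\<rho> \<in> {0..s}" for \<rho>
    proof -
      have r: "0 \<le> \<rho>" "\<rho> \<le> s" using that by auto
      have "\<rho> * fst h \<le> \<rho> * norm h" using r norm_fst_le[of "fst h" "snd h"] by (intro mult_left_mono) auto
      then have "fst p + \<rho> * fst h < T" using small[OF r] m by linarith
      moreover have "0 \<le> fst p + \<rho> * fst h" using p r h by auto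
      moreover have "p + \<rho> *\<^sub>R h \<in> ball p \<epsilon>" using small[OF r] m r by (simp add: dist_norm)
      ultimately show ?thesis using \<epsilon>(2) by (auto simp: mem_Times_iff)
    qed
    have line: "((\<lambda>\<rho>. p + \<rho> *\<^sub>R h) has_derivative (\<lambda>\<rho>. \<rho> *\<^sub>R h)) (at 0 within {0..s})"
      by (rule derivative_eq_intros refl | simp)+
    have "(f has_derivative D) (at (p + 0 *\<^sub>R h) within (\<lambda>\<rho>. p + \<rho> *\<^sub>R h) ` {0..s})"
      using has_derivative_subset[OF d] in_S by (simp add: image_subset_iff)
    from has_derivative_in_compose[OF line this]
    have "((\<lambda>\<rho>. f (p + \<rho> *\<^sub>R h)) has_derivative (\<lambda>\<rho>. D (\<rho> *\<^sub>R h))) (at 0 within {0..s})" .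
    then have "((\<lambda>\<rho>. f (p + \<rho> *\<^sub>R h)) has_vector_derivative D h) (at 0 within {0..s})"
      by (simp add: has_vector_derivative_def D.scaleR)
    moreover have "((\<lambda>\<rho>. f (p + \<rho> *\<^sub>R h)) has_vector_derivative 0) (at 0 within {0..s})"
    proof (rule has_vector_derivative_transform[of 0 "{0..s}" _ "\<lambda>\<rho>. 0"])
      show "f (p + \<rho> *\<^sub>R h) = 0" if "\<rho> \<in> {0..s}" for \<rho> using z in_S[OF that] by auto
    qed (use s in auto)
    moreover have "at (0::real) within {0..s} \<noteq> bot" using s by (simp add: at_within_Icc_at_right)
    ultimately show "D h = 0" using vector_derivative_unique_within by blast
  qed
  show ?thesis
  proof (cases "0 \<le> fst h")
    case False
    then have "D (- h) = 0" by (intro pos) auto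
    then show ?thesis using linear_neg[OF has_derivative_linear[OF d], of h] by simp
  qed (rule pos)
qed

lemma bounded_of_support:
  fixes g :: "'a::metric_space \<Rightarrow> real"
  assumes "continuous_on S g" "compact K" "K \<subseteq> S" "\<And>q. q \<in> S - K \<Longrightarrow> g q = 0"
  obtains B where "0 \<le> B" "\<And>q. q \<in> S \<Longrightarrow> \<bar>g q\<bar> \<le> B"
proof -
  have "bounded (g ` K)"
    using assms(1-3) by (intro compact_imp_bounded compact_continuous_image) (auto intro: continuous_on_subset)
  then obtain B where B: "\<forall>y\<in>g ` K. norm y \<le> B" by (auto simp: bounded_iff)
  show ?thesis
  proof (rule that[of "max 0 B"])
    fix q assume "q \<in> S"
    then show "\<bar>g q\<bar> \<le> max 0 B" using B assms(4)[of q] by (cases "q \<in> K") auto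
  qed simp
qed

lemma linear_bound_of_Basis:
  fixes D :: "'a::euclidean_space \<Rightarrow> real"
  assumes "linear D" and B: "\<And>b. b \<in> Basis \<Longrightarrow> \<bar>D b\<bar> \<le> B b"
  shows "\<bar>D h\<bar> \<le> (\<Sum>b\<in>Basis. B b) * norm h"
proof -
  have "D h = D (\<Sum>b\<in>Basis. (h \<bullet> b) *\<^sub>R b)" by (simp add: euclidean_representation)
  also have "\<dots> = (\<Sum>b\<in>Basis. (h \<bullet> b) * D b)"
    by (simp add: linear_sum[OF assms(1)] linear_cmul[OF assms(1)])
  finally have "\<bar>D h\<bar> \<le> (\<Sum>b\<in>Basis. \<bar>(h \<bullet> b) * D b\<bar>)" by simp
  also have "\<dots> \<le> (\<Sum>b\<in>Basis. norm h * B b)"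
    unfolding abs_mult using B Basis_le_norm by (intro sum_mono mult_mono) (auto intro: order_trans[OF abs_ge_zero])
  finally show ?thesis by (simp add: sum_distrib_left mult.commute)
qed

text \<open>Directional derivatives are continuous and vanish off \<open>K\<close>, hence bounded;
  finitely many basis directions bound the whole derivative, and convexity of the slab turns this
  into a Lipschitz bound.\<close>

lemma C1_supported:
  fixes g :: "real \<times> 'a::euclidean_space \<Rightarrow> real"
  assumes g: "Ck_on (Suc 0) ({0..<T} \<times> UNIV) g" and K: "compact K" "K \<subseteq> {0..<T} \<times> UNIV"
    and z: "\<And>q. q \<in> {0..<T} \<times> UNIV - K \<Longrightarrow> g q = 0"
  obtains B where "0 \<le> B" "\<And>q. q \<in> {0..<T} \<times> UNIV \<Longrightarrow> \<bar>g q\<bar> \<le> B"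
    "\<And>p q. p \<in> {0..<T} \<times> UNIV \<Longrightarrow> q \<in> {0..<T} \<times> UNIV \<Longrightarrow> \<bar>g p - g q\<bar> \<le> B * norm (p - q)"
    "continuous_on ({0..<T} \<times> UNIV) g"
proof -
  let ?S = "{0..<T} \<times> (UNIV :: 'a set)"
  obtain D where D: "\<And>x. x \<in> ?S \<Longrightarrow> (g has_derivative D x) (at x within ?S)"
    and Dc: "\<And>h. continuous_on ?S (\<lambda>x. D x h)" using g by auto
  have c: "continuous_on ?S g" using D by (rule has_derivative_continuous_on)
  have Dz: "D q h = 0" if "q \<in> ?S - K" for q h
    by (rule has_derivative_zero_outside[OF D _ _ compact_imp_closed[OF K(1)] z]) (use that in auto)
  have "\<exists>B. 0 \<le> B \<and> (\<forall>q\<in>?S. \<bar>D q h\<bar> \<le> B)" for h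
    using bounded_of_support[OF Dc K Dz] by metis
  then obtain B where B: "\<And>h. 0 \<le> B h" "\<And>h q. q \<in> ?S \<Longrightarrow> \<bar>D q h\<bar> \<le> B h" by metis
  define A where "A = (\<Sum>b\<in>Basis. B b)"
  have A0: "0 \<le> A" unfolding A_def using B by (intro sum_nonneg) auto
  obtain B0 where B0: "0 \<le> B0" "\<And>q. q \<in> ?S \<Longrightarrow> \<bar>g q\<bar> \<le> B0" using bounded_of_support[OF c K z] by metis
  have lip: "\<bar>g p - g q\<bar> \<le> A * norm (p - q)" if "p \<in> ?S" "q \<in> ?S" for p q
  proof -
    have "norm (g p - g q) \<le> A * norm (p - q)"
    proof (rule differentiable_bound[OF _ D _ that])
      show "convex ?S" by (intro convex_Times convex_real_interval convex_UNIV)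
      fix x assume x: "x \<in> ?S"
      have "linear (D x)" using has_derivative_linear[OF D[OF x]] .
      then have "norm (D x h) \<le> A * norm h" for h
        unfolding A_def real_norm_def by (rule linear_bound_of_Basis) (rule B(2)[OF x])
      then show "onorm (D x) \<le> A" by (rule onorm_bound[OF A0])
    qed
    then show ?thesis by simp
  qed
  show ?thesis
  proof (rule that[of "max A B0"])
    fix q assume "q \<in> ?S" then show "\<bar>g q\<bar> \<le> max A B0" using B0(2)[of q] by simp
  next
    fix p q assume "p \<in> ?S" "q \<in> ?S"
    from lip[OF this] show "\<bar>g p - g q\<bar> \<le> max A B0 * norm (p - q)"
      using mult_right_mono[of A "max A B0" "norm (p - q)"] by simp
  qed (use A0 c in auto)
qed

lemma test_function_data:
  assumes T: "0 < T" and \<psi>: "\<psi> \<in> test_functions T"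
  shows "\<exists>T' L R \<psi>' G. test_data T T' L R (\<lambda>t x. \<psi> (t, x)) \<psi>' G \<and>
    (\<forall>t x. 0 \<le> t \<longrightarrow> t < T \<longrightarrow> time_deriv T \<psi> t x = \<psi>' t x \<and> grad (\<lambda>y. \<psi> (t, y)) x = G t x)"
proof -
  let ?S = "{0..<T} \<times> (UNIV :: (real^2) set)"
  obtain K where K: "compact K" "K \<subseteq> ?S" and z: "\<And>q. q \<in> ?S - K \<Longrightarrow> \<psi> q = 0"
    using \<psi> by (auto simp: test_functions_def)
  have sm: "Ck_on k ?S \<psi>" for k using \<psi> by (auto simp: test_functions_def smooth_on_def)
  \<comment> \<open>Two orders are taken because the Lipschitz bounds on the gradient and on the
    time derivative come from the second derivatives.\<close>
  obtain D where D: "\<And>x. x \<in> ?S \<Longrightarrow> (\<psi> has_derivative D x) (at x within ?S)"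
    and D1: "\<And>h. Ck_on (Suc 0) ?S (\<lambda>x. D x h)" using sm[of "Suc (Suc 0)"] by (auto simp del: Ck_on.simps(1))
  have Dz: "D q h = 0" if "q \<in> ?S - K" for q h
    by (rule has_derivative_zero_outside[OF D _ _ compact_imp_closed[OF K(1)] z]) (use that in auto)
  obtain B0 where B0: "0 \<le> B0" "\<And>q. q \<in> ?S \<Longrightarrow> \<bar>\<psi> q\<bar> \<le> B0"
    using C1_supported[OF sm K z] by metis
  have "\<exists>B. 0 \<le> B \<and> (\<forall>q\<in>?S. \<bar>D q h\<bar> \<le> B) \<and> (\<forall>p\<in>?S. \<forall>q\<in>?S. \<bar>D p h - D q h\<bar> \<le> B * norm (p - q)) \<and> continuous_on ?S (\<lambda>x. D x h)" for h
    by (rule C1_supported[OF D1 K Dz, of h]) blast+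
  then obtain B where B: "\<And>h. 0 \<le> B h" "\<And>h q. q \<in> ?S \<Longrightarrow> \<bar>D q h\<bar> \<le> B h"
    "\<And>h p q. p \<in> ?S \<Longrightarrow> q \<in> ?S \<Longrightarrow> \<bar>D p h - D q h\<bar> \<le> B h * norm (p - q)" "\<And>h. continuous_on ?S (\<lambda>x. D x h)"
    by metis
  define et :: "real \<times> (real^2)" where "et = (1, 0)"
  define L where "L = B0 + B et + (\<Sum>i\<in>Basis. B (0, i))"
  have sB: "0 \<le> (\<Sum>i\<in>(Basis::(real^2) set). B (0, i))" using B(1) by (intro sum_nonneg) auto
  have L: "B0 \<le> L" "B et \<le> L" "(\<Sum>i\<in>(Basis::(real^2) set). B (0, i)) \<le> L" "0 \<le> L" using B(1)[of et] B0(1) sB by (auto simp: L_def)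
  define \<psi>' where "\<psi>' t x = indicator ?S (t, x) * D (t, x) et" for t x
  define G0 where "G0 p = (\<Sum>i\<in>(Basis::(real^2) set). D p (0, i) *\<^sub>R i)" for p
  define G where "G t x = indicator ?S (t, x) *\<^sub>R G0 (t, x)" for t x
  have G0b: "norm (G0 p) \<le> L" if "p \<in> ?S" for p
  proof -
    have "norm (G0 p) \<le> (\<Sum>i\<in>(Basis::(real^2) set). B (0, i))"
      unfolding G0_def by (rule sum_norm_le) (use B(2)[OF that] in auto)
    then show ?thesis using L(3) by linarith
  qed
  have G0l: "norm (G0 p - G0 q) \<le> L * norm (p - q)" if "p \<in> ?S" "q \<in> ?S" for p q
  proof -
    have "G0 p - G0 q = (\<Sum>i\<in>(Basis::(real^2) set). (D p (0, i) - D q (0, i)) *\<^sub>R i)"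
      unfolding G0_def by (simp add: sum_subtractf scaleR_diff_left)
    then have "norm (G0 p - G0 q) \<le> (\<Sum>i\<in>(Basis::(real^2) set). B (0, i) * norm (p - q))"
      using B(3)[OF that] by (auto intro!: sum_norm_le)
    also have "\<dots> \<le> L * norm (p - q)" using L(3) by (simp add: mult_right_mono flip: sum_distrib_right)
    finally show ?thesis .
  qed
  have lin: "linear (D p)" if "p \<in> ?S" for p using has_derivative_linear[OF D[OF that]] .
  have inn: "D p (0, h) = G0 p \<bullet> h" if "p \<in> ?S" for p h
  proof -
    have "(0, h) = (\<Sum>i\<in>Basis. (h \<bullet> i) *\<^sub>R ((0::real), i))"
    proof (rule prod_eqI)
      show "snd (0::real, h) = snd (\<Sum>i\<in>Basis. (h \<bullet> i) *\<^sub>R ((0::real), i))"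
        by (simp add: snd_sum euclidean_representation)
      show "fst (0::real, h) = fst (\<Sum>i\<in>Basis. (h \<bullet> i) *\<^sub>R ((0::real), i))" by (simp add: fst_sum)
    qed
    then have "D p (0, h) = (\<Sum>i\<in>Basis. (h \<bullet> i) * D p (0, i))"
      by (simp only: linear_sum[OF lin[OF that]] linear_cmul[OF lin[OF that]] real_scaleR_def)
    then show ?thesis by (simp add: G0_def inner_sum_left inner_commute[of h] mult.commute)
  qed
  have dx: "((\<lambda>y. \<psi> (t, y)) has_derivative (\<lambda>h. G0 (t, x) \<bullet> h)) (at x)" if "0 \<le> t" "t < T" for t x
  proof -
    have p: "(t, x) \<in> ?S" using that by simp
    have 1: "(Pair t has_derivative Pair 0) (at x within UNIV)"
      by (rule has_derivative_eq_rhs[OF has_derivative_Pair[OF has_derivative_const has_derivative_ident]]) auto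
    have "(\<psi> has_derivative D (t, x)) (at (t, x) within Pair t ` UNIV)"
      by (rule has_derivative_subset[OF D[OF p]]) (use that in auto)
    from has_derivative_in_compose[OF 1 this] show ?thesis by (simp add: inn[OF p])
  qed
  have dt: "((\<lambda>s. \<psi> (s, x)) has_derivative (\<lambda>s. s * D (t, x) et)) (at t within S')" if "0 \<le> t" "t < T" "S' \<subseteq> {0..<T}" for t x S'
  proof -
    have p: "(t, x) \<in> ?S" using that by simp
    have 1: "((\<lambda>s. (s, x)) has_derivative (\<lambda>s. (s, 0))) (at t within S')"
      by (rule has_derivative_Pair[OF has_derivative_ident has_derivative_const])
    have "(\<psi> has_derivative D (t, x)) (at (t, x) within (\<lambda>s. (s, x)) ` S')"
      by (rule has_derivative_subset[OF D[OF p]]) (use that in auto)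
    from has_derivative_in_compose[OF 1 this]
    have "((\<lambda>s. \<psi> (s, x)) has_derivative (\<lambda>s. D (t, x) (s, 0))) (at t within S')" .
    moreover have "D (t, x) (s, 0) = s * D (t, x) et" for s
      using linear_cmul[OF lin[OF p], of s et] by (simp add: et_def)
    ultimately show ?thesis by simp
  qed
  obtain Rb where Rb: "\<And>q. q \<in> K \<Longrightarrow> norm q \<le> Rb" using compact_imp_bounded[OF K(1)] by (auto simp: bounded_iff)
  obtain m where m: "m < T" "\<And>q. q \<in> K \<Longrightarrow> fst q \<le> m"
  proof (cases "K = {}")
    case True then show ?thesis using that[of 0] T by simp
  next
    case False
    have "compact (fst ` K)" using K(1) by (intro compact_continuous_image continuous_on_fst continuous_on_id)
    then obtain u where "u \<in> fst ` K" "\<And>v. v \<in> fst ` K \<Longrightarrow> v \<le> u" using compact_attains_sup[of "fst ` K"] False by auto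
    then show ?thesis using that[of u] K(2) by auto
  qed
  \<comment> \<open>The midpoint between the last time of the support and \<open>T\<close>: the test
    function vanishes from \<open>T'\<close> on, and a gap before \<open>T\<close> remains for the
    final time step.\<close>
  define T' where "T' = (m + T) / 2"
  define R where "R = Rb + 1"
  have out: "(t, x) \<notin> K" if "T' \<le> t \<or> R \<le> norm x" for t x
  proof
    assume k: "(t, x) \<in> K"
    have "norm x \<le> norm (t, x)" using norm_snd_le[of x t] by simp
    then show False using that Rb[OF k] m(2)[OF k] m(1) by (auto simp: T'_def R_def)
  qed
  have "test_data T T' L R (\<lambda>t x. \<psi> (t, x)) \<psi>' G"
  proof
    show "0 < T" "T' < T" "0 \<le> L" using T m L by (auto simp: T'_def)
    show "C11 L (\<lambda>x. \<psi> (t, x)) (G t)" if t: "0 \<le> t" "t < T" for t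
    proof (rule C11_I)
      have p: "(t, x) \<in> ?S" for x using t by simp
      then have G: "G t x = G0 (t, x)" for x by (simp add: G_def)
      show "((\<lambda>x. \<psi> (t, x)) has_derivative (\<lambda>h. G t x \<bullet> h)) (at x)" for x unfolding G by (rule dx[OF t])
      show "norm (G t x) \<le> L" for x unfolding G by (rule G0b[OF p])
      show "norm (G t y - G t x) \<le> L * norm (y - x)" for x y
        using G0l[OF p p, of y x] unfolding G by (simp add: norm_Pair)
    qed
    show "\<bar>\<psi> (t, x)\<bar> \<le> L" if "0 \<le> t" "t < T" for t x using B0(2)[of "(t, x)"] L(1) that by simp
    show "\<bar>\<psi>' t x\<bar> \<le> L" for t x using B(2)[of "(t, x)" et] L(2,4) by (auto simp: \<psi>'_def indicator_def)
    show "\<bar>\<psi> (t', x) - \<psi> (t, x) - (t' - t) * \<psi>' \<tau> x\<bar> \<le> L * (t' - t)\<^sup>2"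
      if t: "0 \<le> t" "t \<le> \<tau>" "\<tau> \<le> t'" "t' < T" for t \<tau> t' x
    proof -
      \<comment> \<open>The mean value point need not be \<tau>; the Lipschitz bound of the time
        derivative pays for the difference.\<close>
      have "\<exists>\<xi>\<in>{t..t'}. \<psi> (t', x) - \<psi> (t, x) = (t' - t) * D (\<xi>, x) et"
      proof (rule mvt_very_simple)
        show "t \<le> t'" using t by simp
        show "((\<lambda>s. \<psi> (s, x)) has_derivative (\<lambda>s. s * D (\<xi>, x) et)) (at \<xi> within {t..t'})" if "t \<le> \<xi>" "\<xi> \<le> t'" for \<xi>
          by (rule dt) (use that t in auto)
      qed
      then obtain \<xi> where \<xi>: "\<xi> \<in> {t..t'}" "\<psi> (t', x) - \<psi> (t, x) = (t' - t) * D (\<xi>, x) et" by auto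
      have "\<bar>D (\<xi>, x) et - D (\<tau>, x) et\<bar> \<le> B et * norm ((\<xi>, x) - (\<tau>, x))" using \<xi>(1) t by (intro B(3)) auto
      also have "\<dots> \<le> L * (t' - t)"
        using \<xi>(1) t L by (intro mult_mono) (auto simp: norm_Pair)
      finally have "(t' - t) * \<bar>D (\<xi>, x) et - D (\<tau>, x) et\<bar> \<le> (t' - t) * (L * (t' - t))" using t by (intro mult_left_mono) auto
      moreover have "\<psi> (t', x) - \<psi> (t, x) - (t' - t) * \<psi>' \<tau> x = (t' - t) * (D (\<xi>, x) et - D (\<tau>, x) et)"
        unfolding \<xi>(2) using t by (simp add: \<psi>'_def right_diff_distrib)
      ultimately show ?thesis using t by (simp add: abs_mult power2_eq_square mult_ac)
    qed
    show "norm (G \<tau> x - G t x) \<le> L * \<bar>\<tau> - t\<bar>" if "0 \<le> t" "t < T" "0 \<le> \<tau>" "\<tau> < T" for t \<tau> x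
      using G0l[of "(\<tau>, x)" "(t, x)"] that by (simp add: G_def norm_Pair)
    have Dout: "D (t, x) h = 0" if "T' \<le> t \<or> R \<le> norm x" "0 \<le> t" "t < T" for t x h
      using Dz[of "(t, x)" h] out[OF that(1)] that by simp
    show "\<psi>' t x = 0" if "t < 0 \<or> T \<le> t \<or> T' \<le> t \<or> R \<le> norm x" for t x
      using that Dout[of t x et] by (cases "0 \<le> t \<and> t < T") (auto simp: \<psi>'_def)
    show "G t x = 0" if "t < 0 \<or> T \<le> t \<or> T' \<le> t \<or> R \<le> norm x" for t x
      using that Dout[of t x] by (cases "0 \<le> t \<and> t < T") (auto simp: G_def G0_def)
    show "\<psi> (t, x) = 0" if "0 \<le> t" "T' \<le> t" "t < T" for t x
      using z[of "(t, x)"] out[of t x] that by simp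
    have Sm: "?S \<in> sets borel" unfolding borel_prod[symmetric] by measurable
    show "(\<lambda>p. \<psi>' (fst p) (snd p)) \<in> borel_measurable borel"
      using borel_measurable_continuous_on_indicator[OF Sm B(4)[of et]] by (simp add: \<psi>'_def)
    have "continuous_on ?S G0" unfolding G0_def by (intro continuous_intros B(4))
    from borel_measurable_continuous_on_indicator[OF Sm this]
    show "(\<lambda>p. G (fst p) (snd p)) \<in> borel_measurable borel" by (simp add: G_def)
  qed
  moreover have "time_deriv T \<psi> t x = \<psi>' t x \<and> grad (\<lambda>y. \<psi> (t, y)) x = G t x" if t: "0 \<le> t" "t < T" for t x
  proof
    \<comment> \<open>\<open>T > 0\<close> makes [0,T) free of isolated points, so the derivative
      within it is unique, also at \<open>t = 0\<close> where it is one-sided.\<close>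
    have "at t within {0..<T} \<noteq> bot"
    proof -
      have "{0..<T} \<noteq> {a}" for a
      proof
        assume "{0..<T} = {a}"
        moreover have "0 \<in> {0..<T}" "T / 2 \<in> {0..<T}" using T by auto
        ultimately show False using T by auto
      qed
      then have "t islimpt {0..<T}" using connected_imp_perfect[of "{0..<T}" t] t by auto
      then show ?thesis by (simp add: trivial_limit_within)
    qed
    moreover have "((\<lambda>\<tau>. \<psi> (\<tau>, x)) has_vector_derivative D (t, x) et) (at t within {0..<T})"
      using dt[OF t order_refl, of x] by (simp add: has_vector_derivative_def)
    ultimately show "time_deriv T \<psi> t x = \<psi>' t x"
      unfolding time_deriv_def using t by (simp add: vector_derivative_within \<psi>'_def)
    have g: "GDERIV (\<lambda>y. \<psi> (t, y)) x :> G0 (t, x)"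
      unfolding gderiv_def using dx[OF t, of x] by (simp add: inner_commute)
    have "grad (\<lambda>y. \<psi> (t, y)) x = G0 (t, x)" unfolding grad_def
    proof (rule the_equality)
      show "GDERIV (\<lambda>y. \<psi> (t, y)) x :> G0 (t, x)" by (rule g)
      fix E assume "GDERIV (\<lambda>y. \<psi> (t, y)) x :> E"
      then have "(\<lambda>h. h \<bullet> E) = (\<lambda>h. h \<bullet> G0 (t, x))"
        using g unfolding gderiv_def by (rule has_derivative_unique)
      then have "h \<bullet> E = h \<bullet> G0 (t, x)" for h by (rule fun_cong)
      then show "E = G0 (t, x)" using vector_eq_ldot[of E "G0 (t, x)"] by blast
    qed
    then show "grad (\<lambda>y. \<psi> (t, y)) x = G t x" using t by (simp add: G_def)
  qed
  ultimately show ?thesis by (intro exI conjI allI impI) auto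
qed

section \<open>The vortex-wave system\<close>

lemma tendsto_lipschitz:
  fixes Y :: "nat \<Rightarrow> 'a::metric_space" and X :: "nat \<Rightarrow> real"
  assumes Y: "\<And>n. dist (Y n) l \<le> K * \<bar>X n - x\<bar>" and X: "X \<longlonglongrightarrow> x"
  shows "Y \<longlonglongrightarrow> l"
proof -
  have "(\<lambda>n. K * \<bar>X n - x\<bar>) \<longlonglongrightarrow> K * \<bar>x - x\<bar>" by (intro tendsto_intros X)
  then have "(\<lambda>n. K * \<bar>X n - x\<bar>) \<longlonglongrightarrow> 0" by simp
  then have "(\<lambda>n. dist (Y n) l) \<longlonglongrightarrow> 0"
    by (rule Lim_null_comparison[rotated]) (simp add: Y)
  then show ?thesis by (rule iffD2[OF tendsto_dist_iff])
qed

context limit_solution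
begin

text \<open>Pairings with bumps are Lipschitz in time; density in L^1 and the uniform bound
  \<open>C\<close> give the rest. The sequence is quantified inside the statement so that the
  induction hypotheses apply to it.\<close>

lemma \<theta>_sequentially_continuous:
  assumes \<phi>: "integrable lborel \<phi>"
  shows "\<forall>X x. (\<forall>n. 0 \<le> X n) \<longrightarrow> 0 \<le> x \<longrightarrow> X \<longlonglongrightarrow> x \<longrightarrow>
    (\<lambda>n. \<integral>y. \<theta> (X n) y * \<phi> y \<partial>lborel) \<longlonglongrightarrow> (\<integral>y. \<theta> x y * \<phi> y \<partial>lborel)"
  using \<phi>
proof (induction rule: L1_induct_bump)
  case (bump k a b)
  obtain K E where KE: "C11 K (bump k a b) E" using C11_bump by blast
  have B: "\<bar>bump k a b x\<bar> \<le> 1" for x using bump_bounds[of k a b x] by simp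
  show ?case
  proof (intro allI impI)
    fix X :: "nat \<Rightarrow> real" and x assume X: "\<forall>n. 0 \<le> X n" "0 \<le> x" "X \<longlonglongrightarrow> x"
    show "(\<lambda>n. \<integral>y. \<theta> (X n) y * bump k a b y \<partial>lborel) \<longlonglongrightarrow> (\<integral>y. \<theta> x y * bump k a b y \<partial>lborel)"
    proof (rule tendsto_lipschitz)
      show "dist (\<integral>y. \<theta> (X n) y * bump k a b y \<partial>lborel) (\<integral>y. \<theta> x y * bump k a b y \<partial>lborel) \<le> Lam * K * \<bar>X n - x\<bar>" for n
        using \<theta>_lipschitz[OF KE B bump_integrable] X by blast
    qed (rule X)
  qed
next
  case (add \<phi> \<psi>)
  have s: "(\<integral>y. \<theta> t y * (\<phi> y + \<psi> y) \<partial>lborel) = (\<integral>y. \<theta> t y * \<phi> y \<partial>lborel) + (\<integral>y. \<theta> t y * \<psi> y \<partial>lborel)" if "0 \<le> t" for t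
    using integrable_bounded_mult[OF bdd_L1D(1,2)[OF \<theta>[OF that]] add(1)] integrable_bounded_mult[OF bdd_L1D(1,2)[OF \<theta>[OF that]] add(2)]
    by (simp add: distrib_left)
  show ?case
  proof (intro allI impI)
    fix X :: "nat \<Rightarrow> real" and x assume X: "\<forall>n. 0 \<le> X n" "0 \<le> x" "X \<longlonglongrightarrow> x"
    have "(\<lambda>n. \<integral>y. \<theta> (X n) y * \<phi> y \<partial>lborel) \<longlonglongrightarrow> (\<integral>y. \<theta> x y * \<phi> y \<partial>lborel)" using add(3) X by blast
    moreover have "(\<lambda>n. \<integral>y. \<theta> (X n) y * \<psi> y \<partial>lborel) \<longlonglongrightarrow> (\<integral>y. \<theta> x y * \<psi> y \<partial>lborel)" using add(4) X by blast
    ultimately show "(\<lambda>n. \<integral>y. \<theta> (X n) y * (\<phi> y + \<psi> y) \<partial>lborel) \<longlonglongrightarrow> (\<integral>y. \<theta> x y * (\<phi> y + \<psi> y) \<partial>lborel)"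
      unfolding s[OF X(1)[rule_format]] s[OF X(2)] by (rule tendsto_add)
  qed
next
  case (scale c \<phi>)
  have "(\<integral>y. \<theta> t y * (c * \<phi> y) \<partial>lborel) = c * (\<integral>y. \<theta> t y * \<phi> y \<partial>lborel)" for t by (simp add: mult.left_commute)
  then show ?case using scale(2) by (simp add: tendsto_mult_left)
next
  case (lim \<phi>)
  show ?case
  proof (intro allI impI)
    fix X :: "nat \<Rightarrow> real" and x assume X: "\<forall>n. 0 \<le> X n" "0 \<le> x" "X \<longlonglongrightarrow> x"
    show "(\<lambda>n. \<integral>y. \<theta> (X n) y * \<phi> y \<partial>lborel) \<longlonglongrightarrow> (\<integral>y. \<theta> x y * \<phi> y \<partial>lborel)"
    proof (rule tendsto_approx)
      fix \<eta> :: real assume \<eta>: "\<eta> > 0"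
      have "\<eta> / (C + 1) > 0" using \<eta> C0 by simp
      from lim(2)[OF this] obtain g where g: "integrable lborel g" "(\<integral>x. \<bar>\<phi> x - g x\<bar> \<partial>lborel) \<le> \<eta> / (C + 1)"
        "(\<lambda>n. \<integral>y. \<theta> (X n) y * g y \<partial>lborel) \<longlonglongrightarrow> (\<integral>y. \<theta> x y * g y \<partial>lborel)" using X by blast
      have d: "dist (\<integral>y. \<theta> t y * \<phi> y \<partial>lborel) (\<integral>y. \<theta> t y * g y \<partial>lborel) \<le> \<eta>" if "0 \<le> t" for t
      proof -
        have "dist (\<integral>y. \<theta> t y * \<phi> y \<partial>lborel) (\<integral>y. \<theta> t y * g y \<partial>lborel) \<le> C * (\<integral>x. \<bar>\<phi> x - g x\<bar> \<partial>lborel)"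
          by (rule integral_mult_diff_le[OF bdd_L1D(1,2)[OF \<theta>[OF that]] lim(1) g(1)])
        also have "\<dots> \<le> C * (\<eta> / (C + 1))" using g(2) C0 by (intro mult_left_mono)
        also have "\<dots> \<le> \<eta>" using C0 \<eta> by (simp add: field_simps)
        finally show ?thesis .
      qed
      have "\<forall>\<^sub>F n in sequentially. dist (\<integral>y. \<theta> (X n) y * \<phi> y \<partial>lborel) (\<integral>y. \<theta> (X n) y * g y \<partial>lborel) \<le> \<eta>"
        using d X(1) by (intro always_eventually) auto
      moreover have "dist (\<integral>y. \<theta> x y * g y \<partial>lborel) (\<integral>y. \<theta> x y * \<phi> y \<partial>lborel) \<le> \<eta>" using d[OF X(2)] by (simp add: dist_commute)
      ultimately show "\<exists>Y m. (\<forall>\<^sub>F n in sequentially. dist (\<integral>y. \<theta> (X n) y * \<phi> y \<partial>lborel) (Y n) \<le> \<eta>) \<and> Y \<longlonglongrightarrow> m \<and> dist m (\<integral>y. \<theta> x y * \<phi> y \<partial>lborel) \<le> \<eta>"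
        using g(3) by (intro exI conjI)
    qed
  qed
qed

text \<open>This treats a general element of the predual: the L^1 part is covered by the preceding
  lemma, and for the part vanishing at infinity \<open>weak_limit_C0\<close> is applied to the
  sequence of vorticities at times tending to \<open>x\<close>.\<close>

lemma \<theta>_continuous:
  assumes \<phi>: "integrable lborel \<phi>" and g: "continuous_on UNIV g" "(g \<longlongrightarrow> 0) at_infinity"
  shows "continuous_on {0..} (\<lambda>t. \<integral>y. \<theta> t y * (\<phi> y + g y) \<partial>lborel)"
  unfolding continuous_on_sequentially comp_def
proof (intro ballI allI impI)
  fix X :: "nat \<Rightarrow> real" and x assume x: "x \<in> {0..}" and X: "(\<forall>n. X n \<in> {0..}) \<and> X \<longlonglongrightarrow> x"
  have X0: "0 \<le> X n" for n using X by auto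
  have gm: "g \<in> borel_measurable borel" by (rule borel_measurable_continuous_onI[OF g(1)])
  have "\<forall>\<^sub>F y in at_infinity. \<bar>g y\<bar> < 1" using tendstoD[OF g(2), of 1] by simp
  then obtain R where R: "\<And>y. R \<le> norm y \<Longrightarrow> \<bar>g y\<bar> < 1" by (auto simp: eventually_at_infinity)
  have "bounded (g ` cball 0 R)"
    by (intro compact_imp_bounded compact_continuous_image continuous_on_subset[OF g(1)]) auto
  then obtain B where B: "\<forall>y\<in>g ` cball 0 R. norm y \<le> B" by (auto simp: bounded_iff)
  have gb: "\<bar>g y\<bar> \<le> max 1 B" for y
  proof (cases "norm y \<le> R")
    case True
    then have "norm (g y) \<le> B" using B by auto
    then show ?thesis by simp
  next
    case False
    then show ?thesis using R[of y] by simp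
  qed
  have l1: "(\<lambda>n. \<integral>y. \<theta> (X n) y * u y \<partial>lborel) \<longlonglongrightarrow> (\<integral>y. \<theta> x y * u y \<partial>lborel)" if "integrable lborel u" for u
    using \<theta>_sequentially_continuous[OF that] x X by auto
  have x0: "0 \<le> x" using x by simp
  have l2: "(\<lambda>n. \<integral>y. \<theta> (X n) y * g y \<partial>lborel) \<longlonglongrightarrow> (\<integral>y. \<theta> x y * g y \<partial>lborel)"
    by (rule weak_limit_C0[OF \<theta>[OF X0] \<theta>[OF x0] l1 gm gb g(2)])
  have s: "(\<integral>y. \<theta> t y * (\<phi> y + g y) \<partial>lborel) = (\<integral>y. \<theta> t y * \<phi> y \<partial>lborel) + (\<integral>y. \<theta> t y * g y \<partial>lborel)" if "0 \<le> t" for t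
  proof -
    have "integrable lborel (\<lambda>y. \<theta> t y * g y)"
      using integrable_bounded_mult[OF gm gb bdd_L1D(3)[OF \<theta>[OF that]]] by (simp add: mult.commute)
    then show ?thesis
      using integrable_bounded_mult[OF bdd_L1D(1,2)[OF \<theta>[OF that]] \<phi>] by (simp add: distrib_left)
  qed
  show "(\<lambda>n. \<integral>y. \<theta> (X n) y * (\<phi> y + g y) \<partial>lborel) \<longlonglongrightarrow> (\<integral>y. \<theta> x y * (\<phi> y + g y) \<partial>lborel)"
    unfolding s[OF X0] s[OF x0] by (rule tendsto_add[OF l1[OF \<phi>] l2])
qed

end

section \<open>Borel representatives of Lebesgue measurable functions\<close>

lemma integral_lebesgue_eq_lborel:
  fixes f :: "'a::euclidean_space \<Rightarrow> 'b::{banach,second_countable_topology}"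
  assumes "g \<in> borel_measurable borel" "f \<in> borel_measurable lebesgue" "AE x in lborel. f x = g x"
  shows "integral\<^sup>L lebesgue f = integral\<^sup>L lborel g"
proof -
  have gl: "g \<in> borel_measurable lebesgue" using measurable_completion[of g lborel borel] assms(1) by simp
  have "integral\<^sup>L lebesgue f = integral\<^sup>L lebesgue g"
    by (rule integral_cong_AE[OF assms(2) gl AE_completion[OF assms(3)]])
  also have "\<dots> = integral\<^sup>L lborel g" by (rule integral_completion) (use assms(1) in simp)
  finally show ?thesis .
qed

lemma integral_lebesgue_borel:
  fixes g :: "'a::euclidean_space \<Rightarrow> 'b::{banach,second_countable_topology}"
  shows "g \<in> borel_measurable borel \<Longrightarrow> integral\<^sup>L lebesgue g = integral\<^sup>L lborel g"
  by (rule integral_completion) simp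

lemma borel_version:
  fixes f :: "'a::euclidean_space \<Rightarrow> real"
  assumes "f \<in> borel_measurable lebesgue"
  obtains g where "g \<in> borel_measurable borel" "AE x in lborel. f x = g x"
  using completion_ex_borel_measurable_real[OF assms] by auto

lemma Lp_1_integrable:
  fixes f :: "'a::euclidean_space \<Rightarrow> real"
  assumes f: "f \<in> Lp 1" and g: "g \<in> borel_measurable borel" "AE x in lborel. f x = g x"
  shows "integrable lborel g"
proof (rule integrableI_bounded)
  have fm: "f \<in> borel_measurable lebesgue" and fn: "Lp_norm 1 f < \<infinity>" using f by (auto simp: Lp_def)
  have "(\<integral>\<^sup>+x. ennreal (norm (g x)) \<partial>lborel) = (\<integral>\<^sup>+x. ennreal (norm (g x)) \<partial>lebesgue)"
    using g(1) by (subst nn_integral_completion) auto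
  also have "\<dots> = (\<integral>\<^sup>+x. ennreal (\<bar>f x\<bar> powr 1) \<partial>lebesgue)"
    using AE_completion[OF g(2)] by (intro nn_integral_cong_AE) auto
  also have "\<dots> < \<infinity>"
  proof (rule ccontr)
    assume "\<not> (\<integral>\<^sup>+x. ennreal (\<bar>f x\<bar> powr 1) \<partial>lebesgue) < \<infinity>"
    then have "(\<integral>\<^sup>+x. ennreal (\<bar>f x\<bar> powr 1) \<partial>lebesgue) = \<infinity>"
      unfolding infinity_ennreal_def less_top[symmetric] by (rule notnotD)
    then have "Lp_norm 1 f = \<infinity>" by (simp add: Lp_norm_def)
    then show False using fn by simp
  qed
  finally show "(\<integral>\<^sup>+x. ennreal (norm (g x)) \<partial>lborel) < \<infinity>" .
qed (use g(1) in simp)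

lemma Lp_norm_le:
  fixes f g :: "'a::euclidean_space \<Rightarrow> real"
  assumes p: "1 \<le> p" and f: "f \<in> borel_measurable lebesgue"
    and inf: "AE x in lebesgue. ennreal \<bar>f x\<bar> \<le> Lp_norm \<infinity> g"
    and fin: "\<And>r. 1 \<le> r \<Longrightarrow> (\<integral>\<^sup>+x. ennreal (\<bar>f x\<bar> powr r) \<partial>lebesgue) \<le> (\<integral>\<^sup>+x. ennreal (\<bar>g x\<bar> powr r) \<partial>lebesgue)"
  shows "Lp_norm p f \<le> Lp_norm p g"
proof (cases "p = \<infinity>")
  case True
  have "Lp_norm \<infinity> f \<le> Lp_norm \<infinity> g"
    unfolding Lp_norm_def[of \<infinity> f] using f inf by (simp add: esssup_I)
  then show ?thesis by (simp add: True)
next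
  case False
  define r where "r = enn2real p"
  have pr: "p = ennreal r" using False by (simp add: r_def top.not_eq_extremum)
  have r: "1 \<le> r" using p unfolding pr by (metis ennreal_1 ennreal_le_iff2 not_one_le_zero zero_less_one less_le_not_le linear)
  let ?If = "\<integral>\<^sup>+x. ennreal (\<bar>f x\<bar> powr r) \<partial>lebesgue" and ?Ig = "\<integral>\<^sup>+x. ennreal (\<bar>g x\<bar> powr r) \<partial>lebesgue"
  have le: "?If \<le> ?Ig" by (rule fin[OF r])
  have N: "Lp_norm p h = (if (\<integral>\<^sup>+x. ennreal (\<bar>h x\<bar> powr r) \<partial>lebesgue) = \<infinity> then \<infinity>
      else ennreal (enn2real (\<integral>\<^sup>+x. ennreal (\<bar>h x\<bar> powr r) \<partial>lebesgue) powr (1 / r)))" for h :: "'a \<Rightarrow> real"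
    using False by (simp add: Lp_norm_def Let_def r_def)
  show ?thesis
  proof (cases "?Ig = \<infinity>")
    case True
    then show ?thesis by (simp add: N)
  next
    case False
    then have If: "?If \<noteq> \<infinity>" using le by (auto simp: top_unique)
    have "enn2real ?If \<le> enn2real ?Ig" using le False by (intro enn2real_mono) (auto simp: top.not_eq_extremum)
    then have "enn2real ?If powr (1 / r) \<le> enn2real ?Ig powr (1 / r)" using r by (intro powr_mono2) auto
    then show ?thesis unfolding N using If False by (simp add: ennreal_leI)
  qed
qed

theorem theorem1p3:
  fixes s :: real and \<theta>\<^sub>0 :: "real^2 \<Rightarrow> real" and z\<^sub>0 :: "real^2"
  assumes "1 / 2 < s" and "s < 1"
    and "\<theta>\<^sub>0 \<in> L1_Linf"
  shows "\<exists>(\<theta> :: real \<Rightarrow> real^2 \<Rightarrow> real) (z :: real \<Rightarrow> real^2).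
    \<theta> \<in> Linf_time_L1_Linf \<and>
    continuous_on {0..} z \<and>
    (\<forall>T>0. \<forall>\<psi>\<in>test_functions T.
       (LINT t:{0..T}|lebesgue. (LINT x|lebesgue.
          \<theta> t x * (time_deriv T \<psi> t x
                   + (velocity s \<theta> t x + vortex_field s z t x) \<bullet> grad (\<lambda>y. \<psi> (t, y)) x)))
       + (LINT x|lebesgue. \<theta>\<^sub>0 x * \<psi> (0, x)) = 0) \<and>
    (\<forall>t\<ge>0. z t = z\<^sub>0 + (LINT \<tau>:{0..t}|lebesgue. velocity s \<theta> \<tau> (z \<tau>))) \<and>
    (\<forall>t\<ge>0. \<forall>p\<ge>1. Lp_norm p (\<theta> t) \<le> Lp_norm p \<theta>\<^sub>0) \<and>
    continuous_map (top_of_set {0..}) weak_star_L1_Linf \<theta>"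
proof -
  have \<theta>m: "\<theta>\<^sub>0 \<in> borel_measurable lebesgue" and \<theta>1: "\<theta>\<^sub>0 \<in> Lp 1" "Lp_norm 1 \<theta>\<^sub>0 < \<infinity>" and \<theta>inf: "Lp_norm \<infinity> \<theta>\<^sub>0 < \<infinity>"
    using assms(3) by (auto simp: L1_Linf_def Lp_def)
  define C where "C = enn2real (Lp_norm \<infinity> \<theta>\<^sub>0)"
  have C: "Lp_norm \<infinity> \<theta>\<^sub>0 = ennreal C" "0 \<le> C" using \<theta>inf by (auto simp: C_def)
  obtain g where g: "g \<in> borel_measurable borel" "AE x in lborel. \<theta>\<^sub>0 x = g x" by (rule borel_version[OF \<theta>m])
  \<comment> \<open>Truncating the Borel representative at the essential supremum makes the bound
    hold everywhere and alters it on a null set only.\<close>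
  define f0 where "f0 x = max (- C) (min C (g x))" for x
  have f0m: "f0 \<in> borel_measurable borel" unfolding f0_def using g(1) by measurable
  have f0C: "\<bar>f0 x\<bar> \<le> C" for x using C(2) by (auto simp: f0_def)
  have "AE x in lebesgue. ennreal \<bar>\<theta>\<^sub>0 x\<bar> \<le> Lp_norm \<infinity> \<theta>\<^sub>0"
    unfolding Lp_norm_def by (simp add: esssup_AE)
  then have ae1: "AE x in lborel. \<bar>\<theta>\<^sub>0 x\<bar> \<le> C" unfolding AE_completion_iff C(1) using C(2) by simp
  have ae: "AE x in lborel. \<theta>\<^sub>0 x = f0 x"
    using g(2) ae1 by eventually_elim (auto simp: f0_def)
  have f0i: "integrable lborel f0" by (rule Lp_1_integrable[OF \<theta>1(1) f0m ae])
  define M where "M = (\<integral>x. \<bar>f0 x\<bar> \<partial>lborel)"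
  have f0: "bdd_L1 C M f0" unfolding bdd_L1_def M_def using f0m f0C f0i by auto
  define b c where "b = 4 - 2 * s" and "c = c_const s"
  interpret scheme c b C M f0 z\<^sub>0
  proof unfold_locales
    show "2 < b" "b < 3" using assms(1,2) by (auto simp: b_def)
    show "bdd_L1 C M f0" by (rule f0)
  qed
  obtain r \<theta> z where r: "strict_mono r" and joint: "(\<lambda>(t, x). \<theta> t x) \<in> borel_measurable lebesgue"
    and th\<theta>: "\<And>t. 0 \<le> t \<Longrightarrow> bdd_L1 C M (\<theta> t)"
    and l\<theta>: "\<And>t \<phi>. 0 \<le> t \<Longrightarrow> integrable lborel \<phi> \<Longrightarrow> (\<lambda>n. \<integral>x. approx (r n) t x * \<phi> x \<partial>lborel) \<longlonglongrightarrow> (\<integral>x. \<theta> t x * \<phi> x \<partial>lborel)"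
    and lz: "\<And>t. 0 \<le> t \<Longrightarrow> (\<lambda>n. track (r n) t) \<longlonglongrightarrow> z t"
    and powr: "\<And>t p. 0 \<le> t \<Longrightarrow> 1 \<le> p \<Longrightarrow> (\<integral>\<^sup>+x. ennreal (\<bar>\<theta> t x\<bar> powr p) \<partial>lborel) \<le> (\<integral>\<^sup>+x. ennreal (\<bar>f0 x\<bar> powr p) \<partial>lborel)"
  proof (rule extraction, goal_cases)
    case (1 r \<theta> z)
    show thesis by (rule 1(1)[of r \<theta> z]) (fact 1)+
  qed
  interpret limit_solution c b C M f0 z\<^sub>0 r \<theta> z
  proof unfold_locales
    show "strict_mono r" by (rule r)
    show "bdd_L1 C M (\<theta> t)" if "0 \<le> t" for t by (rule th\<theta>[OF that])
    show "(\<lambda>n. \<integral>x. approx (r n) t x * \<phi> x \<partial>lborel) \<longlonglongrightarrow> (\<integral>x. \<theta> t x * \<phi> x \<partial>lborel)" if "0 \<le> t" "integrable lborel \<phi>" for t \<phi>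
      by (rule l\<theta>[OF that])
    show "(\<lambda>n. track (r n) t) \<longlonglongrightarrow> z t" if "0 \<le> t" for t by (rule lz[OF that])
  qed
  have \<theta>b: "\<theta> t \<in> borel_measurable borel" if "0 \<le> t" for t using bdd_L1D(1)[OF th\<theta>[OF that]] .
  have \<theta>l: "\<theta> t \<in> borel_measurable lebesgue" if "0 \<le> t" for t
    using measurable_completion[of "\<theta> t" lborel borel] \<theta>b[OF that] by simp
  have K: "K_kernel s = kern c b 0" unfolding b_def c_def by (rule K_kernel_eq)
  have vel: "velocity s \<theta> t x = vel c b 0 (\<theta> t) x" if "0 \<le> t" for t x
    unfolding velocity_def convol_def vel_def K
    by (rule integral_lebesgue_borel) (use \<theta>b[OF that] in measurable)
  \<comment> \<open>For p infinite the bound is pointwise, because \<open>C\<close> is exactly the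
    sup norm of the datum; finite exponents use the integral inequalities that survived the weak
    limit.\<close>
  have Lp: "Lp_norm p (\<theta> t) \<le> Lp_norm p \<theta>\<^sub>0" if t: "0 \<le> t" and p: "1 \<le> p" for t p
  proof (rule Lp_norm_le[OF p \<theta>l[OF t]])
    show "AE x in lebesgue. ennreal \<bar>\<theta> t x\<bar> \<le> Lp_norm \<infinity> \<theta>\<^sub>0"
      unfolding C(1) using bdd_L1D(2)[OF th\<theta>[OF t]] by (intro AE_I2 ennreal_leI)
    fix q :: real assume q: "1 \<le> q"
    have "(\<integral>\<^sup>+x. ennreal (\<bar>\<theta> t x\<bar> powr q) \<partial>lebesgue) = (\<integral>\<^sup>+x. ennreal (\<bar>\<theta> t x\<bar> powr q) \<partial>lborel)"
      using \<theta>b[OF t] by (subst nn_integral_completion) auto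
    also have "\<dots> \<le> (\<integral>\<^sup>+x. ennreal (\<bar>f0 x\<bar> powr q) \<partial>lborel)" by (rule powr[OF t q])
    also have "\<dots> = (\<integral>\<^sup>+x. ennreal (\<bar>f0 x\<bar> powr q) \<partial>lebesgue)" using f0m by (subst nn_integral_completion) auto
    also have "\<dots> = (\<integral>\<^sup>+x. ennreal (\<bar>\<theta>\<^sub>0 x\<bar> powr q) \<partial>lebesgue)"
      using AE_completion[OF ae] by (intro nn_integral_cong_AE) auto
    finally show "(\<integral>\<^sup>+x. ennreal (\<bar>\<theta> t x\<bar> powr q) \<partial>lebesgue) \<le> (\<integral>\<^sup>+x. ennreal (\<bar>\<theta>\<^sub>0 x\<bar> powr q) \<partial>lebesgue)" .
  qed
  have mem: "\<theta> t \<in> L1_Linf" if t: "0 \<le> t" for t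
    using le_less_trans[OF Lp[OF t] \<theta>1(2)] le_less_trans[OF Lp[OF t] \<theta>inf] \<theta>l[OF t] by (simp add: L1_Linf_def Lp_def)
  have c1: "\<theta> \<in> Linf_time_L1_Linf"
    unfolding Linf_time_L1_Linf_def mem_Collect_eq
  proof (intro conjI exI[of _ "Lp_norm 1 \<theta>\<^sub>0 + Lp_norm \<infinity> \<theta>\<^sub>0"])
    show "(\<lambda>(t, x). \<theta> t x) \<in> borel_measurable (lebesgue_on ({0..} \<times> UNIV))"
      by (rule measurable_restrict_space1[OF joint])
    show "Lp_norm 1 \<theta>\<^sub>0 + Lp_norm \<infinity> \<theta>\<^sub>0 < \<infinity>" using \<theta>1(2) \<theta>inf by simp
    show "AE t in lebesgue_on {0..}. \<theta> t \<in> L1_Linf \<and> Lp_norm 1 (\<theta> t) + Lp_norm \<infinity> (\<theta> t) \<le> Lp_norm 1 \<theta>\<^sub>0 + Lp_norm \<infinity> \<theta>\<^sub>0"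
    proof (rule AE_I2)
      fix t :: real assume "t \<in> Sigma_Algebra.space (lebesgue_on {0..})"
      then have t: "0 \<le> t" by simp
      show "\<theta> t \<in> L1_Linf \<and> Lp_norm 1 (\<theta> t) + Lp_norm \<infinity> (\<theta> t) \<le> Lp_norm 1 \<theta>\<^sub>0 + Lp_norm \<infinity> \<theta>\<^sub>0"
        using mem[OF t] Lp[OF t] by (auto intro!: add_mono)
    qed
  qed
  have c2: "continuous_on {0..} z"
  proof (rule continuous_on_sequentiallyI)
    fix X :: "nat \<Rightarrow> real" and x assume X: "\<forall>n. X n \<in> {0..}" "x \<in> {0..}" "X \<longlonglongrightarrow> x"
    show "(\<lambda>n. z (X n)) \<longlonglongrightarrow> z x"
    proof (rule tendsto_lipschitz)
      show "dist (z (X n)) (z x) \<le> V * \<bar>X n - x\<bar>" for n using z_lipschitz X by auto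
    qed (rule X)
  qed
  have c3: "(LINT t:{0..T}|lebesgue. (LINT x|lebesgue.
          \<theta> t x * (time_deriv T \<psi> t x + (velocity s \<theta> t x + vortex_field s z t x) \<bullet> grad (\<lambda>y. \<psi> (t, y)) x)))
       + (LINT x|lebesgue. \<theta>\<^sub>0 x * \<psi> (0, x)) = 0" if T: "0 < T" and \<psi>: "\<psi> \<in> test_functions T" for T \<psi>
  proof -
    obtain T' L R \<psi>' G where td: "test_data T T' L R (\<lambda>t x. \<psi> (t, x)) \<psi>' G"
      and der: "\<And>t x. 0 \<le> t \<Longrightarrow> t < T \<Longrightarrow> time_deriv T \<psi> t x = \<psi>' t x"
        "\<And>t x. 0 \<le> t \<Longrightarrow> t < T \<Longrightarrow> grad (\<lambda>y. \<psi> (t, y)) x = G t x"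
      using test_function_data[OF T \<psi>] by auto
    interpret td: test_data T T' L R "\<lambda>t x. \<psi> (t, x)" \<psi>' G by (rule td)
    interpret wf: weak_form c b C M f0 z\<^sub>0 r \<theta> z T T' L R "\<lambda>t x. \<psi> (t, x)" \<psi>' G ..
    define I where "I t = (LINT x|lebesgue. \<theta> t x * (time_deriv T \<psi> t x + (velocity s \<theta> t x + vortex_field s z t x) \<bullet> grad (\<lambda>y. \<psi> (t, y)) x))" for t
    have I: "I t = wf.weak t" if t: "0 \<le> t" "t < T" for t
    proof -
      note [measurable] = \<theta>b[OF t(1)] td.section_borel
      have "I t = (LINT x|lebesgue. \<theta> t x * (\<psi>' t x + (vel c b 0 (\<theta> t) x + kern c b 0 (x - z t)) \<bullet> G t x))"
        unfolding I_def by (simp add: der[OF t] vel[OF t(1)] vortex_field_def K)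
      also have "\<dots> = (\<integral>x. \<theta> t x * (\<psi>' t x + (vel c b 0 (\<theta> t) x + kern c b 0 (x - z t)) \<bullet> G t x) \<partial>lborel)"
        by (rule integral_lebesgue_borel) measurable
      also have "\<dots> = wf.weak t"
        unfolding wf.weak_def flux_def distrib_left
        by (rule Bochner_Integration.integral_add
            [OF integrable_bounded_mult[OF bdd_L1D(1,2)[OF th\<theta>[OF t(1)]] td.section_integrable(1)]
              flux_split(1)[OF th\<theta>[OF t(1)] order_refl td.section_borel(2) td.G_bound]])
      finally show ?thesis .
    qed
    have "(LINT t:{0..T}|lebesgue. I t) = integral\<^sup>L lborel wf.weak"
      unfolding set_lebesgue_integral_def
    proof (rule integral_lebesgue_eq_lborel[OF wf.weak_borel])
      \<comment> \<open>At \<open>t = T\<close> the derivatives of the test function are not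
        controlled, so \<open>I T\<close> is an arbitrary number; it is isolated as the value at a
        single point.\<close>
      have e: "indicator {0..T} t *\<^sub>R I t = (if t = T then I T else wf.weak t)" for t
      proof (cases "0 \<le> t \<and> t < T")
        case True
        then show ?thesis using I[of t] by simp
      next
        case False
        then have "wf.weak t = 0" using wf.weak_outside[of t] td.T' by auto
        then show ?thesis using False T by (auto simp: indicator_def)
      qed
      have "(\<lambda>t. if t = T then I T else wf.weak t) \<in> borel_measurable borel"
        by (rule measurable_If) (simp_all add: wf.weak_borel)
      then show "(\<lambda>t. indicator {0..T} t *\<^sub>R I t) \<in> borel_measurable lebesgue"
        unfolding e by (intro measurable_completion) simp
      show "AE t in lborel. indicator {0..T} t *\<^sub>R I t = wf.weak t"
        unfolding e using AE_lborel_singleton[of T] by eventually_elim auto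
    qed
    moreover have "(LINT x|lebesgue. \<theta>\<^sub>0 x * \<psi> (0, x)) = (\<integral>x. f0 x * \<psi> (0, x) \<partial>lborel)"
    proof (rule integral_lebesgue_eq_lborel)
      have pm: "(\<lambda>x. \<psi> (0, x)) \<in> borel_measurable borel" using C11_borel[OF td.space[of 0]] T by simp
      then show "(\<lambda>x. f0 x * \<psi> (0, x)) \<in> borel_measurable borel" using f0m by measurable
      have "(\<lambda>x. \<psi> (0, x)) \<in> borel_measurable lebesgue" using measurable_completion[of "\<lambda>x. \<psi> (0, x)" lborel borel] pm by simp
      then show "(\<lambda>x. \<theta>\<^sub>0 x * \<psi> (0, x)) \<in> borel_measurable lebesgue" using \<theta>m by measurable
      show "AE x in lborel. \<theta>\<^sub>0 x * \<psi> (0, x) = f0 x * \<psi> (0, x)" using ae by eventually_elim simp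
    qed
    ultimately show ?thesis using wf.weak_equation unfolding I_def by simp
  qed
  have c4: "z t = z\<^sub>0 + (LINT \<tau>:{0..t}|lebesgue. velocity s \<theta> \<tau> (z \<tau>))" if t: "0 \<le> t" for t
  proof -
    \<comment> \<open>The velocity is identified at nonnegative times only; the inner indicator lets
      the measurability of its cut-off version be used.\<close>
    have e: "indicator {0..t} \<tau> *\<^sub>R velocity s \<theta> \<tau> (z \<tau>) = indicator {0..t} \<tau> *\<^sub>R (indicator {0..} \<tau> *\<^sub>R vel c b 0 (\<theta> \<tau>) (z \<tau>))" for \<tau>
      using vel[of \<tau> "z \<tau>"] by (auto simp: indicator_def)
    have e': "indicator {0..t} \<tau> *\<^sub>R (indicator {0..} \<tau> *\<^sub>R vel c b 0 (\<theta> \<tau>) (z \<tau>)) = indicator {0..t} \<tau> *\<^sub>R vel c b 0 (\<theta> \<tau>) (z \<tau>)" for \<tau>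
      by (auto simp: indicator_def)
    have "(LINT \<tau>:{0..t}|lebesgue. velocity s \<theta> \<tau> (z \<tau>)) = (LINT \<tau>:{0..t}|lborel. vel c b 0 (\<theta> \<tau>) (z \<tau>))"
      unfolding set_lebesgue_integral_def e e'[symmetric]
      by (rule integral_lebesgue_borel) (use velocity_borel in measurable)
    then show ?thesis using z_equation[OF t] by simp
  qed
  have c6: "continuous_map (top_of_set {0..}) weak_star_L1_Linf \<theta>"
    unfolding weak_star_L1_Linf_def
  proof (rule continuous_map_pullback')
    show "topspace (top_of_set {0..}) \<subseteq> \<theta> -` L1_Linf" using mem by auto
    show "continuous_map (top_of_set {0..}) (product_topology (\<lambda>_. euclideanreal) predual_L1_Linf)
       ((\<lambda>f. \<lambda>\<phi>\<in>predual_L1_Linf. LINT x|lebesgue. f x * \<phi> x) \<circ> \<theta>)"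
      unfolding continuous_map_componentwise
    proof (intro conjI ballI)
      fix \<phi> :: "real^2 \<Rightarrow> real" assume \<phi>: "\<phi> \<in> predual_L1_Linf"
      then obtain u v where uv: "\<phi> = (\<lambda>x. u x + v x)" "u \<in> Lp 1" "v \<in> C0_space" by (auto simp: predual_L1_Linf_def)
      have um: "u \<in> borel_measurable lebesgue" using uv(2) by (simp add: Lp_def)
      obtain w where w: "w \<in> borel_measurable borel" "AE x in lborel. u x = w x" by (rule borel_version[OF um])
      have wi: "integrable lborel w" by (rule Lp_1_integrable[OF uv(2) w])
      have v: "continuous_on UNIV v" "(v \<longlongrightarrow> 0) at_infinity" using uv(3) by (auto simp: C0_space_def)
      have vm: "v \<in> borel_measurable borel" by (rule borel_measurable_continuous_onI[OF v(1)])
      have eq: "(LINT x|lebesgue. \<theta> t x * \<phi> x) = (\<integral>x. \<theta> t x * (w x + v x) \<partial>lborel)" if t: "t \<in> {0..}" for t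
      proof (rule integral_lebesgue_eq_lborel)
        have t0: "0 \<le> t" using t by simp
        show "(\<lambda>x. \<theta> t x * (w x + v x)) \<in> borel_measurable borel" using \<theta>b[OF t0] w(1) vm by measurable
        have "v \<in> borel_measurable lebesgue" using measurable_completion[of v lborel borel] vm by simp
        then show "(\<lambda>x. \<theta> t x * \<phi> x) \<in> borel_measurable lebesgue" unfolding uv(1) using \<theta>l[OF t0] um by measurable
        show "AE x in lborel. \<theta> t x * \<phi> x = \<theta> t x * (w x + v x)" using w(2) by eventually_elim (simp add: uv(1))
      qed
      have "continuous_on {0..} (\<lambda>t. LINT x|lebesgue. \<theta> t x * \<phi> x)"
        by (rule continuous_on_eq[OF \<theta>_continuous[OF wi v] eq[symmetric]])
      then show "continuous_map (top_of_set {0..}) euclideanreal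
         (\<lambda>t. ((\<lambda>f. \<lambda>\<phi>\<in>predual_L1_Linf. LINT x|lebesgue. f x * \<phi> x) \<circ> \<theta>) t \<phi>)"
        using \<phi> by simp
    qed auto
  qed
  show ?thesis
    by (intro exI[of _ \<theta>] exI[of _ z] conjI allI ballI impI c1 c2 c3 c4 Lp c6)
qed

end
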